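(* Assume (A1)–(A5) and that the Dirichlet problem $$H(x,\nabla u(x),u(x))=0,\ x\in G;\qquad u(x)=\tilde\sigma(x),\ x\in\partial G,$$ has a unique minimax solution $u$. Then the differential game with exit time has a value function $\operatorname{Val}$, i.e. $J_1^0(x_0)=J_2^0(x_0)=:\operatorname{Val}(x_0)$ for every $x_0\in G$, and $$u(x)=1-e^{-\operatorname{Val}(x)},\qquad x\in G$$ (with $e^{-\infty}=0$).
   Context: Setting. $P,Q$ are compact sets; $M_1,M_2\subset\mathbb{R}^d$ are closed sets with continuous boundaries $\mathcal M_1=\partial M_1$, $\mathcal M_2=\partial M_2$, at strictly positive distance from each other; $G=\mathbb{R}^d\setminus(M_1\cup M_2)$, $\partial G=\mathcal M_1\cup\mathcal M_2$. Data: $f:\mathbb{R}^d\times P\times Q\to\mathbb{R}^d$, $g:\mathbb{R}^d\to\mathbb{R}$, $\sigma:\partial G\to[0,+\infty]$. The dynamics is $\dot x(t)=f(x(t),p(t),q(t))$, $x(0)=x_0$, $p(t)\in P$, $q(t)\in Q$; the payoff is $\int_0^{\tau}g(x(t))\,dt+\sigma(x(\tau))$, where $\tau$ is the first time $x(\cdot)$ reaches $M_1\cup M_2$ (payoff $+\infty$ if $\tau=+\infty$); the first player (control $p$) minimizes and the second player (control $q$) maximizes. Assumptions: (A1) $f,g$ are continuous and $\|f(x,p,q)\|\le R_f(1+\|x\|)$ for all $(x,p,q)$, for some constant $R_f$; (A2) $\|f(x+y,p,q)-f(x,p,q)\|+|g(x+y)-g(x)|\le\lambda\|y\|$ for all $x,y\in\mathbb{R}^d$,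 $p\in P$, $q\in Q$; (A3) $\min_{p}\max_{q}\langle s,f(x,p,q)\rangle=\max_{q}\min_{p}\langle s,f(x,p,q)\rangle$ for all $s,x\in\mathbb{R}^d$; (A4) there is $b>0$ with $g(x)\ge b$ for all $x\in\mathbb{R}^d$; (A5) there is $\Sigma>0$ such that $\sigma\in[0,\Sigma]$ on $\mathcal M_1$, $\sigma=+\infty$ on $\mathcal M_2$, and $\sigma$ is Lipschitz continuous on $\mathcal M_1$ with some constant $L$. Extension of $\sigma$. $M_i^\varepsilon=\{x+y:x\in\mathcal M_i,\ \|y\|\le\varepsilon\}$, $i=1,2$. For each (small) $\varepsilon>0$, $\hat\sigma$ denotes a fixed extension of $\sigma$ to $\mathrm{cl}\,G$ with $\hat\sigma=\sigma$ on $\mathcal M_1$, $\hat\sigma$ Lipschitz continuous with values in $[0,\Sigma]$ off $M_2^\varepsilon$, and $\hat\sigma=+\infty$ on $M_2^\varepsilon$; for example, off $M_2^\varepsilon$, $\hat\sigma(x)=\max[\sup\{\sigma(y)-L\|x-y\|:y\in\mathcal M_1\},0]$. $\tilde\sigma=1-e^{-\hat\sigma}$; on $\partial G$ it equals $1-e^{-\sigma}$. Hamiltonian: $H(x,s,z)=\min_{p\in P}\max_{q\in Q}\langle s,f(x,p,q)\rangle+g(x)(1-z)$. Minimax solution. For $u:\mathrm{cl}\,G\to\mathbb{R}$, $x\in G$, $\bar f\in\mathbb{R}^d$, $d^+u(x;\bar f)$ (resp. $d^-u(x;\bar f)$) is the limit as $\rho\downarrow0$ of the supremum (resp. infimum)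 of $\frac{u(x+\delta f')-u(x)}{\delta}$ over $(\delta,f')\in(0,\rho)\times\mathbb{R}^d$ with $\|\bar f-f'\|\le\rho$, $x+\delta f'\in G$. Let $E^+(x,z,q)=\mathrm{co}\{(f(x,p,q),g(x)(z-1)):p\in P\}$ and $E^-(x,z,p)=\mathrm{co}\{(f(x,p,q),g(x)(z-1)):q\in Q\}$ ($\mathrm{co}$ = convex hull). A supersolution is a bounded lower semicontinuous $u:\mathrm{cl}\,G\to\mathbb{R}$ with $u=\tilde\sigma$ on $\partial G$ and $\inf\{d^-u(x;\bar f)-\bar g:(\bar f,\bar g)\in E^+(x,u(x),q)\}\le0$ for all $x\in G$, $q\in Q$. A subsolution is a bounded upper semicontinuous $u:\mathrm{cl}\,G\to\mathbb{R}$ with $u=\tilde\sigma$ on $\partial G$, continuous at each point of $\partial G$, and $\sup\{d^+u(x;\bar f)-\bar g:(\bar f,\bar g)\in E^-(x,u(x),p)\}\ge0$ for all $x\in G$, $p\in P$. A minimax solution is a function $u:\mathrm{cl}\,G\to\mathbb{R}$ for which there are a sequence of supersolutions $u^k$ and a sequence of subsolutions $u_k$ with $\lim_k u^k(x)=u(x)=\lim_k u_k(x)$ for every $x\in\mathrm{cl}\,G$. Guarantees and value. A partition is $\Delta=\{t_i\}_{i=0}^\infty$ with $t_0=0$, $t_{i+1}>t_i$, $\inf_i(t_{i+1}-t_i)>0$; $\mathrm{diam}\,\Delta=\sup_i(t_{i+1}-t_i)$. Feedback strategies are arbitrary functions $U:\mathbb{R}^d\to P$ (first player), $V:\mathbb{R}^d\to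 Q$ (second player). $X(x_0,U,\Delta)$ is the set of continuous $x(\cdot)$ with $x(0)=x_0$ such that on each $[t_i,t_{i+1})$, $\dot x(t)=f(x(t),U(x(t_i)),q(t))$ a.e. for some $q(\cdot)\in L^\infty([t_i,t_{i+1}],Q)$; $X(x_0,V,\Delta)$ is the set of continuous $x(\cdot)$ with $x(0)=x_0$ such that on each $[t_i,t_{i+1})$, $\dot x(t)=f(x(t),p(t),V(x(t_i)))$ a.e. for some $p(\cdot)\in L^\infty([t_i,t_{i+1}],P)$. $\tau_\varepsilon(x(\cdot))=\min\{t\ge0:x(t)\in M_1^\varepsilon\cup M_2^\varepsilon\}$ ($+\infty$ if there is no such $t$). Put $\Phi_\varepsilon(x(\cdot))=\int_0^{\tau_\varepsilon(x(\cdot))}g(x(t))\,dt+\hat\sigma(x(\tau_\varepsilon(x(\cdot))))$, equal to $+\infty$ if $\tau_\varepsilon(x(\cdot))=+\infty$. Then $J_1^\varepsilon(x_0,U,\Delta)=\sup\{\Phi_\varepsilon(x(\cdot)):x(\cdot)\in X(x_0,U,\Delta)\}$, $J_1^\varepsilon(x_0,U)=\limsup_{\mathrm{diam}\,\Delta\to0}J_1^\varepsilon(x_0,U,\Delta)$, $J_1^\varepsilon(x_0)=\inf_UJ_1^\varepsilon(x_0,U)$, $J_1^0(x_0)=\limsup_{\varepsilon\to0}J_1^\varepsilon(x_0)$; $J_2^\varepsilon(x_0,V,\Delta)=\inf\{\Phi_\varepsilon(x(\cdot)):x(\cdot)\in X(x_0,V,\Delta)\}$, $J_2^\varepsilon(x_0,V)=\liminf_{\mathrm{diam}\,\Delta\to0}J_2^\varepsilon(x_0,V,\Delta)$,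 $J_2^\varepsilon(x_0)=\sup_VJ_2^\varepsilon(x_0,V)$, $J_2^0(x_0)=\liminf_{\varepsilon\to0}J_2^\varepsilon(x_0)$. The value exists at $x_0$ if $J_1^0(x_0)=J_2^0(x_0)$, and this common value in $[0,+\infty]$ is $\operatorname{Val}(x_0)$.
   Formalization: The Lipschitz constant of the extensions σ̂ off M_2^ε is assumed independent of ε (as in the example with constant L); if it may grow like 1/ε, σ̂ can vanish at distance ε from M_1 and the claimed identity fails. *)

theory Defs
  imports "HOL-Analysis.Analysis"
begin

section \<open>Geometry of the terminal sets\<close>

text \<open>A set has continuous boundary if, near each boundary point and in suitable orthonormal
  coordinates, it is the closed epigraph of a continuous function of the first \<open>d - 1\<close>
  coordinates. The last coordinate axis is given by the unit vector \<open>e\<close>, and the hyperplane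
  orthogonal to \<open>e\<close> carries the other coordinates.\<close>

definition continuous_boundary :: "(real ^ 'd) set \<Rightarrow> bool" where
  "continuous_boundary M \<longleftrightarrow>
     (\<forall>x\<in>frontier M. \<exists>r>0. \<exists>e \<gamma>. norm e = 1 \<and> continuous_on {y. e \<bullet> y = 0} \<gamma> \<and>
        M \<inter> ball x r = {y \<in> ball x r. \<gamma> (y - (e \<bullet> y) *\<^sub>R e) \<le> e \<bullet> y})"

text \<open>Written with an explicit lower bound because \<^term>\<open>setdist {} S = 0\<close>, whereas an
  empty set is meant to be at infinite distance from every set.\<close>

definition positive_distance :: "(real ^ 'd) set \<Rightarrow> (real ^ 'd) set \<Rightarrow> bool" where
  "positive_distance A B \<longleftrightarrow> (\<exists>\<delta>>0. \<forall>x\<in>A. \<forall>y\<in>B. \<delta> \<le> dist x y)"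

definition game_region :: "(real ^ 'd) set \<Rightarrow> (real ^ 'd) set \<Rightarrow> (real ^ 'd) set" where
  "game_region M1 M2 = UNIV - (M1 \<union> M2)"

definition boundary_nbhd :: "(real ^ 'd) set \<Rightarrow> real \<Rightarrow> (real ^ 'd) set" where
  "boundary_nbhd M \<epsilon> = {x + y |x y. x \<in> frontier M \<and> norm y \<le> \<epsilon>}"

section \<open>Terminal payoff\<close>

text \<open>\<open>sh \<epsilon>\<close> is the extension of \<open>\<sigma>\<close> chosen for \<open>\<epsilon>\<close>. The Lipschitz constant \<open>K\<close> does not depend
  on \<open>\<epsilon>\<close>: with constants growing like \<open>1 / \<epsilon>\<close> the extension could lose all
  information about \<open>\<sigma>\<close> at distance \<open>\<epsilon>\<close> from \<open>M1\<close>.\<close>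

definition sigma_extension ::
  "(real ^ 'd) set \<Rightarrow> (real ^ 'd) set \<Rightarrow> (real ^ 'd \<Rightarrow> ereal) \<Rightarrow> real
    \<Rightarrow> (real \<Rightarrow> real ^ 'd \<Rightarrow> ereal) \<Rightarrow> bool" where
  "sigma_extension M1 M2 \<sigma> S sh \<longleftrightarrow>
     (\<exists>K. \<exists>\<epsilon>0>0. \<forall>\<epsilon>. 0 < \<epsilon> \<and> \<epsilon> < \<epsilon>0 \<longrightarrow>
        (let D = closure (game_region M1 M2); N = boundary_nbhd M2 \<epsilon> in
          (\<forall>x\<in>frontier M1. sh \<epsilon> x = \<sigma> x) \<and>
          (\<forall>x\<in>D - N. 0 \<le> sh \<epsilon> x \<and> sh \<epsilon> x \<le> ereal S) \<and>
          K-lipschitz_on (D - N) (\<lambda>x. real_of_ereal (sh \<epsilon> x)) \<and>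
          (\<forall>x\<in>D \<inter> N. sh \<epsilon> x = \<infinity>)))"

text \<open>The transform \<open>z \<mapsto> 1 - exp (-z)\<close> on \<open>[0, \<infinity>]\<close>, with \<open>exp (-\<infinity>) = 0\<close>.\<close>

definition kruzhkov :: "ereal \<Rightarrow> real" where
  "kruzhkov z = (if z = \<infinity> then 1 else 1 - exp (- real_of_ereal z))"

section \<open>Minimax solutions\<close>

text \<open>The Hamiltonian of the equation \<open>H(x, \<nabla>u, u) = 0\<close>. Minimax solutions refer to the
  equation only through the sets \<open>E_plus\<close> and \<open>E_minus\<close> below.\<close>

definition hamiltonian ::
  "'p set \<Rightarrow> 'q set \<Rightarrow> (real ^ 'd \<Rightarrow> 'p \<Rightarrow> 'q \<Rightarrow> real ^ 'd) \<Rightarrow> (real ^ 'd \<Rightarrow> real)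
    \<Rightarrow> real ^ 'd \<Rightarrow> real ^ 'd \<Rightarrow> real \<Rightarrow> real" where
  "hamiltonian P Q f g x s z = (INF p\<in>P. SUP q\<in>Q. s \<bullet> f x p q) + g x * (1 - z)"

definition upper_dd ::
  "(real ^ 'd) set \<Rightarrow> (real ^ 'd \<Rightarrow> real) \<Rightarrow> real ^ 'd \<Rightarrow> real ^ 'd \<Rightarrow> ereal" where
  "upper_dd G u x w =
     Lim (at_right 0) (\<lambda>\<rho>. SUP (\<delta>, w') \<in> {(\<delta>, w'). 0 < \<delta> \<and> \<delta> < \<rho> \<and>
         norm (w - w') \<le> \<rho> \<and> x + \<delta> *\<^sub>R w' \<in> G}. ereal ((u (x + \<delta> *\<^sub>R w') - u x) / \<delta>))"

definition lower_dd ::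
  "(real ^ 'd) set \<Rightarrow> (real ^ 'd \<Rightarrow> real) \<Rightarrow> real ^ 'd \<Rightarrow> real ^ 'd \<Rightarrow> ereal" where
  "lower_dd G u x w =
     Lim (at_right 0) (\<lambda>\<rho>. INF (\<delta>, w') \<in> {(\<delta>, w'). 0 < \<delta> \<and> \<delta> < \<rho> \<and>
         norm (w - w') \<le> \<rho> \<and> x + \<delta> *\<^sub>R w' \<in> G}. ereal ((u (x + \<delta> *\<^sub>R w') - u x) / \<delta>))"

text \<open>Both limits exist by monotonicity in \<open>\<rho>\<close>.\<close>

lemma tendsto_at_right_INF_mono:
  fixes h :: "real \<Rightarrow> ereal"
  assumes "\<And>a b. 0 < a \<Longrightarrow> a \<le> b \<Longrightarrow> h a \<le> h b"
  shows "(h \<longlongrightarrow> (INF \<rho>\<in>{0<..}. h \<rho>)) (at_right 0)"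
proof (rule order_tendstoI)
  fix a assume "a < (INF \<rho>\<in>{0<..}. h \<rho>)"
  then have "\<And>\<rho>. 0 < \<rho> \<Longrightarrow> a < h \<rho>"
    by (meson INF_lower greaterThan_iff less_le_trans)
  then show "eventually (\<lambda>\<rho>. a < h \<rho>) (at_right 0)"
    by (simp add: eventually_at_filter)
next
  fix a assume "(INF \<rho>\<in>{0<..}. h \<rho>) < a"
  then obtain r where "0 < r" "h r < a" by (auto simp: INF_less_iff)
  then have "\<And>\<rho>. 0 < \<rho> \<Longrightarrow> \<rho> < r \<Longrightarrow> h \<rho> < a"
    using assms by (meson less_imp_le le_less_trans)
  then show "eventually (\<lambda>\<rho>. h \<rho> < a) (at_right 0)"
    using \<open>0 < r\<close> by (auto simp: eventually_at_right)
qed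

lemma tendsto_at_right_SUP_antimono:
  fixes h :: "real \<Rightarrow> ereal"
  assumes "\<And>a b. 0 < a \<Longrightarrow> a \<le> b \<Longrightarrow> h b \<le> h a"
  shows "(h \<longlongrightarrow> (SUP \<rho>\<in>{0<..}. h \<rho>)) (at_right 0)"
proof (rule order_tendstoI)
  fix a assume "(SUP \<rho>\<in>{0<..}. h \<rho>) < a"
  then have "\<And>\<rho>. 0 < \<rho> \<Longrightarrow> h \<rho> < a"
    by (meson SUP_upper greaterThan_iff le_less_trans)
  then show "eventually (\<lambda>\<rho>. h \<rho> < a) (at_right 0)"
    by (simp add: eventually_at_filter)
next
  fix a assume "a < (SUP \<rho>\<in>{0<..}. h \<rho>)"
  then obtain r where "0 < r" "a < h r" by (auto simp: less_SUP_iff)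
  then have "\<And>\<rho>. 0 < \<rho> \<Longrightarrow> \<rho> < r \<Longrightarrow> a < h \<rho>"
    using assms by (meson less_imp_le less_le_trans)
  then show "eventually (\<lambda>\<rho>. a < h \<rho>) (at_right 0)"
    using \<open>0 < r\<close> by (auto simp: eventually_at_right)
qed

lemma upper_dd_eq_INF:
  "upper_dd G u x w =
     (INF \<rho>\<in>{0<..}. SUP (\<delta>, w') \<in> {(\<delta>, w'). 0 < \<delta> \<and> \<delta> < \<rho> \<and>
         norm (w - w') \<le> \<rho> \<and> x + \<delta> *\<^sub>R w' \<in> G}. ereal ((u (x + \<delta> *\<^sub>R w') - u x) / \<delta>))"
  unfolding upper_dd_def
  by (intro tendsto_Lim tendsto_at_right_INF_mono SUP_subset_mono) auto

lemma lower_dd_eq_SUP: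
  "lower_dd G u x w =
     (SUP \<rho>\<in>{0<..}. INF (\<delta>, w') \<in> {(\<delta>, w'). 0 < \<delta> \<and> \<delta> < \<rho> \<and>
         norm (w - w') \<le> \<rho> \<and> x + \<delta> *\<^sub>R w' \<in> G}. ereal ((u (x + \<delta> *\<^sub>R w') - u x) / \<delta>))"
  unfolding lower_dd_def
  by (intro tendsto_Lim tendsto_at_right_SUP_antimono INF_superset_mono) auto

definition E_plus ::
  "'p set \<Rightarrow> (real ^ 'd \<Rightarrow> 'p \<Rightarrow> 'q \<Rightarrow> real ^ 'd) \<Rightarrow> (real ^ 'd \<Rightarrow> real)
    \<Rightarrow> real ^ 'd \<Rightarrow> real \<Rightarrow> 'q \<Rightarrow> ((real ^ 'd) \<times> real) set" where
  "E_plus P f g x z q = convex hull ((\<lambda>p. (f x p q, g x * (z - 1))) ` P)"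

definition E_minus ::
  "'q set \<Rightarrow> (real ^ 'd \<Rightarrow> 'p \<Rightarrow> 'q \<Rightarrow> real ^ 'd) \<Rightarrow> (real ^ 'd \<Rightarrow> real)
    \<Rightarrow> real ^ 'd \<Rightarrow> real \<Rightarrow> 'p \<Rightarrow> ((real ^ 'd) \<times> real) set" where
  "E_minus Q f g x z p = convex hull ((\<lambda>q. (f x p q, g x * (z - 1))) ` Q)"

definition lsc_on :: "'a::topological_space set \<Rightarrow> ('a \<Rightarrow> real) \<Rightarrow> bool" where
  "lsc_on S u \<longleftrightarrow> (\<forall>x\<in>S. \<forall>c. c < u x \<longrightarrow> (\<forall>\<^sub>F y in at x within S. c < u y))"

definition usc_on :: "'a::topological_space set \<Rightarrow> ('a \<Rightarrow> real) \<Rightarrow> bool" where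
  "usc_on S u \<longleftrightarrow> (\<forall>x\<in>S. \<forall>c. u x < c \<longrightarrow> (\<forall>\<^sub>F y in at x within S. u y < c))"

text \<open>A function on \<open>closure G\<close> is represented by a total function whose values outside
  \<open>closure G\<close> are never used.\<close>

definition supersolution ::
  "'p set \<Rightarrow> 'q set \<Rightarrow> (real ^ 'd \<Rightarrow> 'p \<Rightarrow> 'q \<Rightarrow> real ^ 'd) \<Rightarrow> (real ^ 'd \<Rightarrow> real)
    \<Rightarrow> (real ^ 'd) set \<Rightarrow> (real ^ 'd \<Rightarrow> real) \<Rightarrow> (real ^ 'd \<Rightarrow> real) \<Rightarrow> bool" where
  "supersolution P Q f g G \<sigma>t u \<longleftrightarrow>
     bounded (u ` closure G) \<and> lsc_on (closure G) u \<and>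
     (\<forall>x\<in>frontier G. u x = \<sigma>t x) \<and>
     (\<forall>x\<in>G. \<forall>q\<in>Q.
        (INF (fb, gb) \<in> E_plus P f g x (u x) q. lower_dd G u x fb - ereal gb) \<le> 0)"

definition subsolution ::
  "'p set \<Rightarrow> 'q set \<Rightarrow> (real ^ 'd \<Rightarrow> 'p \<Rightarrow> 'q \<Rightarrow> real ^ 'd) \<Rightarrow> (real ^ 'd \<Rightarrow> real)
    \<Rightarrow> (real ^ 'd) set \<Rightarrow> (real ^ 'd \<Rightarrow> real) \<Rightarrow> (real ^ 'd \<Rightarrow> real) \<Rightarrow> bool" where
  "subsolution P Q f g G \<sigma>t u \<longleftrightarrow>
     bounded (u ` closure G) \<and> usc_on (closure G) u \<and>
     (\<forall>x\<in>frontier G. u x = \<sigma>t x \<and> continuous (at x within closure G) u) \<and>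
     (\<forall>x\<in>G. \<forall>p\<in>P.
        0 \<le> (SUP (fb, gb) \<in> E_minus Q f g x (u x) p. upper_dd G u x fb - ereal gb))"

definition minimax_solution ::
  "'p set \<Rightarrow> 'q set \<Rightarrow> (real ^ 'd \<Rightarrow> 'p \<Rightarrow> 'q \<Rightarrow> real ^ 'd) \<Rightarrow> (real ^ 'd \<Rightarrow> real)
    \<Rightarrow> (real ^ 'd) set \<Rightarrow> (real ^ 'd \<Rightarrow> real) \<Rightarrow> (real ^ 'd \<Rightarrow> real) \<Rightarrow> bool" where
  "minimax_solution P Q f g G \<sigma>t u \<longleftrightarrow>
     (\<exists>v w. (\<forall>k::nat. supersolution P Q f g G \<sigma>t (v k)) \<and>
            (\<forall>k::nat. subsolution P Q f g G \<sigma>t (w k)) \<and>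
            (\<forall>x\<in>closure G. (\<lambda>k. v k x) \<longlonglongrightarrow> u x \<and> (\<lambda>k. w k x) \<longlonglongrightarrow> u x))"

definition unique_minimax_solution ::
  "'p set \<Rightarrow> 'q set \<Rightarrow> (real ^ 'd \<Rightarrow> 'p \<Rightarrow> 'q \<Rightarrow> real ^ 'd) \<Rightarrow> (real ^ 'd \<Rightarrow> real)
    \<Rightarrow> (real ^ 'd) set \<Rightarrow> (real ^ 'd \<Rightarrow> real) \<Rightarrow> (real ^ 'd \<Rightarrow> real) \<Rightarrow> bool" where
  "unique_minimax_solution P Q f g G \<sigma>t u \<longleftrightarrow>
     minimax_solution P Q f g G \<sigma>t u \<and>
     (\<forall>v. minimax_solution P Q f g G \<sigma>t v \<longrightarrow> (\<forall>x\<in>closure G. v x = u x))"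

section \<open>Step-by-step motions\<close>

definition is_partition :: "(nat \<Rightarrow> real) \<Rightarrow> bool" where
  "is_partition \<Delta> \<longleftrightarrow> \<Delta> 0 = 0 \<and> (\<forall>i. \<Delta> i < \<Delta> (Suc i)) \<and> 0 < (INF i. \<Delta> (Suc i) - \<Delta> i)"

definition mesh :: "(nat \<Rightarrow> real) \<Rightarrow> ereal" where
  "mesh \<Delta> = (SUP i. ereal (\<Delta> (Suc i) - \<Delta> i))"

text \<open>The filter of partitions whose diameter tends to \<open>0\<close>.\<close>

definition fine_partitions :: "(nat \<Rightarrow> real) filter" where
  "fine_partitions = inf (filtercomap mesh (at_right 0)) (principal {\<Delta>. is_partition \<Delta>})"

text \<open>A division is a finite family of nonoverlapping closed intervals; \<open>Inf k\<close> and \<open>Sup k\<close> are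
  the endpoints of the interval \<open>k\<close>.\<close>

definition abs_continuous_on :: "real \<Rightarrow> real \<Rightarrow> (real \<Rightarrow> 'a::real_normed_vector) \<Rightarrow> bool" where
  "abs_continuous_on a b x \<longleftrightarrow>
     (\<forall>\<epsilon>>0. \<exists>\<delta>>0. \<forall>D T. D division_of T \<and> T \<subseteq> {a..b} \<and> (\<Sum>k\<in>D. Sup k - Inf k) < \<delta> \<longrightarrow>
        (\<Sum>k\<in>D. norm (x (Sup k) - x (Inf k))) < \<epsilon>)"

text \<open>Motions are solutions in the sense of Caratheodory. Absolute continuity has to be required
  explicitly, since otherwise Cantor-type functions could be added to a motion.\<close>

definition ae_solution_on :: "real \<Rightarrow> real \<Rightarrow> (real \<Rightarrow> real ^ 'd) \<Rightarrow> (real \<Rightarrow> real ^ 'd) \<Rightarrow> bool" where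
  "ae_solution_on a b x h \<longleftrightarrow> abs_continuous_on a b x \<and>
     (AE t in lebesgue_on {a..b}. (x has_vector_derivative h t) (at t))"

definition measurable_controls :: "real \<Rightarrow> real \<Rightarrow> 'c::topological_space set \<Rightarrow> (real \<Rightarrow> 'c) set" where
  "measurable_controls a b C = {c \<in> borel_measurable (lebesgue_on {a..b}). \<forall>t\<in>{a..b}. c t \<in> C}"

definition motions1 ::
  "'q::topological_space set \<Rightarrow> (real ^ 'd \<Rightarrow> 'p \<Rightarrow> 'q \<Rightarrow> real ^ 'd)
    \<Rightarrow> real ^ 'd \<Rightarrow> (real ^ 'd \<Rightarrow> 'p) \<Rightarrow> (nat \<Rightarrow> real) \<Rightarrow> (real \<Rightarrow> real ^ 'd) set" where
  "motions1 Q f x0 U \<Delta> =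
     {x. continuous_on {0..} x \<and> x 0 = x0 \<and>
         (\<forall>i. \<exists>q \<in> measurable_controls (\<Delta> i) (\<Delta> (Suc i)) Q.
            ae_solution_on (\<Delta> i) (\<Delta> (Suc i)) x (\<lambda>t. f (x t) (U (x (\<Delta> i))) (q t)))}"

definition motions2 ::
  "'p::topological_space set \<Rightarrow> (real ^ 'd \<Rightarrow> 'p \<Rightarrow> 'q \<Rightarrow> real ^ 'd)
    \<Rightarrow> real ^ 'd \<Rightarrow> (real ^ 'd \<Rightarrow> 'q) \<Rightarrow> (nat \<Rightarrow> real) \<Rightarrow> (real \<Rightarrow> real ^ 'd) set" where
  "motions2 P f x0 V \<Delta> =
     {x. continuous_on {0..} x \<and> x 0 = x0 \<and>
         (\<forall>i. \<exists>p \<in> measurable_controls (\<Delta> i) (\<Delta> (Suc i)) P.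
            ae_solution_on (\<Delta> i) (\<Delta> (Suc i)) x (\<lambda>t. f (x t) (p t) (V (x (\<Delta> i)))))}"

section \<open>Guaranteed results and value\<close>

definition exit_time ::
  "(real ^ 'd) set \<Rightarrow> (real ^ 'd) set \<Rightarrow> real \<Rightarrow> (real \<Rightarrow> real ^ 'd) \<Rightarrow> ereal" where
  "exit_time M1 M2 \<epsilon> x =
     (INF t \<in> {t. 0 \<le> t \<and> x t \<in> boundary_nbhd M1 \<epsilon> \<union> boundary_nbhd M2 \<epsilon>}. ereal t)"

definition payoff ::
  "(real ^ 'd) set \<Rightarrow> (real ^ 'd) set \<Rightarrow> (real ^ 'd \<Rightarrow> real) \<Rightarrow> (real \<Rightarrow> real ^ 'd \<Rightarrow> ereal)
    \<Rightarrow> real \<Rightarrow> (real \<Rightarrow> real ^ 'd) \<Rightarrow> ereal" where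
  "payoff M1 M2 g sh \<epsilon> x =
     (let \<tau> = exit_time M1 M2 \<epsilon> x in
      if \<tau> = \<infinity> then \<infinity>
      else ereal (integral {0..real_of_ereal \<tau>} (\<lambda>t. g (x t))) + sh \<epsilon> (x (real_of_ereal \<tau>)))"

definition guarantee1 ::
  "'p set \<Rightarrow> 'q::topological_space set \<Rightarrow> (real ^ 'd \<Rightarrow> 'p \<Rightarrow> 'q \<Rightarrow> real ^ 'd)
    \<Rightarrow> (real ^ 'd \<Rightarrow> real) \<Rightarrow> (real ^ 'd) set \<Rightarrow> (real ^ 'd) set
    \<Rightarrow> (real \<Rightarrow> real ^ 'd \<Rightarrow> ereal) \<Rightarrow> real \<Rightarrow> real ^ 'd \<Rightarrow> ereal" where
  "guarantee1 P Q f g M1 M2 sh \<epsilon> x0 =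
     (INF U \<in> UNIV \<rightarrow> P. Limsup fine_partitions
        (\<lambda>\<Delta>. SUP x \<in> motions1 Q f x0 U \<Delta>. payoff M1 M2 g sh \<epsilon> x))"

definition guarantee2 ::
  "'p::topological_space set \<Rightarrow> 'q set \<Rightarrow> (real ^ 'd \<Rightarrow> 'p \<Rightarrow> 'q \<Rightarrow> real ^ 'd)
    \<Rightarrow> (real ^ 'd \<Rightarrow> real) \<Rightarrow> (real ^ 'd) set \<Rightarrow> (real ^ 'd) set
    \<Rightarrow> (real \<Rightarrow> real ^ 'd \<Rightarrow> ereal) \<Rightarrow> real \<Rightarrow> real ^ 'd \<Rightarrow> ereal" where
  "guarantee2 P Q f g M1 M2 sh \<epsilon> x0 =
     (SUP V \<in> UNIV \<rightarrow> Q. Liminf fine_partitions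
        (\<lambda>\<Delta>. INF x \<in> motions2 P f x0 V \<Delta>. payoff M1 M2 g sh \<epsilon> x))"

definition limit_guarantee1 ::
  "'p set \<Rightarrow> 'q::topological_space set \<Rightarrow> (real ^ 'd \<Rightarrow> 'p \<Rightarrow> 'q \<Rightarrow> real ^ 'd)
    \<Rightarrow> (real ^ 'd \<Rightarrow> real) \<Rightarrow> (real ^ 'd) set \<Rightarrow> (real ^ 'd) set
    \<Rightarrow> (real \<Rightarrow> real ^ 'd \<Rightarrow> ereal) \<Rightarrow> real ^ 'd \<Rightarrow> ereal" where
  "limit_guarantee1 P Q f g M1 M2 sh x0 =
     Limsup (at_right 0) (\<lambda>\<epsilon>. guarantee1 P Q f g M1 M2 sh \<epsilon> x0)"

definition limit_guarantee2 ::
  "'p::topological_space set \<Rightarrow> 'q set \<Rightarrow> (real ^ 'd \<Rightarrow> 'p \<Rightarrow> 'q \<Rightarrow> real ^ 'd)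
    \<Rightarrow> (real ^ 'd \<Rightarrow> real) \<Rightarrow> (real ^ 'd) set \<Rightarrow> (real ^ 'd) set
    \<Rightarrow> (real \<Rightarrow> real ^ 'd \<Rightarrow> ereal) \<Rightarrow> real ^ 'd \<Rightarrow> ereal" where
  "limit_guarantee2 P Q f g M1 M2 sh x0 =
     Liminf (at_right 0) (\<lambda>\<epsilon>. guarantee2 P Q f g M1 M2 sh \<epsilon> x0)"

definition is_game_value ::
  "'p::topological_space set \<Rightarrow> 'q::topological_space set
    \<Rightarrow> (real ^ 'd \<Rightarrow> 'p \<Rightarrow> 'q \<Rightarrow> real ^ 'd) \<Rightarrow> (real ^ 'd \<Rightarrow> real)
    \<Rightarrow> (real ^ 'd) set \<Rightarrow> (real ^ 'd) set
    \<Rightarrow> (real \<Rightarrow> real ^ 'd \<Rightarrow> ereal) \<Rightarrow> real ^ 'd \<Rightarrow> ereal \<Rightarrow> bool" where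
  "is_game_value P Q f g M1 M2 sh x0 v \<longleftrightarrow>
     0 \<le> v \<and> limit_guarantee1 P Q f g M1 M2 sh x0 = v \<and> limit_guarantee2 P Q f g M1 M2 sh x0 = v"

end

(* A supersolution v is aimed at through its penalized minimum
   w(x) = min_y (v(y) + pen(x - y)). The gradient s of the penalty is a proximal subgradient of v at
   the minimizer y, so the derivative inequality and (A3) give min_p max_q <s, f(y,p,q)> <= g(y)(v(y) - 1).
   The first player uses at x a nearly optimal p for s; the shift from y to x costs lam |x - y| |s|,
   which a penalty of small power growth keeps below g pen. Hence (w(x(t)) - 1) exp(-int g) hardly
   increases along the step-by-step motions, and evaluating it at the exit time bounds
   1 - exp(-payoff) by v(x0) up to a small error. The same argument for -w, w a subsolution, with the
   players exchanged, bounds the guarantee of the second player from below. A motion generated by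
   both feedbacks together shows J2 <= J1, so the common limit of super- and subsolutions is squeezed. *)
theory Submission
  imports Defs
begin

section \<open>Absolutely continuous functions\<close>

text \<open>The derivative inequality holds only in the open set G, while a minimizer y might lie on
  the boundary. This is why the estimates concern motions that keep a distance above \<epsilon> from
  the frontier: with y within \<epsilon> of the position, y stays in G until the \<epsilon>-exit. At
  the exit, y and a nearby boundary point are compared through the semicontinuity of the solution,
  which is uniform only on bounded sets; hence a finite horizon T. The horizon is harmless because
  \<open>g \<ge> b\<close> discounts bounded quantities by \<open>exp (- (b * T))\<close>: the first
  player's own estimate excludes motions that survive up to T, and for the second player such a
  motion has already cost enough. The constants have a forced order: \<zeta> and T, then the radius
  \<rho>, then the penalty, whose slope may be huge, and the mesh last. Both players are treated at
  once in a locale with a constant c, equal to 1 for a supersolution and to -1 for a negated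
  subsolution. As the penalized value minus c may have either sign, the discount factor is
  controlled from both sides.\<close>

lemma abs_continuous_onE:
  assumes "abs_continuous_on a b x" "0 < e"
  obtains \<delta> where "0 < \<delta>"
    "\<And>D T. D division_of T \<Longrightarrow> T \<subseteq> {a..b} \<Longrightarrow> (\<Sum>k\<in>D. Sup k - Inf k) < \<delta> \<Longrightarrow>
      (\<Sum>k\<in>D. norm (x (Sup k) - x (Inf k))) < e"
proof -
  from assms obtain \<delta> where "0 < \<delta>" and *: "\<forall>D T. D division_of T \<and> T \<subseteq> {a..b} \<and>
      (\<Sum>k\<in>D. Sup k - Inf k) < \<delta> \<longrightarrow> (\<Sum>k\<in>D. norm (x (Sup k) - x (Inf k))) < e"
    unfolding abs_continuous_on_def by meson
  show ?thesis
    by (rule that[OF \<open>0 < \<delta>\<close>]) (rule *[rule_format], intro conjI)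
qed

lemma abs_continuous_on_subinterval:
  assumes "abs_continuous_on a b x" "a \<le> s" "t \<le> b"
  shows "abs_continuous_on s t x"
proof -
  have "{s..t} \<subseteq> {a..b}" using assms by auto
  then show ?thesis
    using assms(1) unfolding abs_continuous_on_def by (meson subset_trans)
qed

text \<open>Distinct intervals of a division meet in a set with empty interior, hence in a null set,
  so their lengths add up to the measure of the union.\<close>

lemma sum_length_le_measure:
  fixes D :: "real set set"
  assumes D: "D division_of T" and sub: "T \<subseteq> X" and X: "X \<in> lmeasurable"
  shows "(\<Sum>K\<in>D. Sup K - Inf K) \<le> measure lebesgue X"
proof -
  have fin: "finite D" using D by (rule division_of_finite)
  have cb: "\<exists>u v. u \<le> v \<and> K = {u..v}" if "K \<in> D" for K
    using division_ofD(3,4)[OF D that] by (metis atLeastatMost_empty_iff2 box_real(2))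
  have "(\<Sum>K\<in>D. Sup K - Inf K) = (\<Sum>K\<in>D. measure lebesgue K)"
  proof (rule sum.cong[OF refl])
    fix K assume "K \<in> D"
    then obtain u v where "u \<le> v" "K = {u..v}" using cb by blast
    then show "Sup K - Inf K = measure lebesgue K" by simp
  qed
  also have "\<dots> = measure lebesgue (\<Union>D)"
  proof (rule measure_negligible_finite_Union[symmetric, OF fin])
    show "S \<in> lmeasurable" if "S \<in> D" for S
      using cb[OF that] by auto
    show "pairwise (\<lambda>S T. negligible (S \<inter> T)) D"
    proof (rule pairwiseI)
      fix S T assume ST: "S \<in> D" "T \<in> D" "S \<noteq> T"
      then have e: "interior S \<inter> interior T = {}" using division_ofD(5)[OF D] by blast
      obtain u v where S: "S = cbox u v" using division_ofD(4)[OF D ST(1)] by blast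
      obtain u' v' where T: "T = cbox u' v'" using division_ofD(4)[OF D ST(2)] by blast
      obtain w z where wz: "S \<inter> T = cbox w z" unfolding S T Int_interval by blast
      have "box w z = {}" using e by (metis wz interior_Int interior_cbox)
      then show "negligible (S \<inter> T)" unfolding wz negligible_interval .
    qed
  qed
  also have "\<dots> \<le> measure lebesgue X"
  proof (rule measure_mono_fmeasurable)
    show "\<Union>D \<subseteq> X" using division_ofD(6)[OF D] sub by simp
    show "\<Union>D \<in> sets lebesgue"
    proof (intro sets.finite_Union fin subsetI)
      fix K assume "K \<in> D"
      then show "K \<in> sets lebesgue" using cb[of K] by auto
    qed
  qed (rule X)
  finally show ?thesis .
qed

text \<open>On a null set the increments are controlled by absolute continuity through an open cover
  of small measure, elsewhere by the sign of the derivative; Cousin's lemma combines both.\<close>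

lemma abs_continuous_nonincreasing:
  fixes \<phi> :: "real \<Rightarrow> real"
  assumes ac: "abs_continuous_on a b \<phi>" and ab: "a \<le> b" and N: "negligible N"
    and der: "\<And>t. t \<in> {a..b} - N \<Longrightarrow> \<exists>l\<le>0. (\<phi> has_real_derivative l) (at t)"
  shows "\<phi> b \<le> \<phi> a"
proof (rule field_le_epsilon)
  fix e0 :: real assume "0 < e0"
  \<comment> \<open>Two error budgets add up to e0: e for the intervals tagged in N, and
    \<open>e * (b - a)\<close> for all others.\<close>
  define e where "e = e0 / (b - a + 1)"
  have e: "0 < e" using \<open>0 < e0\<close> ab by (simp add: e_def)
  obtain \<delta> where \<delta>: "0 < \<delta>" and ac\<delta>: "\<And>D T. D division_of T \<Longrightarrow> T \<subseteq> {a..b} \<Longrightarrow>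
      (\<Sum>k\<in>D. Sup k - Inf k) < \<delta> \<Longrightarrow> (\<Sum>k\<in>D. norm (\<phi> (Sup k) - \<phi> (Inf k))) < e"
    using abs_continuous_onE[OF ac e] by metis
  have Nl: "N \<in> sets lebesgue" "N \<in> null_sets lebesgue" using N negligible_iff_null_sets by auto
  obtain X where X: "open X" "N \<subseteq> X" "X - N \<in> lmeasurable" "emeasure lebesgue (X - N) < ennreal \<delta>"
    using sets_lebesgue_outer_open[OF Nl(1) \<delta>] .
  have Xm: "X \<in> lmeasurable"
    using X(2,3) Nl(2) fmeasurable.Un[OF X(3) ] 
    by (metis Diff_partition Un_commute negligible_iff_measure N)
  have "emeasure lebesgue X = emeasure lebesgue (X - N)"
    using Nl(2) X(1) by (simp add: emeasure_Diff_null_set)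
  then have "ennreal (measure lebesgue X) < ennreal \<delta>"
    using X(4) Xm by (simp add: emeasure_eq_measure2)
  then have Xd: "measure lebesgue X < \<delta>"
    by (simp add: ennreal_less_iff)
  \<comment> \<open>Only intervals containing the tag occur in a tagged division, so
    differentiability at the tag alone controls the increment; no uniformity in t is
    required.\<close>
  define Good where "Good t r \<longleftrightarrow> 0 < r \<and> (if t \<in> N then ball t r \<subseteq> X else t \<in> {a..b} \<longrightarrow>
       (\<forall>u v. u \<le> t \<longrightarrow> t \<le> v \<longrightarrow> {u..v} \<subseteq> ball t r \<longrightarrow> \<phi> v - \<phi> u \<le> e * (v - u)))" for t r
  have "\<exists>r. Good t r" for t
  proof -
    consider "t \<in> N" | "t \<notin> N" "t \<notin> {a..b}" | "t \<in> {a..b} - N" by blast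
    then show ?thesis
    proof cases
      case 1 then show ?thesis using X(1,2) open_contains_ball unfolding Good_def by (metis subsetD)
    next
      case 2 then show ?thesis unfolding Good_def by (auto intro: exI[of _ 1])
    next
      case 3
      then obtain l where l: "l \<le> 0" "(\<phi> has_real_derivative l) (at t)" using der by blast
      have "(\<phi> has_derivative (\<lambda>h. l * h)) (at t)" using l(2) by (simp add: has_field_derivative_def)
      then obtain r where r: "r > 0" and
        rb: "\<And>y. norm (y - t) < r \<Longrightarrow> norm (\<phi> y - \<phi> t - l * (y - t)) \<le> e * norm (y - t)"
        using e unfolding has_derivative_at_alt by blast
      have "\<phi> v - \<phi> u \<le> e * (v - u)" if "u \<le> t" "t \<le> v" "{u..v} \<subseteq> ball t r" for u v
      proof -
        have "u \<in> {u..v}" "v \<in> {u..v}" using that by auto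
        then have uv: "u \<in> ball t r" "v \<in> ball t r" using that by blast+
        have "\<phi> v - \<phi> t - l * (v - t) \<le> e * (v - t)"
          using rb[of v] uv that by (auto simp: dist_real_def)
        moreover have "l * (v - t) \<le> 0" using l(1) that by (simp add: mult_nonpos_nonneg)
        moreover have "- (\<phi> u - \<phi> t - l * (u - t)) \<le> e * (t - u)"
          using rb[of u] uv that by (auto simp: dist_real_def)
        moreover have "l * (u - t) \<ge> 0" using l(1) that by (simp add: mult_nonpos_nonpos)
        ultimately show ?thesis by (simp add: algebra_simps)
      qed
      then show ?thesis using 3 r unfolding Good_def by auto
    qed
  qed
  then obtain r where r: "\<And>t. Good t (r t)" by metis
  have "gauge (\<lambda>t. ball t (r t))" using r by (auto simp: gauge_def Good_def)
  then obtain p where p: "p tagged_division_of {a..b}" "(\<lambda>t. ball t (r t)) fine p"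
    using fine_division_exists_real by blast
  \<comment> \<open>The convention on the empty set makes \<open>d\<close> vanish on all degenerate
    intervals, as is required for replacing the sum over tagged pairs by a sum over
    intervals.\<close>
  define d where "d K = (if K = {} then 0 else \<phi> (Sup K) - \<phi> (Inf K))" for K :: "real set"
  define D where "D = snd ` p"
  have Ddiv: "D division_of {a..b}" unfolding D_def by (rule division_of_tagged_division[OF p(1)])
  have fin: "finite D" using Ddiv by (rule division_of_finite)
  have "\<phi> b - \<phi> a = (\<Sum>(x,K)\<in>p. \<phi> (Sup K) - \<phi> (Inf K))"
    using additive_tagged_division_1[OF ab p(1), of \<phi>] by simp
  also have "\<dots> = (\<Sum>(x,K)\<in>p. d K)"
    using tagged_division_ofD(2)[OF p(1)] unfolding d_def by (intro sum.cong) (auto, blast)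
  also have "\<dots> = sum d D"
    unfolding D_def
  proof (rule sum.over_tagged_division_lemma[OF p(1)])
    fix u v :: real assume "box u v = {}"
    then have "v \<le> u" by simp
    then show "d (cbox u v) = 0" by (cases "u = v") (auto simp: d_def)
  qed
  finally have tot: "\<phi> b - \<phi> a = sum d D" .
  define D1 where "D1 = {K \<in> D. \<exists>x\<in>N. (x, K) \<in> p}"
  have K: "\<exists>x u v. (x, K) \<in> p \<and> x \<in> K \<and> u \<le> v \<and> K = {u..v} \<and> K \<subseteq> ball x (r x)" if KD: "K \<in> D" for K
  proof -
    obtain x where x: "(x, K) \<in> p" using KD by (auto simp: D_def)
    then have xK: "x \<in> K" and "\<exists>u v. K = {u..v}" using tagged_division_ofD(2,4)[OF p(1) x] by auto
    then obtain u v where "K = {u..v}" "u \<le> v" by auto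
    moreover have "K \<subseteq> ball x (r x)" using p(2) x by (auto simp: fine_def)
    ultimately show ?thesis using x xK by blast
  qed
  have D1X: "\<Union>D1 \<subseteq> X"
  proof
    fix y assume "y \<in> \<Union>D1"
    then obtain K x where "y \<in> K" "x \<in> N" "(x, K) \<in> p" by (auto simp: D1_def)
    moreover have "K \<subseteq> ball x (r x)" using p(2) \<open>(x, K) \<in> p\<close> by (auto simp: fine_def)
    ultimately show "y \<in> X" using r[of x] by (auto simp: Good_def)
  qed
  have D1div: "D1 division_of \<Union>D1"
    by (rule division_of_subset[OF division_of_union_self[OF Ddiv]]) (auto simp: D1_def)
  have "sum d D1 \<le> (\<Sum>k\<in>D1. norm (\<phi> (Sup k) - \<phi> (Inf k)))"
    by (rule sum_mono) (auto simp: d_def)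
  also have "\<dots> < e"
  proof (rule ac\<delta>[OF D1div])
    show "\<Union>D1 \<subseteq> {a..b}" using division_ofD(6)[OF Ddiv] by (auto simp: D1_def)
    show "(\<Sum>k\<in>D1. Sup k - Inf k) < \<delta>"
      using sum_length_le_measure[OF D1div D1X Xm] Xd by linarith
  qed
  finally have s1: "sum d D1 \<le> e" by simp
  have "sum d (D - D1) \<le> (\<Sum>K\<in>D - D1. e * (Sup K - Inf K))"
  proof (rule sum_mono)
    fix K assume "K \<in> D - D1"
    then obtain x u v where x: "(x, K) \<in> p" "x \<in> K" "u \<le> v" "K = {u..v}" "K \<subseteq> ball x (r x)" "x \<notin> N"
      using K[of K] by (auto simp: D1_def)
    moreover have "x \<in> {a..b}" using tag_in_interval[OF p(1) x(1)] .
    ultimately show "d K \<le> e * (Sup K - Inf K)" using r[of x] by (auto simp: d_def Good_def)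
  qed
  also have "\<dots> \<le> (\<Sum>K\<in>D. e * (Sup K - Inf K))"
    using fin K e by (intro sum_mono2) fastforce+
  also have "\<dots> = e * (\<Sum>K\<in>D. Sup K - Inf K)" by (simp add: sum_distrib_left)
  also have "\<dots> \<le> e * (b - a)"
    using sum_length_le_measure[OF Ddiv order_refl] e ab by (intro mult_left_mono) auto
  finally have "sum d (D - D1) \<le> e * (b - a)" .
  moreover have "sum d D = sum d (D - D1) + sum d D1"
    using sum.subset_diff[of D1 D d] fin by (auto simp: D1_def)
  ultimately have "\<phi> b - \<phi> a \<le> e * (b - a + 1)" using tot s1 by (simp add: algebra_simps)
  also have "\<dots> = e0" using ab by (simp add: e_def)
  finally show "\<phi> b \<le> \<phi> a + e0" by simp
qed

text \<open>Brings a vector-valued motion into the scope of the monotonicity result for real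
  functions, one direction v at a time.\<close>

lemma abs_continuous_on_inner_linear:
  fixes x :: "real \<Rightarrow> 'a::real_inner"
  assumes "abs_continuous_on a b x"
  shows "abs_continuous_on a b (\<lambda>t. v \<bullet> x t - c * t)"
  unfolding abs_continuous_on_def
proof (intro allI impI)
  fix e :: real assume e: "0 < e"
  define e1 where "e1 = e / (2 * (norm v + 1))"
  have e1: "0 < e1" using e by (simp add: e1_def add_nonneg_pos)
  obtain \<delta> where \<delta>: "0 < \<delta>" and D\<delta>: "\<And>D T. D division_of T \<Longrightarrow> T \<subseteq> {a..b} \<Longrightarrow>
      (\<Sum>k\<in>D. Sup k - Inf k) < \<delta> \<Longrightarrow> (\<Sum>k\<in>D. norm (x (Sup k) - x (Inf k))) < e1"
    using abs_continuous_onE[OF assms e1] by metis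
  define \<delta>' where "\<delta>' = min \<delta> (e / (2 * (\<bar>c\<bar> + 1)))"
  have \<delta>': "0 < \<delta>'" using \<delta> e by (simp add: \<delta>'_def add_nonneg_pos)
  show "\<exists>\<delta>>0. \<forall>D T. D division_of T \<and> T \<subseteq> {a..b} \<and> (\<Sum>k\<in>D. Sup k - Inf k) < \<delta> \<longrightarrow>
      (\<Sum>k\<in>D. norm (v \<bullet> x (Sup k) - c * Sup k - (v \<bullet> x (Inf k) - c * Inf k))) < e"
  proof (intro exI[of _ \<delta>'] conjI \<delta>' allI impI, elim conjE)
    fix D T assume D: "D division_of T" "T \<subseteq> {a..b}" "(\<Sum>k\<in>D. Sup k - Inf k) < \<delta>'"
    have len: "0 \<le> Sup k - Inf k" if k: "k \<in> D" for k :: "real set"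
      using division_ofD(3,4)[OF D(1) k] by fastforce
    have "(\<Sum>k\<in>D. norm (v \<bullet> x (Sup k) - c * Sup k - (v \<bullet> x (Inf k) - c * Inf k)))
        \<le> (\<Sum>k\<in>D. norm v * norm (x (Sup k) - x (Inf k)) + \<bar>c\<bar> * (Sup k - Inf k))"
    proof (rule sum_mono)
      fix k assume k: "k \<in> D"
      have "v \<bullet> x (Sup k) - c * Sup k - (v \<bullet> x (Inf k) - c * Inf k)
         = v \<bullet> (x (Sup k) - x (Inf k)) - c * (Sup k - Inf k)"
        by (simp add: inner_diff_right algebra_simps)
      also have "norm \<dots> \<le> norm (v \<bullet> (x (Sup k) - x (Inf k))) + norm (c * (Sup k - Inf k))"
        by (rule norm_triangle_ineq4)
      also have "\<dots> \<le> norm v * norm (x (Sup k) - x (Inf k)) + \<bar>c\<bar> * (Sup k - Inf k)"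
        using len[OF k] Cauchy_Schwarz_ineq2[of v "x (Sup k) - x (Inf k)"] by (simp add: abs_mult)
      finally show "norm (v \<bullet> x (Sup k) - c * Sup k - (v \<bullet> x (Inf k) - c * Inf k))
          \<le> norm v * norm (x (Sup k) - x (Inf k)) + \<bar>c\<bar> * (Sup k - Inf k)" .
    qed
    also have "\<dots> = norm v * (\<Sum>k\<in>D. norm (x (Sup k) - x (Inf k))) + \<bar>c\<bar> * (\<Sum>k\<in>D. Sup k - Inf k)"
      by (simp add: sum.distrib sum_distrib_left)
    also have "\<dots> < (norm v + 1) * e1 + (\<bar>c\<bar> + 1) * (e / (2 * (\<bar>c\<bar> + 1)))"
    proof (rule add_strict_mono)
      have "(\<Sum>k\<in>D. norm (x (Sup k) - x (Inf k))) < e1"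
        using D\<delta>[OF D(1,2)] D(3) by (simp add: \<delta>'_def)
      then have "norm v * (\<Sum>k\<in>D. norm (x (Sup k) - x (Inf k))) \<le> norm v * e1"
        by (intro mult_left_mono) auto
      then show "norm v * (\<Sum>k\<in>D. norm (x (Sup k) - x (Inf k))) < (norm v + 1) * e1"
        using e1 by (simp add: algebra_simps)
      have l: "0 \<le> (\<Sum>k\<in>D. Sup k - Inf k)" using len by (rule sum_nonneg)
      have "\<bar>c\<bar> * (\<Sum>k\<in>D. Sup k - Inf k) \<le> (\<bar>c\<bar> + 1) * (\<Sum>k\<in>D. Sup k - Inf k)"
        using l by (intro mult_right_mono) auto
      also have "\<dots> < (\<bar>c\<bar> + 1) * (e / (2 * (\<bar>c\<bar> + 1)))"
        using D(3) by (intro mult_strict_left_mono) (auto simp: \<delta>'_def)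
      finally show "\<bar>c\<bar> * (\<Sum>k\<in>D. Sup k - Inf k) < (\<bar>c\<bar> + 1) * (e / (2 * (\<bar>c\<bar> + 1)))" .
    qed
    also have "(norm v + 1) * e1 = e / 2"
    proof -
      have "norm v + 1 \<noteq> 0" using norm_ge_zero[of v] by linarith
      then show ?thesis unfolding e1_def by (metis mult.commute nonzero_mult_divide_mult_cancel_left times_divide_eq_right)
    qed
    also have "(\<bar>c\<bar> + 1) * (e / (2 * (\<bar>c\<bar> + 1))) = e / 2"
      by (simp add: field_simps)
    finally show "(\<Sum>k\<in>D. norm (v \<bullet> x (Sup k) - c * Sup k - (v \<bullet> x (Inf k) - c * Inf k))) < e"
      by simp
  qed
qed

text \<open>Takes the place of integrating the velocity: \<open>v \<bullet> x t - c * t\<close> has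
  a nonpositive derivative off a null set and is absolutely continuous, hence does not
  increase.\<close>

lemma ae_solution_inner_le:
  assumes sol: "ae_solution_on a b x h" and st: "a \<le> s" "s \<le> t" "t \<le> b"
    and le: "\<And>r. r \<in> {s..t} \<Longrightarrow> v \<bullet> h r \<le> c"
  shows "v \<bullet> (x t - x s) \<le> c * (t - s)"
proof -
  have ac: "abs_continuous_on a b x" and ae: "AE r in lebesgue_on {a..b}. (x has_vector_derivative h r) (at r)"
    using sol by (auto simp: ae_solution_on_def)
  have "AE r in lebesgue. r \<in> {a..b} \<longrightarrow> (x has_vector_derivative h r) (at r)"
    using ae by (simp add: AE_restrict_space_iff)
  then obtain N where N: "N \<in> null_sets lebesgue" and
    Nc: "{r \<in> space lebesgue. \<not> (r \<in> {a..b} \<longrightarrow> (x has_vector_derivative h r) (at r))} \<subseteq> N"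
    unfolding eventually_ae_filter by blast
  have "v \<bullet> x t - c * t \<le> v \<bullet> x s - c * s"
  proof (rule abs_continuous_nonincreasing[where N = N and \<phi> = "\<lambda>t. v \<bullet> x t - c * t"])
    show "abs_continuous_on s t (\<lambda>t. v \<bullet> x t - c * t)"
      using abs_continuous_on_subinterval[OF ac st(1,3)] by (rule abs_continuous_on_inner_linear)
    show "negligible N" using N by (simp add: negligible_iff_null_sets)
    fix r assume r: "r \<in> {s..t} - N"
    then have "r \<in> {a..b}" "r \<notin> N" using st by auto
    then have "(x has_vector_derivative h r) (at r)" using Nc by auto
    then have "((\<lambda>t. v \<bullet> x t - c * t) has_real_derivative v \<bullet> h r - c) (at r)"
      by (auto simp: has_real_derivative_iff_has_vector_derivative intro!: derivative_eq_intros
          has_vector_derivative_diff bounded_linear.has_vector_derivative[OF bounded_linear_inner_right])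
    then show "\<exists>l\<le>0. ((\<lambda>t. v \<bullet> x t - c * t) has_real_derivative l) (at r)"
      using le[of r] r by (intro exI[of _ "v \<bullet> h r - c"]) auto
  qed (rule st)
  then show ?thesis by (simp add: inner_diff_right algebra_simps)
qed

text \<open>The direction \<open>x t - x s\<close> itself is used as the test vector.\<close>

lemma ae_solution_norm_le:
  assumes sol: "ae_solution_on a b x h" and st: "a \<le> s" "s \<le> t" "t \<le> b"
    and le: "\<And>r. r \<in> {s..t} \<Longrightarrow> norm (h r) \<le> c"
  shows "norm (x t - x s) \<le> c * (t - s)"
proof (cases "x t = x s")
  case True
  have "0 \<le> c" using order_trans[OF norm_ge_zero le[of s]] st by simp
  then show ?thesis using True st by simp
next
  case False
  have "(x t - x s) \<bullet> (x t - x s) \<le> (norm (x t - x s) * c) * (t - s)"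
  proof (rule ae_solution_inner_le[OF sol st])
    fix r assume "r \<in> {s..t}"
    then have "norm (h r) \<le> c" by (rule le)
    then show "(x t - x s) \<bullet> h r \<le> norm (x t - x s) * c"
      by (meson mult_left_mono norm_cauchy_schwarz norm_ge_zero order_trans)
  qed
  then have "norm (x t - x s) * norm (x t - x s) \<le> norm (x t - x s) * (c * (t - s))"
    by (simp add: dot_square_norm power2_eq_square mult.assoc)
  then show ?thesis using False by simp
qed

section \<open>Partitions and growth of motions\<close>

lemma partition_gap:
  assumes "is_partition \<Delta>"
  obtains m where "0 < m" "\<And>i. \<Delta> i + m \<le> \<Delta> (Suc i)"
proof
  show "0 < (INF i. \<Delta> (Suc i) - \<Delta> i)" using assms by (simp add: is_partition_def)
  fix i
  have "bdd_below (range (\<lambda>i. \<Delta> (Suc i) - \<Delta> i))"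
    using assms by (intro bdd_belowI[of _ 0]) (auto simp: is_partition_def less_imp_le)
  then have "(INF i. \<Delta> (Suc i) - \<Delta> i) \<le> \<Delta> (Suc i) - \<Delta> i" by (rule cINF_lower) simp
  then show "\<Delta> i + (INF i. \<Delta> (Suc i) - \<Delta> i) \<le> \<Delta> (Suc i)" by simp
qed

text \<open>The positive lower bound on the step lengths keeps the nodes from accumulating, so the
  cells exhaust the half-line.\<close>

lemma partition_unbounded:
  assumes "is_partition \<Delta>"
  shows "\<exists>i. t < \<Delta> i"
proof -
  obtain m where m: "0 < m" "\<And>i. \<Delta> i + m \<le> \<Delta> (Suc i)" using partition_gap[OF assms] by blast
  have "real i * m \<le> \<Delta> i" for i
  proof (induction i)
    case 0 then show ?case using assms by (simp add: is_partition_def)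
  next
    case (Suc i) then show ?case using m(2)[of i] by (simp add: algebra_simps)
  qed
  moreover obtain i where "t < real i * m" using reals_Archimedean3[OF m(1)] by blast
  ultimately show ?thesis by (meson less_le_trans)
qed

lemma partition_strict_mono: "is_partition \<Delta> \<Longrightarrow> strict_mono \<Delta>"
  by (simp add: is_partition_def strict_mono_Suc_iff)

lemma partition_nonneg: "is_partition \<Delta> \<Longrightarrow> 0 \<le> \<Delta> i"
  using partition_strict_mono[of \<Delta>] strict_mono_less_eq[of \<Delta> 0 i] by (simp add: is_partition_def)

lemma partition_cell:
  assumes P: "is_partition \<Delta>" and t: "0 \<le> t"
  obtains i where "\<Delta> i \<le> t" "t < \<Delta> (Suc i)"
proof -
  obtain j where "t < \<Delta> j" using partition_unbounded[OF P] by blast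
  define k where "k = (LEAST j. t < \<Delta> j)"
  have k: "t < \<Delta> k" unfolding k_def using \<open>t < \<Delta> j\<close> by (rule LeastI)
  then have "k \<noteq> 0" using P t by (cases k) (auto simp: is_partition_def)
  then obtain i where i: "k = Suc i" using not0_implies_Suc by blast
  have "\<not> t < \<Delta> i" using not_less_Least[of i "\<lambda>j. t < \<Delta> j"] i k_def by simp
  then have "\<Delta> i \<le> t" by simp
  then show thesis using k i that by blast
qed

text \<open>Cells include their right endpoint, so the conclusion of one cell provides the premise
  at the next node.\<close>

lemma partition_induct [consumes 2, case_names start cell]:
  assumes P: "is_partition \<Delta>" and t: "0 \<le> t" and "S 0"
    and step: "\<And>i t. S (\<Delta> i) \<Longrightarrow> \<Delta> i \<le> t \<Longrightarrow> t \<le> \<Delta> (Suc i) \<Longrightarrow> S t"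
  shows "S t"
proof -
  have n: "S (\<Delta> i)" for i
  proof (induction i)
    case 0 then show ?case using P \<open>S 0\<close> by (simp add: is_partition_def)
  next
    case (Suc i) then show ?case using step[of i "\<Delta> (Suc i)"] P by (simp add: is_partition_def less_imp_le)
  qed
  obtain i where "\<Delta> i \<le> t" "t < \<Delta> (Suc i)" using partition_cell[OF P t] .
  then show ?thesis using step[OF n] by simp
qed

text \<open>A discrete Gronwall argument. At the point m of a cell where the norm is maximal, the
  growth condition gives \<open>(1 + norm (x m)) * (1 - w) \<le> 1 + norm (x a)\<close> with
  \<open>w = R * (m - a)\<close>. For \<open>w \<le> 1/2\<close> the factor
  \<open>1 / (1 - w)\<close> is at most \<open>exp (2 * w)\<close>, which explains the 2 in the
  exponent and the condition on the mesh.\<close>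

lemma motion_growth:
  assumes growth: "\<And>x a d. a \<in> A \<Longrightarrow> d \<in> D \<Longrightarrow> norm (F x a d) \<le> R * (1 + norm x)" and R: "0 \<le> R"
    and U: "U \<in> UNIV \<rightarrow> A" and part: "is_partition \<Delta>"
    and fine: "\<And>i. 2 * R * (\<Delta> (Suc i) - \<Delta> i) \<le> 1"
    and x: "x \<in> motions1 D F x0 U \<Delta>" and t: "0 \<le> t"
  shows "1 + norm (x t) \<le> (1 + norm x0) * exp (2 * R * t)"
  using part t
proof (induction rule: partition_induct)
  case start
  then show ?case using x by (simp add: motions1_def)
next
  case (cell i t)
  define a where "a = \<Delta> i"
  obtain d where d: "d \<in> measurable_controls (\<Delta> i) (\<Delta> (Suc i)) D"
    and sol: "ae_solution_on a (\<Delta> (Suc i)) x (\<lambda>t. F (x t) (U (x (\<Delta> i))) (d t))"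
    using x unfolding a_def by (auto simp: motions1_def)
  have "continuous_on {a..t} x"
    using x partition_nonneg[OF part, of i] by (auto simp: motions1_def a_def elim: continuous_on_subset)
  then have "continuous_on {a..t} (\<lambda>s. norm (x s))" by (rule continuous_on_norm)
  then obtain m where m: "m \<in> {a..t}" "\<And>s. s \<in> {a..t} \<Longrightarrow> norm (x s) \<le> norm (x m)"
    using continuous_attains_sup[of "{a..t}" "\<lambda>s. norm (x s)"] cell(2) a_def by auto
  have "norm (x m - x a) \<le> R * (1 + norm (x m)) * (m - a)"
  proof (rule ae_solution_norm_le[OF sol])
    fix r assume r: "r \<in> {a..m}"
    then have "d r \<in> D" using d m cell(3) by (auto simp: measurable_controls_def a_def)
    then have "norm (F (x r) (U (x (\<Delta> i))) (d r)) \<le> R * (1 + norm (x r))" using U by (intro growth) auto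
    also have "\<dots> \<le> R * (1 + norm (x m))" using m r R by (intro mult_left_mono) auto
    finally show "norm (F (x r) (U (x (\<Delta> i))) (d r)) \<le> R * (1 + norm (x m))" .
  qed (use m cell in auto)
  moreover have "norm (x m) \<le> norm (x a) + norm (x m - x a)" by (rule norm_triangle_sub)
  ultimately have *: "(1 + norm (x m)) * (1 - R * (m - a)) \<le> 1 + norm (x a)" by (simp add: algebra_simps)
  define w where "w = R * (m - a)"
  have "R * (m - a) \<le> R * (\<Delta> (Suc i) - \<Delta> i)"
    using m cell(3) R by (intro mult_left_mono) (auto simp: a_def)
  then have w: "0 \<le> w" "w \<le> 1/2" using m R fine[of i] by (auto simp: w_def)
  have "0 \<le> w * (1 - 2 * w)" using w by (intro mult_nonneg_nonneg) auto
  then have "1 \<le> (1 + 2 * w) * (1 - w)" by (simp add: algebra_simps)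
  also have "\<dots> \<le> exp (2 * w) * (1 - w)" using w exp_ge_add_one_self[of "2 * w"] by (intro mult_right_mono) auto
  finally have e: "1 \<le> exp (2 * w) * (1 - w)" .
  have "1 + norm (x t) \<le> 1 + norm (x m)" using m cell(2) by (simp add: a_def)
  also have "\<dots> \<le> (1 + norm (x m)) * (exp (2 * w) * (1 - w))" using mult_left_mono[OF e, of "1 + norm (x m)"] by simp
  also have "\<dots> = (1 + norm (x m)) * (1 - w) * exp (2 * w)" by simp
  also have "\<dots> \<le> (1 + norm (x a)) * exp (2 * w)" using * unfolding w_def by (intro mult_right_mono) auto
  also have "\<dots> \<le> ((1 + norm x0) * exp (2 * R * a)) * exp (2 * R * (t - a))"
  proof (rule mult_mono)
    show "1 + norm (x a) \<le> (1 + norm x0) * exp (2 * R * a)" using cell(1) by (simp add: a_def)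
    show "exp (2 * w) \<le> exp (2 * R * (t - a))" using m R by (auto simp: w_def intro: mult_left_mono)
  qed auto
  also have "\<dots> = (1 + norm x0) * exp (2 * R * t)"
    by (simp add: mult.assoc flip: exp_add) (simp add: algebra_simps)
  finally show ?case .
qed

section \<open>Existence of motions\<close>

lemma continuous_on_integral_from_0:
  fixes h :: "real \<Rightarrow> 'a::banach"
  assumes h: "continuous_on {0..} h"
  shows "continuous_on {0..} (\<lambda>s. integral {0..s} h)"
  unfolding continuous_on_eq_continuous_within
proof
  fix s :: real assume s: "s \<in> {0..}"
  have "h integrable_on {0..s+1}"
    by (rule integrable_continuous_real, rule continuous_on_subset[OF h]) auto
  then have "continuous_on {0..s+1} (\<lambda>s. integral {0..s} h)" by (rule indefinite_integral_continuous_1)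
  then have "continuous (at s within {0..s+1}) (\<lambda>s. integral {0..s} h)"
    using s by (auto simp: continuous_on_eq_continuous_within)
  moreover have "at s within {0..s+1} = at s within {0..}"
    by (rule at_within_nhd[where S = "{..<s+1}"]) auto
  ultimately show "continuous (at s within {0..}) (\<lambda>s. integral {0..s} h)" by simp
qed

text \<open>Integrating \<open>exp (K * r)\<close> and weighting it back gains the factor
  \<open>1 / K\<close>, the source of the contraction in the Picard iteration.\<close>

lemma weighted_integral_bound:
  fixes h :: "real \<Rightarrow> 'a::banach"
  assumes h: "continuous_on {0..} h" and K: "0 < K" and s: "0 \<le> s" and C: "0 \<le> C"
    and le: "\<And>r. 0 \<le> r \<Longrightarrow> norm (h r) \<le> C * exp (K * r)"
  shows "norm (exp (- K * s) *\<^sub>R integral {0..s} h) \<le> C / K"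
proof -
  have "((\<lambda>r. C * exp (K * r)) has_integral (C * exp (K * s) / K - C * exp (K * 0) / K)) {0..s}"
    using s K by (intro fundamental_theorem_of_calculus)
      (auto intro!: derivative_eq_intros simp flip: has_real_derivative_iff_has_vector_derivative)
  then have I: "(\<lambda>r. C * exp (K * r)) integrable_on {0..s}"
    "integral {0..s} (\<lambda>r. C * exp (K * r)) = C * exp (K * s) / K - C / K"
    by (auto simp: has_integral_iff)
  have "norm (integral {0..s} h) \<le> integral {0..s} (\<lambda>r. C * exp (K * r))"
    using le by (intro integral_norm_bound_integral[OF _ I(1)] integrable_continuous_real continuous_on_subset[OF h]) auto
  also have "\<dots> \<le> C * exp (K * s) / K" using I(2) C K by simp
  finally have "exp (- K * s) * norm (integral {0..s} h) \<le> exp (- K * s) * (C * exp (K * s) / K)"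
    by (intro mult_left_mono) auto
  also have "\<dots> = C / K" by (simp add: exp_minus)
  finally show ?thesis by simp
qed

text \<open>With the weight \<open>exp (- K t)\<close>, \<open>K\<close> larger than the Lipschitz constant, the Picard operator
  is a contraction on the whole half-line at once.\<close>

lemma lipschitz_ode_global_solution:
  fixes F :: "'a::banach \<Rightarrow> 'a"
  assumes lip: "\<And>x y. norm (F x - F y) \<le> L * norm (x - y)"
  obtains x where "x 0 = x0" "continuous_on {0..} x"
    "\<And>t. 0 < t \<Longrightarrow> (x has_vector_derivative F (x t)) (at t)"
proof -
  define K where "K = 2 * \<bar>L\<bar> + 1"
  have K: "0 < K" "\<bar>L\<bar> / K \<le> 1/2" by (auto simp: K_def field_simps)
  have lip': "norm (F x - F y) \<le> \<bar>L\<bar> * norm (x - y)" for x y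
    using lip[of x y] by (meson abs_ge_self mult_right_mono norm_ge_zero order_trans)
  have contF: "continuous_on UNIV F"
    using lip' by (intro lipschitz_on_continuous_on[of "\<bar>L\<bar>"] lipschitz_onI) (auto simp: dist_norm)
  \<comment> \<open>The unknown y is the weighted deviation
    \<open>exp (- K * t) *\<^sub>R (x t - x0)\<close>, which stays bounded. In the operator
    \<open>T\<close>, \<open>max 0 t\<close> extends it to the whole line, where bounded continuous
    functions form a complete space.\<close>
  define h where "h y r = F (x0 + exp (K * r) *\<^sub>R apply_bcontfun y r)" for y :: "real \<Rightarrow>\<^sub>C 'a" and r
  define T where "T y t = exp (- K * max 0 t) *\<^sub>R integral {0..max 0 t} (h y)" for y :: "real \<Rightarrow>\<^sub>C 'a" and t
  have hc: "continuous_on S (h y)" for y S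
    unfolding h_def
    by (intro continuous_on_compose2[OF contF] continuous_intros continuous_on_subset[OF continuous_on_apply_bcontfun]) auto
  have Tb: "T y \<in> bcontfun" for y
  proof (rule bcontfun_normI)
    have "continuous_on UNIV (\<lambda>t. integral {0..max 0 t} (h y))"
      by (rule continuous_on_compose2[OF continuous_on_integral_from_0[OF hc]]) (auto intro!: continuous_intros)
    then show "continuous_on UNIV (T y)" unfolding T_def by (intro continuous_intros)
    fix t
    show "norm (T y t) \<le> (norm (F x0) + \<bar>L\<bar> * norm y) / K"
      unfolding T_def
    proof (rule weighted_integral_bound[OF hc K(1)])
      fix r :: real assume r: "0 \<le> r"
      have "norm (h y r) \<le> norm (F x0) + norm (h y r - F x0)" by (rule norm_triangle_sub)
      also have "norm (h y r - F x0) \<le> \<bar>L\<bar> * (exp (K * r) * norm (apply_bcontfun y r))"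
        unfolding h_def by (rule order_trans[OF lip']) simp
      also have "\<dots> \<le> \<bar>L\<bar> * (exp (K * r) * norm y)"
        by (intro mult_left_mono norm_bounded) auto
      also have "norm (F x0) \<le> norm (F x0) * exp (K * r)" using r K by (simp add: mult_le_cancel_left1)
      finally show "norm (h y r) \<le> (norm (F x0) + \<bar>L\<bar> * norm y) * exp (K * r)"
        by (simp add: algebra_simps)
    qed auto
  qed
  define TT where "TT y = Bcontfun (T y)" for y
  have TT: "apply_bcontfun (TT y) = T y" for y unfolding TT_def using Bcontfun_inverse[OF Tb] .
  have "\<exists>!y. TT y = y"
  proof (rule banach_fix_type)
    show "(0::real) \<le> 1/2" "(1/2::real) < 1" by auto
    show "\<forall>y z. dist (TT y) (TT z) \<le> 1/2 * dist y z"
    proof (intro allI dist_bound)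
      fix y z :: "real \<Rightarrow>\<^sub>C 'a" and t
      have i: "h y integrable_on {0..max 0 t}" for y by (intro integrable_continuous_real hc)
      have "dist (apply_bcontfun (TT y) t) (apply_bcontfun (TT z) t)
          = norm (exp (- K * max 0 t) *\<^sub>R integral {0..max 0 t} (\<lambda>r. h y r - h z r))"
        unfolding TT T_def dist_norm by (simp add: integral_diff[OF i i] scaleR_diff_right)
      also have "\<dots> \<le> (\<bar>L\<bar> * dist y z) / K"
      proof (rule weighted_integral_bound[OF _ K(1)])
        show "continuous_on {0..} (\<lambda>r. h y r - h z r)" by (intro continuous_on_diff hc)
        fix r :: real
        have "norm (h y r - h z r) \<le> \<bar>L\<bar> * norm (exp (K * r) *\<^sub>R (apply_bcontfun y r - apply_bcontfun z r))"
          unfolding h_def by (rule order_trans[OF lip']) (simp add: scaleR_diff_right)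
        also have "\<dots> = \<bar>L\<bar> * (exp (K * r) * dist (apply_bcontfun y r) (apply_bcontfun z r))"
          by (simp add: dist_norm)
        also have "\<dots> \<le> \<bar>L\<bar> * (exp (K * r) * dist y z)"
          by (intro mult_left_mono dist_bounded) auto
        finally show "norm (h y r - h z r) \<le> \<bar>L\<bar> * dist y z * exp (K * r)" by (simp add: algebra_simps)
      qed auto
      also have "\<dots> \<le> 1/2 * dist y z" using mult_right_mono[OF K(2), of "dist y z"] by simp
      finally show "dist (apply_bcontfun (TT y) t) (apply_bcontfun (TT z) t) \<le> 1/2 * dist y z" .
    qed
  qed
  then obtain y where "TT y = y" by blast
  then have y: "apply_bcontfun y t = T y t" for t using TT[of y] by simp
  define x where "x t = x0 + exp (K * t) *\<^sub>R apply_bcontfun y t" for t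
  have hx: "h y = (\<lambda>r. F (x r))" by (simp add: fun_eq_iff h_def x_def)
  have xc: "continuous_on S x" for S
    unfolding x_def by (intro continuous_intros continuous_on_subset[OF continuous_on_apply_bcontfun]) auto
  have xi: "x t = x0 + integral {0..t} (\<lambda>r. F (x r))" if "0 \<le> t" for t
    using that unfolding x_def[of t] y T_def by (simp add: exp_minus hx max_absorb2)
  show thesis
  proof (rule that[of x])
    show "x 0 = x0" using xi[of 0] by simp
    show "continuous_on {0..} x" by (rule xc)
    fix t :: real assume t: "0 < t"
    have "((\<lambda>s. integral {0..s} (\<lambda>r. F (x r))) has_vector_derivative F (x t)) (at t within {0..t+1})"
      using t by (intro integral_has_vector_derivative continuous_on_compose2[OF contF] xc) auto
    moreover have "at t within {0..t+1} = at t"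
      using t by (intro at_within_interior) auto
    ultimately have "((\<lambda>s. x0 + integral {0..s} (\<lambda>r. F (x r))) has_vector_derivative F (x t)) (at t)"
      by (auto intro!: derivative_eq_intros)
    then show "(x has_vector_derivative F (x t)) (at t)"
      by (rule has_vector_derivative_transform_within_open[where S = "{0<..}"]) (use t xi in auto)
  qed
qed

lemma abs_continuous_on_Lipschitz:
  assumes lip: "\<And>s t. a \<le> s \<Longrightarrow> s \<le> t \<Longrightarrow> t \<le> b \<Longrightarrow> norm (x t - x s) \<le> C * (t - s)"
  shows "abs_continuous_on a b x"
  unfolding abs_continuous_on_def
proof (intro allI impI)
  fix e :: real assume e: "0 < e"
  have d0: "0 < e / (\<bar>C\<bar> + 1)" using e by simp
  have "(\<Sum>k\<in>D. norm (x (Sup k) - x (Inf k))) < e"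
    if D: "D division_of T" "T \<subseteq> {a..b}" "(\<Sum>k\<in>D. Sup k - Inf k) < e / (\<bar>C\<bar> + 1)" for D T
  proof -
    have k: "norm (x (Sup k) - x (Inf k)) \<le> (\<bar>C\<bar> + 1) * (Sup k - Inf k)" if kD: "k \<in> D" for k
    proof -
      obtain u v where uv: "k = {u..v}" "u \<le> v"
        using division_ofD(3,4)[OF D(1) kD] by fastforce
      moreover have "k \<subseteq> {a..b}" using division_ofD(2)[OF D(1) kD] D(2) by blast
      ultimately have "norm (x v - x u) \<le> C * (v - u)" by (intro lip) auto
      also have "\<dots> \<le> (\<bar>C\<bar> + 1) * (v - u)" using uv by (intro mult_right_mono) auto
      finally show ?thesis using uv by simp
    qed
    have "(\<Sum>k\<in>D. norm (x (Sup k) - x (Inf k))) \<le> (\<bar>C\<bar> + 1) * (\<Sum>k\<in>D. Sup k - Inf k)"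
      unfolding sum_distrib_left by (rule sum_mono) (rule k)
    also have "\<dots> < e" using D(3) by (simp add: field_simps)
    finally show ?thesis .
  qed
  then show "\<exists>\<delta>>0. \<forall>D T. D division_of T \<and> T \<subseteq> {a..b} \<and> (\<Sum>k\<in>D. Sup k - Inf k) < \<delta> \<longrightarrow>
        (\<Sum>k\<in>D. norm (x (Sup k) - x (Inf k))) < e"
    using d0 by blast
qed

lemma exists_common_motion:
  fixes f :: "real ^ 'd \<Rightarrow> 'p::topological_space \<Rightarrow> 'q::topological_space \<Rightarrow> real ^ 'd"
  assumes part: "is_partition \<Delta>" and U: "U \<in> UNIV \<rightarrow> P" and V: "V \<in> UNIV \<rightarrow> Q"
    and lip: "\<And>x y p q. p \<in> P \<Longrightarrow> q \<in> Q \<Longrightarrow> norm (f x p q - f y p q) \<le> L * norm (x - y)"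
  obtains x where "x \<in> motions1 Q f x0 U \<Delta>" "x \<in> motions2 P f x0 V \<Delta>"
proof -
  define F where "F z x = f x (U z) (V z)" for z x
  have lipF: "norm (F z x - F z y) \<le> L * norm (x - y)" for z x y
    unfolding F_def using U V by (intro lip) auto
  have "\<exists>x. x 0 = z \<and> continuous_on {0..} x \<and> (\<forall>t>0. (x has_vector_derivative F z (x t)) (at t))" for z
    using lipschitz_ode_global_solution[OF lipF[of z], of z] by metis
  then obtain S where S0: "\<And>z. S z 0 = z" and Sc: "\<And>z. continuous_on {0..} (S z)"
    and Sd: "\<And>z t. 0 < t \<Longrightarrow> (S z has_vector_derivative F z (S z t)) (at t)"
    by metis
  define Z where "Z = rec_nat x0 (\<lambda>i z. S z (\<Delta> (Suc i) - \<Delta> i))"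
  have Z: "Z 0 = x0" "\<And>i. Z (Suc i) = S (Z i) (\<Delta> (Suc i) - \<Delta> i)" by (simp_all add: Z_def)
  define idx where "idx t = (THE i. \<Delta> i \<le> t \<and> t < \<Delta> (Suc i))" for t
  have mono: "strict_mono \<Delta>" using partition_strict_mono[OF part] .
  have idx: "idx t = i" if "\<Delta> i \<le> t" "t < \<Delta> (Suc i)" for i t
    unfolding idx_def
  proof (rule the_equality)
    fix j assume j: "\<Delta> j \<le> t \<and> t < \<Delta> (Suc j)"
    have "\<Delta> i < \<Delta> (Suc j)" "\<Delta> j < \<Delta> (Suc i)" using that j by linarith+
    then show "j = i" using strict_mono_less[OF mono] by (simp add: less_Suc_eq_le)
  qed (use that in simp)
  define x where "x t = S (Z (idx t)) (t - \<Delta> (idx t))" for t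
  have lt: "\<Delta> i < \<Delta> (Suc i)" for i using part by (simp add: is_partition_def)
  \<comment> \<open>At the right node \<open>idx\<close> has already moved on to the next cell; the
    recursion for \<open>Z\<close> makes both formulas agree there, which gives continuity across
    nodes.\<close>
  have xi: "x t = S (Z i) (t - \<Delta> i)" if "\<Delta> i \<le> t" "t \<le> \<Delta> (Suc i)" for i t
  proof (cases "t = \<Delta> (Suc i)")
    case True
    then have "idx t = Suc i" using lt[of "Suc i"] by (intro idx) auto
    then show ?thesis using True by (simp add: x_def S0 Z)
  next
    case False
    then have "idx t = i" using that by (intro idx) auto
    then show ?thesis by (simp add: x_def)
  qed
  have xnode: "x (\<Delta> i) = Z i" for i using xi[of i "\<Delta> i"] lt[of i] by (simp add: S0)
  have xd: "(x has_vector_derivative F (x (\<Delta> i)) (x t)) (at t)" if t: "\<Delta> i < t" "t < \<Delta> (Suc i)" for i t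
  proof -
    have "((\<lambda>s. s - \<Delta> i) has_real_derivative 1) (at t)" by (auto intro!: derivative_eq_intros)
    then have "((\<lambda>s. S (Z i) (s - \<Delta> i)) has_vector_derivative F (Z i) (S (Z i) (t - \<Delta> i))) (at t)"
      using vector_diff_chain_at[of "\<lambda>s. s - \<Delta> i" 1 t "S (Z i)" "F (Z i) (S (Z i) (t - \<Delta> i))"]
        Sd[of "t - \<Delta> i" "Z i"] t
      by (auto simp: o_def intro!: derivative_eq_intros simp flip: has_real_derivative_iff_has_vector_derivative)
    then show ?thesis
      unfolding xnode xi[OF less_imp_le[OF t(1)] less_imp_le[OF t(2)]]
      by (rule has_vector_derivative_transform_within_open[where S = "{\<Delta> i<..<\<Delta> (Suc i)}"])
        (use t xi[symmetric] in auto)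
  qed
  have xcell: "continuous_on {\<Delta> i..\<Delta> (Suc i)} x" for i
  proof -
    have "continuous_on {\<Delta> i..\<Delta> (Suc i)} (\<lambda>s. S (Z i) (s - \<Delta> i))"
      by (rule continuous_on_compose2[OF Sc]) (auto intro!: continuous_intros)
    then show ?thesis by (rule continuous_on_eq) (use xi[symmetric] in auto)
  qed
  have xn: "continuous_on {0..\<Delta> n} x" for n
  proof (induction n)
    case 0 then show ?case using part by (simp add: is_partition_def)
  next
    case (Suc n)
    have "{0..\<Delta> (Suc n)} = {0..\<Delta> n} \<union> {\<Delta> n..\<Delta> (Suc n)}"
      using partition_nonneg[OF part, of n] lt[of n] by auto
    then show ?case using continuous_on_closed_Un[OF _ _ Suc xcell[of n]] by simp
  qed
  have xc: "continuous_on {0..} x"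
    unfolding continuous_on_eq_continuous_within
  proof
    fix s :: real assume s: "s \<in> {0..}"
    obtain n where n: "s < \<Delta> n" using partition_unbounded[OF part] by blast
    have "continuous (at s within {0..\<Delta> n}) x"
      using xn[of n] s n by (auto simp: continuous_on_eq_continuous_within)
    moreover have "at s within {0..\<Delta> n} = at s within {0..}"
      by (rule at_within_nhd[where S = "{..<\<Delta> n}"]) (use n in auto)
    ultimately show "continuous (at s within {0..}) x" by simp
  qed
  have sol: "ae_solution_on (\<Delta> i) (\<Delta> (Suc i)) x (\<lambda>t. F (x (\<Delta> i)) (x t))" for i
    unfolding ae_solution_on_def
  proof
    have "continuous_on UNIV (F (x (\<Delta> i)))"
    proof (intro lipschitz_on_continuous_on[of "\<bar>L\<bar>"] lipschitz_onI)
      fix z y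
      have "norm (F (x (\<Delta> i)) z - F (x (\<Delta> i)) y) \<le> L * norm (z - y)" by (rule lipF)
      also have "\<dots> \<le> \<bar>L\<bar> * norm (z - y)" by (intro mult_right_mono) auto
      finally show "dist (F (x (\<Delta> i)) z) (F (x (\<Delta> i)) y) \<le> \<bar>L\<bar> * dist z y" by (simp add: dist_norm)
    qed auto
    then have "continuous_on {\<Delta> i..\<Delta> (Suc i)} (\<lambda>t. F (x (\<Delta> i)) (x t))"
      using xcell[of i] by (rule continuous_on_compose2) auto
    then have "bounded ((\<lambda>t. F (x (\<Delta> i)) (x t)) ` {\<Delta> i..\<Delta> (Suc i)})"
      by (intro compact_imp_bounded compact_continuous_image) auto
    then obtain C where C: "\<And>t. t \<in> {\<Delta> i..\<Delta> (Suc i)} \<Longrightarrow> norm (F (x (\<Delta> i)) (x t)) \<le> C"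
      unfolding bounded_iff by blast
    \<comment> \<open>The velocity is bounded by C inside the cell and x is continuous up to its
      ends, so x is Lipschitz on the closed cell.\<close>
    show "abs_continuous_on (\<Delta> i) (\<Delta> (Suc i)) x"
    proof (rule abs_continuous_on_Lipschitz)
      fix s t assume st: "\<Delta> i \<le> s" "s \<le> t" "t \<le> \<Delta> (Suc i)"
      show "norm (x t - x s) \<le> C * (t - s)"
      proof (cases "s = t")
        case False
        have "norm (x t - x s) \<le> C * t - C * s"
        proof (rule differentiable_bound_general[where f' = "\<lambda>r. F (x (\<Delta> i)) (x r)" and \<phi>' = "\<lambda>r. C"])
          show "continuous_on {s..t} x" using xcell[of i] by (rule continuous_on_subset) (use st in auto)
          fix r assume r: "s < r" "r < t"
          show "(x has_vector_derivative F (x (\<Delta> i)) (x r)) (at r)" using r st by (intro xd) auto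
          show "norm (F (x (\<Delta> i)) (x r)) \<le> C" using r st by (intro C) auto
          show "((\<lambda>r. C * r) has_vector_derivative C) (at r)"
            by (auto intro!: derivative_eq_intros simp flip: has_real_derivative_iff_has_vector_derivative)
        qed (use st False in \<open>auto intro!: continuous_intros\<close>)
        then show ?thesis by (simp add: algebra_simps)
      qed simp
    qed
    \<comment> \<open>Only at the two nodes may the two-sided derivative fail, because the controls
      jump there.\<close>
    have "AE t in lebesgue. t \<in> {\<Delta> i..\<Delta> (Suc i)} \<longrightarrow> (x has_vector_derivative F (x (\<Delta> i)) (x t)) (at t)"
    proof (rule AE_I')
      show "{\<Delta> i, \<Delta> (Suc i)} \<in> null_sets lebesgue"
        by (simp add: negligible_iff_null_sets[symmetric] negligible_finite)
      show "{t \<in> space lebesgue. \<not> (t \<in> {\<Delta> i..\<Delta> (Suc i)} \<longrightarrow>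
          (x has_vector_derivative F (x (\<Delta> i)) (x t)) (at t))} \<subseteq> {\<Delta> i, \<Delta> (Suc i)}"
        using xd[of i] by (auto simp: not_le) (meson antisym_conv2 linorder_not_le)
    qed
    then show "AE t in lebesgue_on {\<Delta> i..\<Delta> (Suc i)}. (x has_vector_derivative F (x (\<Delta> i)) (x t)) (at t)"
      by (simp add: AE_restrict_space_iff)
  qed
  have x0: "x 0 = x0" using xnode[of 0] part by (simp add: is_partition_def Z)
  have "x \<in> motions1 Q f x0 U \<Delta>"
    unfolding motions1_def
  proof (intro CollectI conjI xc x0 allI)
    fix i
    show "\<exists>q\<in>measurable_controls (\<Delta> i) (\<Delta> (Suc i)) Q.
        ae_solution_on (\<Delta> i) (\<Delta> (Suc i)) x (\<lambda>t. f (x t) (U (x (\<Delta> i))) (q t))"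
      using sol[of i] V unfolding F_def
      by (intro bexI[of _ "\<lambda>_. V (x (\<Delta> i))"]) (auto simp: measurable_controls_def)
  qed
  moreover have "x \<in> motions2 P f x0 V \<Delta>"
    unfolding motions2_def
  proof (intro CollectI conjI xc x0 allI)
    fix i
    show "\<exists>p\<in>measurable_controls (\<Delta> i) (\<Delta> (Suc i)) P.
        ae_solution_on (\<Delta> i) (\<Delta> (Suc i)) x (\<lambda>t. f (x t) (p t) (V (x (\<Delta> i))))"
      using sol[of i] U unfolding F_def
      by (intro bexI[of _ "\<lambda>_. U (x (\<Delta> i))"]) (auto simp: measurable_controls_def)
  qed
  ultimately show thesis by (rule that)
qed

section \<open>The penalty function\<close>

text \<open>Concavity of the power, in the form of the weighted inequality of arithmetic and
  geometric means \<open>t powr \<nu> \<le> (1 - \<nu>) + \<nu> * t\<close> for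
  \<open>t = b / a\<close>. It follows from \<open>ln y \<le> y - 1\<close> at \<open>t / u\<close>
  and \<open>1 / u\<close>, whose weighted right-hand sides cancel.\<close>

lemma powr_le_tangent:
  fixes a b \<nu> :: real
  assumes a: "0 < a" and b: "0 < b" and \<nu>: "0 < \<nu>" "\<nu> \<le> 1"
  shows "b powr \<nu> \<le> a powr \<nu> + \<nu> * a powr (\<nu> - 1) * (b - a)"
proof -
  define t where "t = b / a"
  define u where "u = (1 - \<nu>) + \<nu> * t"
  have t: "0 < t" using a b by (simp add: t_def)
  have u: "0 < u" using t \<nu> by (simp add: u_def add_nonneg_pos)
  have "\<nu> * ln (t / u) + (1 - \<nu>) * ln (1 / u) \<le> \<nu> * (t / u - 1) + (1 - \<nu>) * (1 / u - 1)"
    using t u \<nu> by (intro add_mono mult_left_mono ln_le_minus_one) auto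
  also have "\<dots> = (\<nu> * t + (1 - \<nu>)) / u - 1" using u by (simp add: field_simps)
  also have "\<dots> = 0" using u by (simp add: u_def add.commute)
  finally have "\<nu> * ln t \<le> ln u" using t u by (simp add: ln_div algebra_simps)
  then have "t powr \<nu> \<le> u" using t u by (simp add: powr_def) (metis exp_le_cancel_iff exp_ln)
  then have "a powr \<nu> * t powr \<nu> \<le> a powr \<nu> * u" by (intro mult_left_mono) auto
  moreover have "a powr \<nu> * t powr \<nu> = b powr \<nu>"
    using a t by (simp add: t_def flip: powr_mult)
  moreover have "a powr \<nu> * u = a powr \<nu> + \<nu> * a powr (\<nu> - 1) * (b - a)"
    using a by (simp add: u_def t_def powr_diff field_simps)
  ultimately show ?thesis by simp
qed

text \<open>The small exponent keeps \<open>\<lambda>\<bar>r\<bar>\<bar>\<nabla>pen r\<bar>\<close>, the price of evaluating the dynamics at a shifted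
  point, below \<open>2\<lambda>\<nu> pen r\<close>; hence it is absorbed by the discount rate \<open>g \<ge> b\<close>.\<close>

definition pen :: "real \<Rightarrow> real \<Rightarrow> real \<Rightarrow> 'a::real_inner \<Rightarrow> real" where
  "pen \<nu> \<kappa> \<eta> r = ((norm r)\<^sup>2 + \<eta>) powr \<nu> / \<kappa>"

text \<open>The derivative of the penalty with respect to \<open>(norm r)\<^sup>2\<close>; the
  gradient at r is therefore
  \<open>(2 * pen_slope \<nu> \<kappa> \<eta> r) *\<^sub>R r\<close>.\<close>

definition pen_slope :: "real \<Rightarrow> real \<Rightarrow> real \<Rightarrow> 'a::real_inner \<Rightarrow> real" where
  "pen_slope \<nu> \<kappa> \<eta> r = \<nu> * ((norm r)\<^sup>2 + \<eta>) powr (\<nu> - 1) / \<kappa>"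

context
  fixes \<nu> \<kappa> \<eta> :: real
  assumes \<nu>: "0 < \<nu>" "\<nu> \<le> 1" and \<kappa>: "0 < \<kappa>" and \<eta>: "0 < \<eta>"
begin

lemma pen_nonneg: "0 \<le> pen \<nu> \<kappa> \<eta> r"
  using \<kappa> by (simp add: pen_def)

lemma pen_slope_nonneg: "0 \<le> pen_slope \<nu> \<kappa> \<eta> r"
  using \<nu> \<kappa> by (simp add: pen_slope_def)

text \<open>Concavity in the squared norm gives a first-order expansion with an explicit quadratic
  remainder. It serves twice: for the proximal inequality at the minimizer and for the growth of the
  penalty along a motion.\<close>

lemma pen_add_le:
  "pen \<nu> \<kappa> \<eta> (r + h) \<le> pen \<nu> \<kappa> \<eta> r + pen_slope \<nu> \<kappa> \<eta> r * (2 * (r \<bullet> h) + (norm h)\<^sup>2)"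
proof -
  have "(norm (r + h))\<^sup>2 + \<eta> - ((norm r)\<^sup>2 + \<eta>) = 2 * (r \<bullet> h) + (norm h)\<^sup>2"
    by (simp add: power2_norm_eq_inner inner_simps inner_commute)
  then have "((norm (r + h))\<^sup>2 + \<eta>) powr \<nu> \<le> ((norm r)\<^sup>2 + \<eta>) powr \<nu>
      + \<nu> * ((norm r)\<^sup>2 + \<eta>) powr (\<nu> - 1) * (2 * (r \<bullet> h) + (norm h)\<^sup>2)"
    using powr_le_tangent[of "(norm r)\<^sup>2 + \<eta>" "(norm (r + h))\<^sup>2 + \<eta>" \<nu>] \<eta> \<nu> by (simp add: add_nonneg_pos)
  then have "((norm (r + h))\<^sup>2 + \<eta>) powr \<nu> / \<kappa> \<le> (((norm r)\<^sup>2 + \<eta>) powr \<nu>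
      + \<nu> * ((norm r)\<^sup>2 + \<eta>) powr (\<nu> - 1) * (2 * (r \<bullet> h) + (norm h)\<^sup>2)) / \<kappa>"
    using \<kappa> by (intro divide_right_mono) auto
  then show ?thesis by (simp add: pen_def pen_slope_def add_divide_distrib)
qed

text \<open>The exponent \<open>\<nu> - 1\<close> is nonpositive, so the slope is largest at the
  origin, where \<open>\<eta> > 0\<close> keeps it finite. This bounds all quadratic remainders
  uniformly.\<close>

lemma pen_slope_le: "pen_slope \<nu> \<kappa> \<eta> (r::'a::real_inner) \<le> pen_slope \<nu> \<kappa> \<eta> (0::'a)"
proof -
  have "((norm r)\<^sup>2 + \<eta>) powr (\<nu> - 1) \<le> \<eta> powr (\<nu> - 1)"
    using \<nu> \<eta> by (intro powr_mono2') auto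
  then show ?thesis using \<nu> \<kappa> by (auto simp: pen_slope_def intro!: divide_right_mono mult_left_mono)
qed

lemma pen_slope_norm_le: "pen_slope \<nu> \<kappa> \<eta> r * (norm r)\<^sup>2 \<le> \<nu> * pen \<nu> \<kappa> \<eta> r"
proof -
  have p: "0 < (norm r)\<^sup>2 + \<eta>" using \<eta> by (simp add: add_nonneg_pos)
  have "((norm r)\<^sup>2 + \<eta>) powr (\<nu> - 1) * (norm r)\<^sup>2 \<le> ((norm r)\<^sup>2 + \<eta>) powr (\<nu> - 1) * ((norm r)\<^sup>2 + \<eta>)"
    using \<eta> by (intro mult_left_mono) auto
  also have "\<dots> = ((norm r)\<^sup>2 + \<eta>) powr \<nu>" using p by (simp add: powr_diff)
  finally have "\<nu> / \<kappa> * (((norm r)\<^sup>2 + \<eta>) powr (\<nu> - 1) * (norm r)\<^sup>2) \<le> \<nu> / \<kappa> * ((norm r)\<^sup>2 + \<eta>) powr \<nu>"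
    using \<nu> \<kappa> by (intro mult_left_mono) auto
  then show ?thesis by (simp add: pen_def pen_slope_def algebra_simps)
qed

lemma continuous_on_pen: "continuous_on S (pen \<nu> \<kappa> \<eta>)"
proof -
  have "(norm r)\<^sup>2 + \<eta> \<noteq> 0" for r :: 'a
    using \<eta> by (metis add_nonneg_pos less_irrefl zero_le_power2)
  then show ?thesis unfolding pen_def by (intro continuous_intros) (use \<kappa> in auto)
qed

end

text \<open>Each parameter meets one demand: \<nu> makes the shift cost fit under the discount rate
  b, \<kappa> lifts the penalty at distance \<rho> to at least \<open>2 * B + 2\<close>, above the
  oscillation of a function bounded by B, and \<eta> then sets the value at the origin to
  \<open>min \<zeta> 1\<close>.\<close>

lemma pen_parameters:
  fixes \<rho> B \<zeta> lam b :: real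
  assumes "0 < \<rho>" "0 \<le> B" "0 < \<zeta>" "0 \<le> lam" "0 < b"
  obtains \<nu> \<kappa> \<eta> where "0 < \<nu>" "\<nu> \<le> 1" "0 < \<kappa>" "0 < \<eta>" "2 * lam * \<nu> \<le> b"
    "pen \<nu> \<kappa> \<eta> (0::'a::real_inner) \<le> \<zeta>" "pen \<nu> \<kappa> \<eta> (0::'a) \<le> 1"
    "\<And>r::'a. \<rho> < norm r \<Longrightarrow> 2 * B + pen \<nu> \<kappa> \<eta> (0::'a) < pen \<nu> \<kappa> \<eta> r"
proof -
  define \<nu> where "\<nu> = min 1 (b / (2 * lam + 1))"
  define \<kappa> where "\<kappa> = (\<rho>\<^sup>2) powr \<nu> / (2 * B + 2)"
  define \<eta> where "\<eta> = (\<kappa> * min \<zeta> 1) powr (1 / \<nu>)"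
  have \<nu>: "0 < \<nu>" "\<nu> \<le> 1" using assms by (auto simp: \<nu>_def)
  have "2 * lam * \<nu> \<le> (2 * lam + 1) * (b / (2 * lam + 1))"
    using assms by (intro mult_mono) (auto simp: \<nu>_def)
  then have \<nu>2: "2 * lam * \<nu> \<le> b" using assms by simp
  have \<kappa>: "0 < \<kappa>" using assms by (simp add: \<kappa>_def)
  have \<eta>: "0 < \<eta>" using assms \<kappa> by (simp add: \<eta>_def)
  have "\<eta> powr \<nu> = \<kappa> * min \<zeta> 1" using \<nu> \<kappa> assms by (simp add: \<eta>_def powr_powr)
  then have p0: "pen \<nu> \<kappa> \<eta> (0::'a) = min \<zeta> 1" using \<kappa> by (simp add: pen_def)
  have "2 * B + pen \<nu> \<kappa> \<eta> (0::'a) < pen \<nu> \<kappa> \<eta> r" if "\<rho> < norm r" for r :: 'a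
  proof -
    have "\<rho>\<^sup>2 \<le> (norm r)\<^sup>2 + \<eta>"
      using that assms \<eta> power_mono[of \<rho> "norm r" 2] by linarith
    then have "(\<rho>\<^sup>2) powr \<nu> \<le> ((norm r)\<^sup>2 + \<eta>) powr \<nu>" using \<nu> by (intro powr_mono2) auto
    then have "(\<rho>\<^sup>2) powr \<nu> / \<kappa> \<le> pen \<nu> \<kappa> \<eta> r" using \<kappa> unfolding pen_def by (intro divide_right_mono) auto
    moreover have "(\<rho>\<^sup>2) powr \<nu> / \<kappa> = 2 * B + 2" using assms by (simp add: \<kappa>_def)
    ultimately show ?thesis using p0 by linarith
  qed
  then show thesis using that \<nu> \<nu>2 \<kappa> \<eta> p0 by simp
qed

section \<open>Semicontinuous functions on compact sets, and discounting over one cell\<close>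

lemma lsc_on_subset: "lsc_on S u \<Longrightarrow> T \<subseteq> S \<Longrightarrow> lsc_on T u"
  unfolding lsc_on_def by (meson at_le filter_leD subsetD)

lemma lsc_on_add_continuous:
  assumes u: "lsc_on S u" and h: "continuous_on S h"
  shows "lsc_on S (\<lambda>x. u x + h x)"
  unfolding lsc_on_def
proof (intro ballI allI impI)
  fix x c assume x: "x \<in> S" and c: "c < u x + h x"
  define e where "e = (u x + h x - c) / 2"
  have e: "0 < e" using c by (simp add: e_def)
  have "\<forall>\<^sub>F y in at x within S. u x - e < u y" using u x e unfolding lsc_on_def by simp
  moreover have "\<forall>\<^sub>F y in at x within S. h x - e < h y"
    using h x e unfolding continuous_on_def by (intro order_tendstoD(1)[of h "h x"]) auto
  ultimately show "\<forall>\<^sub>F y in at x within S. c < u y + h y"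
  proof eventually_elim
    case (elim y)
    have "c = u x - e + (h x - e)" by (simp add: e_def)
    then show ?case using elim by linarith
  qed
qed

text \<open>Were there no minimum, every x would have a better competitor \<open>z x\<close>, and
  semicontinuity would keep h above \<open>h (z x)\<close> near x. Among the finitely many
  competitors belonging to a subcover, the best one lies in some covering set and is beaten by
  another.\<close>

lemma lsc_on_attains_min:
  fixes h :: "'a::topological_space \<Rightarrow> real"
  assumes K: "compact K" "K \<noteq> {}" and h: "lsc_on K h"
  obtains x where "x \<in> K" "\<And>y. y \<in> K \<Longrightarrow> h x \<le> h y"
proof (rule ccontr)
  assume "\<not> thesis"
  then have "\<forall>x\<in>K. \<exists>z\<in>K. h z < h x" using that by (meson not_le)
  then obtain z where z: "\<And>x. x \<in> K \<Longrightarrow> z x \<in> K" "\<And>x. x \<in> K \<Longrightarrow> h (z x) < h x" by metis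
  have "\<exists>N. open N \<and> x \<in> N \<and> (\<forall>y\<in>N \<inter> K. h (z x) < h y)" if x: "x \<in> K" for x
  proof -
    have "\<forall>\<^sub>F y in at x within K. h (z x) < h y" using h x z(2)[OF x] unfolding lsc_on_def by blast
    then obtain N where "open N" "x \<in> N" "\<forall>y\<in>N. y \<noteq> x \<longrightarrow> y \<in> K \<longrightarrow> h (z x) < h y"
      unfolding eventually_at_topological by blast
    then show ?thesis using z(2)[OF x] by (intro exI[of _ N]) auto
  qed
  then obtain N where N: "\<And>x. x \<in> K \<Longrightarrow> open (N x)" "\<And>x. x \<in> K \<Longrightarrow> x \<in> N x"
    "\<And>x y. x \<in> K \<Longrightarrow> y \<in> N x \<Longrightarrow> y \<in> K \<Longrightarrow> h (z x) < h y"
    by (metis IntI)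
  obtain C where C: "C \<subseteq> K" "finite C" "K \<subseteq> (\<Union>x\<in>C. N x)"
    using compactE_image[OF K(1), of K N] N(1,2) by blast
  define m where "m = Min ((\<lambda>x. h (z x)) ` C)"
  have "C \<noteq> {}" using C K by auto
  then have "m \<in> (\<lambda>x. h (z x)) ` C" unfolding m_def using C(2) by (intro Min_in) auto
  then obtain x where x: "x \<in> C" "h (z x) = m" by blast
  have "z x \<in> K" using x(1) C(1) z(1) by blast
  then obtain y where "y \<in> C" "z x \<in> N y" using C(3) by blast
  then have "h (z y) < h (z x)" using N(3)[of y "z x"] C(1) \<open>z x \<in> K\<close> by blast
  moreover have "m \<le> h (z y)" unfolding m_def using C(2) \<open>y \<in> C\<close> by (intro Min_le) auto
  ultimately show False using x(2) by simp
qed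

lemma discount_bound:
  fixes \<Gamma> A \<theta> :: real
  assumes g: "\<And>r. r \<in> {a..t} \<Longrightarrow> \<bar>g r - g a\<bar> \<le> \<Lambda> * (r - a)" and gc: "continuous_on {a..t} g"
    and at: "a \<le> t" and ga: "0 \<le> g a" "g a \<le> \<Gamma>" and \<Lambda>: "0 \<le> \<Lambda>" "\<Lambda> * (t - a)\<^sup>2 \<le> 1"
  shows "\<bar>exp (- integral {a..t} g) * (1 + (t - a) * g a) - 1\<bar> \<le> (\<Gamma>\<^sup>2 + 2 * \<Lambda>) * (t - a)\<^sup>2"
proof -
  define \<theta> where "\<theta> = t - a"
  define E where "E = integral {a..t} g - \<theta> * g a"
  define m where "m = \<theta> * g a"
  have \<theta>: "0 \<le> \<theta>" using at by (simp add: \<theta>_def)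
  have m: "0 \<le> m" using \<theta> ga by (simp add: m_def)
  have gi: "g integrable_on {a..t}" by (rule integrable_continuous_real[OF gc])
  have "integral {a..t} (\<lambda>r. g r - g a) = E"
    using at integral_diff[OF gi integrable_const_ivl[of "g a" a t]]
    by (simp add: E_def \<theta>_def)
  moreover have "norm (integral {a..t} (\<lambda>r. g r - g a)) \<le> (\<Lambda> * \<theta>) * (t - a)"
  proof (rule integral_bound[OF at])
    show "continuous_on {a..t} (\<lambda>r. g r - g a)" by (intro continuous_intros gc)
    fix r assume r: "r \<in> {a..t}"
    have "\<Lambda> * (r - a) \<le> \<Lambda> * \<theta>" using r \<Lambda> by (intro mult_left_mono) (auto simp: \<theta>_def)
    then show "norm (g r - g a) \<le> \<Lambda> * \<theta>" using g[OF r] by simp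
  qed
  ultimately have E: "\<bar>E\<bar> \<le> \<Lambda> * \<theta>\<^sup>2" by (simp add: \<theta>_def power2_eq_square mult.assoc)
  have "m\<^sup>2 \<le> (\<theta> * \<Gamma>)\<^sup>2" unfolding m_def using ga \<theta> by (intro power_mono mult_left_mono) auto
  then have m2: "m\<^sup>2 \<le> \<Gamma>\<^sup>2 * \<theta>\<^sup>2" by (simp add: power_mult_distrib mult.commute)
  have e: "exp (- integral {a..t} g) = exp (- m) * exp (- E)" by (simp add: E_def m_def flip: exp_add)
  have up: "exp (- m) * (1 + m) \<le> 1"
    using mult_left_mono[OF exp_ge_add_one_self[of m], of "exp (- m)"] by (simp add: exp_minus)
  have "1 - m\<^sup>2 = (1 - m) * (1 + m)" by (simp add: power2_eq_square algebra_simps)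
  also have "\<dots> \<le> exp (- m) * (1 + m)" using m exp_ge_add_one_self[of "- m"] by (intro mult_right_mono) auto
  finally have lo: "1 - m\<^sup>2 \<le> exp (- m) * (1 + m)" .
  define y where "y = exp (- m) * (1 + m)"
  have y: "0 \<le> y" "y \<le> 1" "1 - m\<^sup>2 \<le> y" using up lo m by (auto simp: y_def)
  have "exp (- E) \<le> exp \<bar>E\<bar>" by simp
  also have "\<dots> \<le> 1 + 2 * \<bar>E\<bar>" 
  proof -
    have "\<bar>E\<bar> \<le> 1" using E \<Lambda>(2) by (simp add: \<theta>_def)
    then have "\<bar>E\<bar>\<^sup>2 \<le> \<bar>E\<bar>" unfolding power2_eq_square by (intro mult_left_le) auto
    then show ?thesis using exp_bound[of "\<bar>E\<bar>"] \<open>\<bar>E\<bar> \<le> 1\<close> by simp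
  qed
  finally have eu: "exp (- E) \<le> 1 + 2 * \<bar>E\<bar>" .
  have el: "1 - \<bar>E\<bar> \<le> exp (- E)" using exp_ge_add_one_self[of "- E"] by linarith
  have "y * exp (- E) \<le> 1 * (1 + 2 * \<bar>E\<bar>)" using y eu by (intro mult_mono) auto
  then have 1: "y * exp (- E) - 1 \<le> 2 * \<bar>E\<bar>" by simp
  have "y * (1 - \<bar>E\<bar>) \<le> y * exp (- E)" using y el by (intro mult_left_mono) auto
  moreover have "y * \<bar>E\<bar> \<le> \<bar>E\<bar>" using y by (simp add: mult_left_le_one_le)
  ultimately have 2: "1 - m\<^sup>2 - \<bar>E\<bar> \<le> y * exp (- E)" using y by (simp add: algebra_simps)
  have "\<bar>y * exp (- E) - 1\<bar> \<le> m\<^sup>2 + 2 * \<bar>E\<bar>" using 1 2 zero_le_power2[of m] by linarith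
  also have "\<dots> \<le> (\<Gamma>\<^sup>2 + 2 * \<Lambda>) * \<theta>\<^sup>2" using m2 E by (simp add: algebra_simps)
  finally show ?thesis by (simp add: e y_def m_def \<theta>_def mult_ac)
qed

section \<open>Aiming at minimizers of the penalized function\<close>

text \<open>A is the control set of the aiming player, D that of the opponent. The equation enters
  only through \<open>ham\<close>: at a point y where V has a quadratic minorant with slope s, the
  Hamiltonian inequality holds for s. The constant c lets the same data describe a supersolution
  and, with the players exchanged, a negated subsolution.\<close>

locale aiming =
  fixes A :: "'a set" and D :: "'b::topological_space set"
    and F :: "real ^ 'n \<Rightarrow> 'a \<Rightarrow> 'b \<Rightarrow> real ^ 'n" and g :: "real ^ 'n \<Rightarrow> real"
    and G :: "(real ^ 'n) set" and V :: "real ^ 'n \<Rightarrow> real" and R lam b c B :: real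
  assumes A: "A \<noteq> {}" and D: "D \<noteq> {}"
    and growth: "\<And>x a d. a \<in> A \<Longrightarrow> d \<in> D \<Longrightarrow> norm (F x a d) \<le> R * (1 + norm x)" and R: "0 \<le> R"
    and lipF: "\<And>x y a d. a \<in> A \<Longrightarrow> d \<in> D \<Longrightarrow> norm (F x a d - F y a d) \<le> lam * norm (x - y)"
    and lipg: "\<And>x y. \<bar>g x - g y\<bar> \<le> lam * norm (x - y)" and lam: "0 \<le> lam"
    and b: "0 < b" "\<And>x. b \<le> g x"
    and saddle: "\<And>s x. (INF a\<in>A. SUP d\<in>D. s \<bullet> F x a d) = (SUP d\<in>D. INF a\<in>A. s \<bullet> F x a d)"
    and G: "open G"
    and lsc: "lsc_on (closure G) V" and bnd: "\<And>x. x \<in> closure G \<Longrightarrow> \<bar>V x\<bar> \<le> B"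
    and ham: "\<And>y s C d. y \<in> G \<Longrightarrow>
        (\<And>z. z \<in> closure G \<Longrightarrow> V y + s \<bullet> (z - y) - C * (norm (z - y))\<^sup>2 \<le> V z) \<Longrightarrow> d \<in> D \<Longrightarrow>
        (INF a\<in>A. s \<bullet> F y a d) \<le> g y * (V y - c)"
begin

lemma abs_inner_F_le:
  assumes "a \<in> A" "d \<in> D"
  shows "\<bar>s \<bullet> F x a d\<bar> \<le> norm s * (R * (1 + norm x))"
  using Cauchy_Schwarz_ineq2[of s "F x a d"] growth[OF assms, of x] mult_left_mono[of _ _ "norm s"]
  by (meson norm_ge_zero order_trans)

lemma bdd_inner_F: 
  "d \<in> D \<Longrightarrow> bdd_below ((\<lambda>a. s \<bullet> F x a d) ` A)"
  "a \<in> A \<Longrightarrow> bdd_above ((\<lambda>d. s \<bullet> F x a d) ` D)"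
  using abs_inner_F_le[of _ _ s x]
  by (auto intro!: bdd_belowI2[of _ "- (norm s * (R * (1 + norm x)))"]
      bdd_aboveI2[of _ _ "norm s * (R * (1 + norm x))"] simp: abs_le_iff minus_le_iff)

lemma inner_F_shift:
  assumes "a \<in> A" "d \<in> D"
  shows "s \<bullet> F x a d \<le> s \<bullet> F y a d + norm s * (lam * norm (x - y))"
proof -
  have "s \<bullet> (F x a d - F y a d) \<le> norm s * norm (F x a d - F y a d)" by (rule norm_cauchy_schwarz)
  also have "\<dots> \<le> norm s * (lam * norm (x - y))" using lipF[OF assms] by (intro mult_left_mono) auto
  finally show ?thesis by (simp add: inner_diff_right)
qed

text \<open>The derivative inequality is given for each opponent control d separately and so bounds
  a max-min. A feedback must be chosen before d is known, which calls for the min-max; the saddle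
  condition bridges the two.\<close>

lemma minimax_shift:
  assumes m: "\<And>d. d \<in> D \<Longrightarrow> (INF a\<in>A. s \<bullet> F y a d) \<le> m"
  shows "(INF a\<in>A. SUP d\<in>D. s \<bullet> F x a d) \<le> m + norm s * (lam * norm (x - y))"
  unfolding saddle
proof (rule cSUP_least[OF D])
  fix d assume d: "d \<in> D"
  have "(INF a\<in>A. s \<bullet> F x a d) - norm s * (lam * norm (x - y)) \<le> (INF a\<in>A. s \<bullet> F y a d)"
  proof (rule cINF_greatest[OF A])
    fix a assume a: "a \<in> A"
    have "(INF a\<in>A. s \<bullet> F x a d) \<le> s \<bullet> F x a d" using bdd_inner_F(1)[OF d] a by (rule cINF_lower)
    then show "(INF a\<in>A. s \<bullet> F x a d) - norm s * (lam * norm (x - y)) \<le> s \<bullet> F y a d"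
      using inner_F_shift[OF a d, of s x y] by simp
  qed
  then show "(INF a\<in>A. s \<bullet> F x a d) \<le> m + norm s * (lam * norm (x - y))" using m[OF d] by simp
qed

text \<open>The set A carries no topology here, so the control is optimal only up to e.\<close>

lemma near_optimal_control:
  assumes "0 < e"
  obtains u where "u \<in> A" "\<And>d. d \<in> D \<Longrightarrow> s \<bullet> F x u d \<le> (INF a\<in>A. SUP d\<in>D. s \<bullet> F x a d) + e"
proof -
  let ?S = "\<lambda>a. SUP d\<in>D. s \<bullet> F x a d"
  have "\<exists>v\<in>?S ` A. v < (INF a\<in>A. ?S a) + e"
    using A assms by (intro cInf_lessD) auto
  then obtain u where u: "u \<in> A" "?S u < (INF a\<in>A. ?S a) + e" by auto
  have "s \<bullet> F x u d \<le> (INF a\<in>A. ?S a) + e" if "d \<in> D" for d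
    using cSUP_upper[OF that bdd_inner_F(2)[OF u(1)], of s x] u(2) by linarith
  then show thesis using that u(1) by blast
qed

text \<open>On the possibly unbounded closure of G, the bound B on V and the growth of the penalty
  make every z farther than \<rho> from x worse than x itself. Minimizing over a compact ball is
  thus enough.\<close>

lemma penalized_minimizer:
  assumes par: "0 < \<nu>" "\<nu> \<le> 1" "0 < \<kappa>" "0 < \<eta>" and x: "x \<in> closure G" and \<rho>: "0 \<le> \<rho>"
    and far: "\<And>r::real ^ 'n. \<rho> < norm r \<Longrightarrow> 2 * B + pen \<nu> \<kappa> \<eta> (0::real ^ 'n) < pen \<nu> \<kappa> \<eta> r"
  obtains y where "y \<in> closure G" "norm (x - y) \<le> \<rho>"
    "\<And>z. z \<in> closure G \<Longrightarrow> V y + pen \<nu> \<kappa> \<eta> (x - y) \<le> V z + pen \<nu> \<kappa> \<eta> (x - z)"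
proof -
  define K where "K = closure G \<inter> cball x \<rho>"
  have K: "compact K" "x \<in> K" using x \<rho> by (auto simp: K_def closed_Int_compact)
  have "K \<noteq> {}" using K(2) by blast
  have lscK: "lsc_on K (\<lambda>z. V z + pen \<nu> \<kappa> \<eta> (x - z))"
  proof (rule lsc_on_add_continuous)
    show "lsc_on K V" using lsc by (rule lsc_on_subset) (simp add: K_def)
    show "continuous_on K (\<lambda>z. pen \<nu> \<kappa> \<eta> (x - z))"
      by (rule continuous_on_compose2[OF continuous_on_pen[OF par, of UNIV]]) (auto intro!: continuous_intros)
  qed
  obtain y where y: "y \<in> K" "\<And>z. z \<in> K \<Longrightarrow> V y + pen \<nu> \<kappa> \<eta> (x - y) \<le> V z + pen \<nu> \<kappa> \<eta> (x - z)"
    using lsc_on_attains_min[OF K(1) \<open>K \<noteq> {}\<close> lscK] by blast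
  have "V y + pen \<nu> \<kappa> \<eta> (x - y) \<le> V z + pen \<nu> \<kappa> \<eta> (x - z)" if z: "z \<in> closure G" for z
  proof (cases "z \<in> K")
    case False
    then have "\<rho> < norm (x - z)" using z by (auto simp: K_def dist_norm)
    then have "2 * B + pen \<nu> \<kappa> \<eta> (0::real ^ 'n) < pen \<nu> \<kappa> \<eta> (x - z)" by (rule far)
    moreover have "V y + pen \<nu> \<kappa> \<eta> (x - y) \<le> V x + pen \<nu> \<kappa> \<eta> (0::real ^ 'n)" using y(2)[OF K(2)] by simp
    ultimately show ?thesis using bnd[OF x] bnd[OF z] by (simp add: abs_le_iff)
  qed (rule y)
  then show thesis using that[of y] y(1) by (auto simp: K_def dist_norm)
qed

text \<open>The penalized minimum is compared along the motion with its value for the frozen minimizer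
  \<open>y\<close>, so the derivative inequality for \<open>V\<close> is needed only at the single point \<open>y\<close>, in its
  proximal form, and no trajectory along which \<open>V\<close> decreases has to be constructed.\<close>

lemma penalized_step:
  fixes y :: "real ^ 'n"
  defines "s \<equiv> \<lambda>\<nu> \<kappa> \<eta> z. (2 * pen_slope \<nu> \<kappa> \<eta> (z - y)) *\<^sub>R (z - y)"
  assumes par: "0 < \<nu>" "\<nu> \<le> 1" "0 < \<kappa>" "0 < \<eta>" and small: "2 * lam * \<nu> \<le> b"
    and sol: "ae_solution_on a a' x (\<lambda>t. F (x t) u (d t))" and d: "\<And>r. r \<in> {a..t} \<Longrightarrow> d r \<in> D"
    and at: "a \<le> t" "t \<le> a'" and X: "\<And>r. r \<in> {a..t} \<Longrightarrow> 1 + norm (x r) \<le> X"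
    and u: "u \<in> A" "\<And>d. d \<in> D \<Longrightarrow> s \<nu> \<kappa> \<eta> (x a) \<bullet> F (x a) u d
        \<le> (INF a'\<in>A. SUP d\<in>D. s \<nu> \<kappa> \<eta> (x a) \<bullet> F (x a) a' d) + e"
    and y: "y \<in> G" "norm (x a - y) \<le> \<rho>"
      "\<And>z. z \<in> closure G \<Longrightarrow> V y + pen \<nu> \<kappa> \<eta> (x a - y) \<le> V z + pen \<nu> \<kappa> \<eta> (x a - z)"
    and B1: "\<bar>V y + pen \<nu> \<kappa> \<eta> (x a - y) - c\<bar> \<le> B1"
    and C: "C = pen_slope \<nu> \<kappa> \<eta> (0::real ^ 'n)"
  shows "V y + pen \<nu> \<kappa> \<eta> (x t - y) - c \<le> (V y + pen \<nu> \<kappa> \<eta> (x a - y) - c) * (1 + (t - a) * g (x a))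
      + (t - a) * (lam * \<rho> * B1 + e + (2 * C * \<rho> * lam * (R * X) + C * (R * X)\<^sup>2) * (t - a))"
proof -
  define M where "M = R * X"
  define \<theta> where "\<theta> = t - a"
  define k where "k = pen_slope \<nu> \<kappa> \<eta> (x a - y)"
  define S where "S = s \<nu> \<kappa> \<eta> (x a)"
  define w where "w = V y + pen \<nu> \<kappa> \<eta> (x a - y) - c"
  have S: "S = (2 * k) *\<^sub>R (x a - y)" by (simp add: S_def s_def k_def)
  have k: "0 \<le> k" "k \<le> C" unfolding k_def C by (rule pen_slope_nonneg[OF par], rule pen_slope_le[OF par])
  have \<theta>: "0 \<le> \<theta>" using at by (simp add: \<theta>_def)
  have \<rho>: "0 \<le> \<rho>" using y(2) norm_ge_zero order_trans by blast
  have FM: "norm (F (x r) u (d r)) \<le> M" if "r \<in> {a..t}" for r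
    using growth[OF u(1) d[OF that], of "x r"] mult_left_mono[OF X[OF that] R] by (simp add: M_def)
  have M: "0 \<le> M" using FM[of a] at norm_ge_zero[of "F (x a) u (d a)"] by (meson atLeastAtMost_iff order_refl order_trans)
  have xM: "norm (x r - x a) \<le> M * \<theta>" if r: "r \<in> {a..t}" for r
  proof -
    have "norm (x r - x a) \<le> M * (r - a)"
      by (rule ae_solution_norm_le[OF sol]) (use r at FM in auto)
    also have "\<dots> \<le> M * \<theta>" using r M by (intro mult_left_mono) (auto simp: \<theta>_def)
    finally show ?thesis .
  qed
  \<comment> \<open>Minimality of y against z, with the penalty at \<open>x a - z\<close> replaced
    by its expansion around \<open>x a - y\<close>: the quadratic minorant required by
    \<open>ham\<close>.\<close>
  have sub: "V y + S \<bullet> (z - y) - k * (norm (z - y))\<^sup>2 \<le> V z" if z: "z \<in> closure G" for z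
  proof -
    have "pen \<nu> \<kappa> \<eta> (x a - z) = pen \<nu> \<kappa> \<eta> ((x a - y) + (y - z))" by simp
    also have "\<dots> \<le> pen \<nu> \<kappa> \<eta> (x a - y) + k * (2 * ((x a - y) \<bullet> (y - z)) + (norm (y - z))\<^sup>2)"
      unfolding k_def by (rule pen_add_le[OF par])
    also have "\<dots> = pen \<nu> \<kappa> \<eta> (x a - y) - S \<bullet> (z - y) + k * (norm (z - y))\<^sup>2"
      by (simp add: S inner_diff_right inner_diff_left norm_minus_commute algebra_simps)
    finally show ?thesis using y(3)[OF z] by linarith
  qed
  have Hy: "(INF a\<in>A. S \<bullet> F y a d) \<le> g y * (V y - c)" if "d \<in> D" for d
    using ham[OF y(1) sub that] .
  \<comment> \<open>Moving the Hamiltonian inequality from y to \<open>x a\<close> costs at most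
    \<open>g y * pen \<nu> \<kappa> \<eta> (x a - y)\<close>. This is just the amount by which
    \<open>g y * w\<close> exceeds \<open>g y * (V y - c)\<close>.\<close>
  have "norm S * (lam * norm (x a - y)) = 2 * lam * (k * (norm (x a - y))\<^sup>2)"
    using k by (simp add: S power2_eq_square)
  also have "\<dots> \<le> 2 * lam * (\<nu> * pen \<nu> \<kappa> \<eta> (x a - y))"
    unfolding k_def using lam by (intro mult_left_mono pen_slope_norm_le[OF par]) auto
  also have "\<dots> \<le> b * pen \<nu> \<kappa> \<eta> (x a - y)"
    using mult_right_mono[OF small pen_nonneg[OF par, of "x a - y"]] by (simp add: mult.assoc)
  also have "\<dots> \<le> g y * pen \<nu> \<kappa> \<eta> (x a - y)" using b pen_nonneg[OF par] by (intro mult_right_mono) auto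
  finally have "(INF a'\<in>A. SUP d\<in>D. S \<bullet> F (x a) a' d) \<le> g y * w"
    using minimax_shift[OF Hy, of "x a"] by (simp add: w_def algebra_simps)
  also have "\<dots> = g (x a) * w + (g y - g (x a)) * w" by (simp add: algebra_simps)
  also have "(g y - g (x a)) * w \<le> lam * \<rho> * B1"
  proof -
    have "\<bar>g y - g (x a)\<bar> \<le> lam * \<rho>"
      using lipg[of y "x a"] mult_left_mono[OF y(2) lam] by (simp add: norm_minus_commute)
    then have "\<bar>g y - g (x a)\<bar> * \<bar>w\<bar> \<le> lam * \<rho> * B1"
      using B1 lam \<rho> by (intro mult_mono) (auto simp: w_def)
    then show ?thesis by (metis abs_ge_self abs_mult order_trans)
  qed
  finally have Hx: "(INF a'\<in>A. SUP d\<in>D. S \<bullet> F (x a) a' d) \<le> g (x a) * w + lam * \<rho> * B1" by simp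
  \<comment> \<open>The last term allows for the displacement inside the cell, at most
    \<open>M * \<theta>\<close>, seen through \<open>norm S \<le> 2 * C * \<rho>\<close>.\<close>
  define q where "q = g (x a) * w + lam * \<rho> * B1 + e + 2 * C * \<rho> * lam * M * \<theta>"
  have "S \<bullet> (x t - x a) \<le> q * (t - a)"
  proof (rule ae_solution_inner_le[OF sol])
    fix r assume r: "r \<in> {a..t}"
    have "norm S * (lam * norm (x r - x a)) \<le> (2 * C * \<rho>) * (lam * (M * \<theta>))"
    proof (rule mult_mono)
      show "norm S \<le> 2 * C * \<rho>" using k y(2) \<rho> by (simp add: S mult_mono)
      show "lam * norm (x r - x a) \<le> lam * (M * \<theta>)" using xM[OF r] lam by (intro mult_left_mono)
    qed (use k \<rho> lam in auto)
    moreover have "S \<bullet> F (x r) u (d r) \<le> S \<bullet> F (x a) u (d r) + norm S * (lam * norm (x r - x a))"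
      by (rule inner_F_shift[OF u(1) d[OF r]])
    moreover have "S \<bullet> F (x a) u (d r) \<le> (INF a'\<in>A. SUP d\<in>D. S \<bullet> F (x a) a' d) + e"
      unfolding S_def by (rule u(2)[OF d[OF r]])
    ultimately show "S \<bullet> F (x r) u (d r) \<le> q" using Hx by (simp add: q_def algebra_simps)
  qed (use at in auto)
  moreover have "pen \<nu> \<kappa> \<eta> (x t - y) \<le> pen \<nu> \<kappa> \<eta> (x a - y) + S \<bullet> (x t - x a) + C * (M * \<theta>)\<^sup>2"
  proof -
    have "pen \<nu> \<kappa> \<eta> (x t - y) = pen \<nu> \<kappa> \<eta> ((x a - y) + (x t - x a))" by simp
    also have "\<dots> \<le> pen \<nu> \<kappa> \<eta> (x a - y) + k * (2 * ((x a - y) \<bullet> (x t - x a)) + (norm (x t - x a))\<^sup>2)"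
      unfolding k_def by (rule pen_add_le[OF par])
    also have "\<dots> = pen \<nu> \<kappa> \<eta> (x a - y) + S \<bullet> (x t - x a) + k * (norm (x t - x a))\<^sup>2"
      by (simp add: S algebra_simps)
    also have "k * (norm (x t - x a))\<^sup>2 \<le> C * (M * \<theta>)\<^sup>2"
      using k xM[of t] at by (intro mult_mono power_mono) auto
    finally show ?thesis by simp
  qed
  ultimately have "V y + pen \<nu> \<kappa> \<eta> (x t - y) - c \<le> w + q * \<theta> + C * (M * \<theta>)\<^sup>2"
    by (simp add: w_def \<theta>_def)
  also have "\<dots> = w * (1 + \<theta> * g (x a)) + \<theta> * (lam * \<rho> * B1 + e + (2 * C * \<rho> * lam * M + C * M\<^sup>2) * \<theta>)"
    by (simp add: q_def power2_eq_square algebra_simps)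
  finally show ?thesis by (simp add: w_def M_def \<theta>_def)
qed


text \<open>As long as the motion is farther than \<rho>0 from the frontier, its minimizer, at
  distance at most \<open>\<rho> \<le> \<rho>0\<close>, lies in G and the one-step estimate applies.
  Since w is evaluated at minimizers, the outcome speaks of a point y near \<open>x \<tau>\<close>
  and not of \<open>x \<tau>\<close> itself.\<close>

theorem aiming_strategy:
  assumes \<rho>0: "0 < \<rho>0" and \<zeta>: "0 < \<zeta>" and T: "0 \<le> T" and x0: "x0 \<in> closure G"
  obtains U \<mu> where "U \<in> UNIV \<rightarrow> A" "0 < \<mu>"
    "\<And>\<Delta> x \<tau>. is_partition \<Delta> \<Longrightarrow> (\<And>i. \<Delta> (Suc i) - \<Delta> i < \<mu>) \<Longrightarrow> x \<in> motions1 D F x0 U \<Delta> \<Longrightarrow>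
      0 \<le> \<tau> \<Longrightarrow> \<tau> \<le> T \<Longrightarrow>
      (\<And>t. 0 \<le> t \<Longrightarrow> t < \<tau> \<Longrightarrow> x t \<in> G \<and> (\<forall>z\<in>frontier G. \<rho>0 < dist (x t) z)) \<Longrightarrow>
      x \<tau> \<in> closure G \<Longrightarrow>
      norm (x \<tau>) \<le> (1 + norm x0) * exp (2 * R * T) \<and>
      (\<exists>y\<in>closure G. dist (x \<tau>) y \<le> \<rho>0 \<and>
        (V y - c) * exp (- integral {0..\<tau>} (\<lambda>t. g (x t))) \<le> V x0 - c + \<zeta>)"
proof -
  have B: "0 \<le> B" using bnd[OF x0] by simp
  define X where "X = (1 + norm x0) * exp (2 * R * T)"
  define M where "M = R * X"
  define \<Gamma> where "\<Gamma> = g 0 + lam * X"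
  define B1 where "B1 = B + 1 + \<bar>c\<bar>"
  \<comment> \<open>Along the motion at most \<open>4 * e * T \<le> \<zeta> / 2\<close> is lost; the
    other half of \<zeta> pays for the penalty at the origin.\<close>
  define e where "e = \<zeta> / (8 * (T + 1))"
  define \<rho> where "\<rho> = min \<rho>0 (e / (lam * B1 + 1))"
  have X: "0 \<le> X" by (simp add: X_def)
  have M: "0 \<le> M" using X R by (simp add: M_def)
  have B1: "0 \<le> B1" using B by (simp add: B1_def)
  have e: "0 < e" using \<zeta> T by (simp add: e_def)
  have \<rho>: "0 < \<rho>" "\<rho> \<le> \<rho>0" using \<rho>0 e lam B1 by (auto simp: \<rho>_def intro!: divide_pos_pos add_nonneg_pos)
  have "(lam * B1) * \<rho> \<le> (lam * B1 + 1) * (e / (lam * B1 + 1))"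
    using lam B1 e \<rho> by (intro mult_mono) (auto simp: \<rho>_def)
  also have "\<dots> = e" using mult_nonneg_nonneg[OF lam B1] by simp
  finally have e1: "lam * \<rho> * B1 \<le> e" by (simp add: mult_ac)
  obtain \<nu> \<kappa> \<eta> where par: "0 < \<nu>" "\<nu> \<le> 1" "0 < \<kappa>" "0 < \<eta>" and small: "2 * lam * \<nu> \<le> b"
    and p0: "pen \<nu> \<kappa> \<eta> (0::real ^ 'n) \<le> \<zeta> / 2" "pen \<nu> \<kappa> \<eta> (0::real ^ 'n) \<le> 1"
    and far: "\<And>r::real ^ 'n. \<rho> < norm r \<Longrightarrow> 2 * B + pen \<nu> \<kappa> \<eta> (0::real ^ 'n) < pen \<nu> \<kappa> \<eta> r"
    using pen_parameters[OF \<rho>(1) B half_gt_zero[OF \<zeta>] lam b(1), where 'a = "real ^ 'n"] by blast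
  let ?p = "pen \<nu> \<kappa> \<eta> :: real ^ 'n \<Rightarrow> real"
  define C where "C = pen_slope \<nu> \<kappa> \<eta> (0::real ^ 'n)"
  have C: "0 \<le> C" unfolding C_def by (rule pen_slope_nonneg[OF par])
  have "\<exists>y. x \<in> closure G \<longrightarrow> y \<in> closure G \<and> norm (x - y) \<le> \<rho> \<and>
      (\<forall>z\<in>closure G. V y + ?p (x - y) \<le> V z + ?p (x - z))" for x
    using penalized_minimizer[OF par _ less_imp_le[OF \<rho>(1)] far] by metis
  then obtain Y where Y: "\<And>x. x \<in> closure G \<Longrightarrow> Y x \<in> closure G" "\<And>x. x \<in> closure G \<Longrightarrow> norm (x - Y x) \<le> \<rho>"
    "\<And>x z. x \<in> closure G \<Longrightarrow> z \<in> closure G \<Longrightarrow> V (Y x) + ?p (x - Y x) \<le> V z + ?p (x - z)"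
    by metis
  define s where "s x = (2 * pen_slope \<nu> \<kappa> \<eta> (x - Y x)) *\<^sub>R (x - Y x)" for x
  have "\<exists>u. u \<in> A \<and> (\<forall>d\<in>D. s x \<bullet> F x u d \<le> (INF a\<in>A. SUP d\<in>D. s x \<bullet> F x a d) + e)" for x
    using near_optimal_control[OF e, of "s x" x] by metis
  then obtain U where U: "\<And>x. U x \<in> A"
    "\<And>x d. d \<in> D \<Longrightarrow> s x \<bullet> F x (U x) d \<le> (INF a\<in>A. SUP d\<in>D. s x \<bullet> F x a d) + e"
    by metis
  \<comment> \<open>\<open>Q\<close> and \<open>Q'\<close> are the coefficients of the second-order
    errors of the one-step estimate and of the discount. Both are known only after the penalty is
    fixed, so the mesh \<open>1 / W\<close> absorbs them, along with the conditions of
    \<open>motion_growth\<close> and \<open>discount_bound\<close>.\<close>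
  define Q where "Q = 2 * C * \<rho> * lam * M + C * M\<^sup>2"
  define Q' where "Q' = B1 * (\<Gamma>\<^sup>2 + 2 * (lam * M))"
  define W where "W = 1 + 2 * R + lam * M + Q / e + Q' / e"
  have Q: "0 \<le> Q" "0 \<le> Q'" "0 \<le> lam * M" using C \<rho> lam M B1 by (auto simp: Q_def Q'_def)
  have "0 \<le> Q / e" "0 \<le> Q' / e" using Q e by simp_all
  then have "1 \<le> W" "2 * R \<le> W" "lam * M \<le> W" "Q / e \<le> W" "Q' / e \<le> W"
    using Q R unfolding W_def by linarith+
  then have W: "1 \<le> W" "2 * R \<le> W" "lam * M \<le> W" "Q \<le> e * W" "Q' \<le> e * W"
    using e by (simp_all add: pos_divide_le_eq mult.commute)
  define \<mu> where "\<mu> = 1 / W"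
  have \<mu>: "0 < \<mu>" using W by (simp add: \<mu>_def)
  have \<mu>W: "m * \<theta> \<le> k" if "m \<le> k * W" "0 \<le> k" "0 \<le> \<theta>" "\<theta> \<le> \<mu>" for m k \<theta>
  proof -
    have "m * \<theta> \<le> (k * W) * \<theta>" using that by (intro mult_right_mono) auto
    also have "\<dots> \<le> (k * W) * \<mu>" using that W by (intro mult_left_mono) auto
    also have "\<dots> = k" using W by (simp add: \<mu>_def)
    finally show ?thesis .
  qed
  show thesis
  proof (rule that[of U \<mu>])
    show "U \<in> UNIV \<rightarrow> A" using U by auto
    show "0 < \<mu>" by (rule \<mu>)
    fix \<Delta> x \<tau>
    assume part: "is_partition \<Delta>" and fine: "\<And>i. \<Delta> (Suc i) - \<Delta> i < \<mu>" and x: "x \<in> motions1 D F x0 U \<Delta>"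
      and \<tau>: "0 \<le> \<tau>" "\<tau> \<le> T"
      and inside: "\<And>t. 0 \<le> t \<Longrightarrow> t < \<tau> \<Longrightarrow> x t \<in> G \<and> (\<forall>z\<in>frontier G. \<rho>0 < dist (x t) z)"
      and end_in: "x \<tau> \<in> closure G"
    have cl: "x t \<in> closure G" if "0 \<le> t" "t \<le> \<tau>" for t
      using inside[of t] that end_in closure_subset[of G] by (cases "t = \<tau>") auto
    have gap: "0 \<le> \<Delta> (Suc i) - \<Delta> i" for i using part by (simp add: is_partition_def less_imp_le)
    have growth_x: "1 + norm (x t) \<le> X" if t: "0 \<le> t" "t \<le> T" for t
    proof -
      have "1 + norm (x t) \<le> (1 + norm x0) * exp (2 * R * t)"
      proof (rule motion_growth[OF growth R _ part _ x t(1)])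
        show "U \<in> UNIV \<rightarrow> A" using U by auto
        show "2 * R * (\<Delta> (Suc i) - \<Delta> i) \<le> 1" for i
          using \<mu>W[of "2 * R" 1 "\<Delta> (Suc i) - \<Delta> i"] fine[of i] gap[of i] W by simp
      qed
      also have "\<dots> \<le> X" unfolding X_def using t R by (intro mult_left_mono) (auto intro!: mult_left_mono)
      finally show ?thesis .
    qed
    have xc: "continuous_on {0..} x" and xx0: "x 0 = x0" using x by (auto simp: motions1_def)
    have gc: "continuous_on S g" for S
      using lipg lam by (intro lipschitz_on_continuous_on[of lam] lipschitz_onI) (auto simp: dist_norm)
    have gxc: "continuous_on {0..} (\<lambda>t. g (x t))" by (rule continuous_on_compose2[OF gc xc]) auto
    define w where "w t = V (Y (x t)) + ?p (x t - Y (x t))" for t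
    define k where "k t = exp (- integral {0..t} (\<lambda>t. g (x t)))" for t
    have kb: "0 < k t" "k t \<le> 1" if "0 \<le> t" for t
    proof -
      have "0 \<le> integral {0..t} (\<lambda>t. g (x t))"
        using b by (intro integral_nonneg integrable_continuous_real continuous_on_subset[OF gxc])
          (auto intro: order_trans[OF less_imp_le])
      then show "0 < k t" "k t \<le> 1" by (auto simp: k_def)
    qed
    have wb: "\<bar>w t - c\<bar> \<le> B1" if t: "0 \<le> t" "t \<le> \<tau>" for t
    proof -
      have "w t \<le> V (x t) + ?p 0" using Y(3)[OF cl[OF t] cl[OF t]] by (simp add: w_def)
      then have "w t \<le> B + 1" using bnd[OF cl[OF t]] p0 by (simp add: abs_le_iff)
      moreover have "- B \<le> w t"
        using bnd[OF Y(1)[OF cl[OF t]]] pen_nonneg[OF par, of "x t - Y (x t)"] by (simp add: w_def abs_le_iff)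
      ultimately show ?thesis unfolding B1_def by linarith
    qed
    \<comment> \<open>The rate \<open>4 * e\<close> consists of four errors of size e: replacing
      \<open>g y\<close> by \<open>g (x a)\<close>, the suboptimal control, the second-order
      remainder, and the mismatch between discount and Euler factor.\<close>
    have main: "t \<le> \<tau> \<longrightarrow> (w t - c) * k t \<le> w 0 - c + 4 * e * t" if "0 \<le> t" for t
      using part that
    proof (induction rule: partition_induct)
      case start
      then show ?case by (simp add: k_def)
    next
      case (cell i t)
      define a where "a = \<Delta> i"
      define \<theta> where "\<theta> = t - a"
      have a0: "0 \<le> a" using partition_nonneg[OF part] by (simp add: a_def)
      have \<theta>: "0 \<le> \<theta>" "\<theta> \<le> \<mu>" using cell(2,3) fine[of i] by (auto simp: \<theta>_def a_def)
      show ?case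
      \<comment> \<open>With \<open>a < t \<le> \<tau>\<close> the node a is strictly before \<tau>,
        where the motion is known to be inside G and away from the frontier.\<close>
      proof (cases "t \<le> \<tau> \<and> a \<noteq> t")
        case False
        then show ?thesis using cell(1) by (auto simp: a_def)
      next
        case True
        then have at: "a < t" "t \<le> \<tau>" "0 \<le> t" "t \<le> T" "a \<le> \<tau>" using cell(2) a0 \<tau> by (auto simp: a_def)
        define y where "y = Y (x a)"
        define wa where "wa = V y + ?p (x a - y) - c"
        have wa: "wa = w a - c" "\<bar>wa\<bar> \<le> B1" using wb[OF a0 at(5)] by (auto simp: wa_def w_def y_def)
        have ina: "x a \<in> G" "\<forall>z\<in>frontier G. \<rho>0 < dist (x a) z" using inside[of a] a0 at by auto
        then have cla: "x a \<in> closure G" using closure_subset by blast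
        have "y \<notin> frontier G" using ina(2) Y(2)[OF cla] \<rho> by (force simp: y_def dist_norm)
        then have yG: "y \<in> G" using Y(1)[OF cla] G by (simp add: y_def frontier_def interior_open)
        obtain d where d: "d \<in> measurable_controls (\<Delta> i) (\<Delta> (Suc i)) D"
          and sol: "ae_solution_on a (\<Delta> (Suc i)) x (\<lambda>t. F (x t) (U (x a)) (d t))"
          using x unfolding a_def by (auto simp: motions1_def)
        have step: "V y + ?p (x t - y) - c \<le> wa * (1 + \<theta> * g (x a)) + \<theta> * (lam * \<rho> * B1 + e + Q * \<theta>)"
          unfolding wa_def \<theta>_def Q_def M_def
        proof (rule penalized_step[OF par small sol])
          show "d r \<in> D" if "r \<in> {a..t}" for r
            using d that cell(3) by (auto simp: measurable_controls_def a_def)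
          show "1 + norm (x r) \<le> X" if "r \<in> {a..t}" for r using growth_x that a0 at by auto
          show "\<bar>V y + ?p (x a - y) - c\<bar> \<le> B1" using wa(2) by (simp add: wa_def)
        qed (use at U U(2)[of _ "x a"] cell(3) yG Y(2,3)[OF cla] C_def in \<open>auto simp: y_def s_def\<close>)
        have br: "lam * \<rho> * B1 + e + Q * \<theta> \<le> 3 * e" using e1 \<mu>W[OF W(4) less_imp_le[OF e] \<theta>] by simp
        define j where "j = exp (- integral {a..t} (\<lambda>t. g (x t)))"
        have gi: "(\<lambda>t. g (x t)) integrable_on {0..t}"
          by (intro integrable_continuous_real continuous_on_subset[OF gxc]) auto
        have kj: "k t = k a * j"
          using Henstock_Kurzweil_Integration.integral_combine[OF a0 less_imp_le[OF at(1)] gi] by (auto simp: k_def j_def simp flip: exp_add)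
        have j: "0 < j" "j \<le> 1"
        proof -
          have "0 \<le> integral {a..t} (\<lambda>t. g (x t))"
            using b a0 by (intro integral_nonneg integrable_continuous_real continuous_on_subset[OF gxc])
              (auto intro: order_trans[OF less_imp_le])
          then show "0 < j" "j \<le> 1" by (auto simp: j_def)
        qed
        have "\<bar>j * (1 + (t - a) * g (x a)) - 1\<bar> \<le> (\<Gamma>\<^sup>2 + 2 * (lam * M)) * (t - a)\<^sup>2"
          unfolding j_def
        proof (rule discount_bound[where g = "\<lambda>t. g (x t)"])
          fix r assume r: "r \<in> {a..t}"
          have "\<bar>g (x r) - g (x a)\<bar> \<le> lam * norm (x r - x a)" by (rule lipg)
          also have "norm (x r - x a) \<le> M * (r - a)"
          proof (rule ae_solution_norm_le[OF sol])
            fix q assume q: "q \<in> {a..r}"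
            have "d q \<in> D" using d q r cell(3) by (auto simp: measurable_controls_def a_def)
            then have "norm (F (x q) (U (x a)) (d q)) \<le> R * (1 + norm (x q))" using U by (intro growth)
            also have "\<dots> \<le> M" unfolding M_def using q r a0 at R by (intro mult_left_mono growth_x) auto
            finally show "norm (F (x q) (U (x a)) (d q)) \<le> M" .
          qed (use r cell(3) in auto)
          finally show "\<bar>g (x r) - g (x a)\<bar> \<le> lam * M * (r - a)" using lam by (simp add: mult_left_mono mult.assoc)
        next
          show "continuous_on {a..t} (\<lambda>t. g (x t))" by (rule continuous_on_subset[OF gxc]) (use a0 in auto)
          show "0 \<le> g (x a)" using b less_imp_le order_trans by blast
          have "g (x a) \<le> g 0 + lam * norm (x a - 0)" using lipg[of "x a" 0] by (simp add: abs_le_iff)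
          also have "\<dots> \<le> \<Gamma>" unfolding \<Gamma>_def using growth_x[of a] a0 at lam by (auto intro!: mult_left_mono)
          finally show "g (x a) \<le> \<Gamma>" .
          have "\<theta> \<le> 1" using \<mu>W[of 1 1 \<theta>] W \<theta> by simp
          then have "\<theta> * \<theta> \<le> \<theta>" using \<theta> by (simp add: mult_left_le)
          then have "lam * M * (\<theta> * \<theta>) \<le> lam * M * \<theta>" using Q by (intro mult_left_mono)
          also have "\<dots> \<le> 1" using \<mu>W[of "lam * M" 1 \<theta>] W \<theta> by simp
          finally show "lam * M * (t - a)\<^sup>2 \<le> 1" by (simp add: \<theta>_def power2_eq_square)
        qed (use at Q in auto)
        then have "\<bar>wa\<bar> * \<bar>j * (1 + \<theta> * g (x a)) - 1\<bar> \<le> B1 * ((\<Gamma>\<^sup>2 + 2 * (lam * M)) * \<theta>\<^sup>2)"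
          using wa(2) B1 by (intro mult_mono) (auto simp: \<theta>_def)
        also have "\<dots> = (Q' * \<theta>) * \<theta>" by (simp add: Q'_def power2_eq_square)
        also have "\<dots> \<le> e * \<theta>" using \<mu>W[OF W(5) less_imp_le[OF e] \<theta>] \<theta> by (intro mult_right_mono)
        finally have "wa * (j * (1 + \<theta> * g (x a)) - 1) \<le> e * \<theta>"
          unfolding abs_mult[symmetric] by (rule order_trans[OF abs_ge_self])
        then have disc: "wa * (j * (1 + \<theta> * g (x a))) \<le> wa + e * \<theta>" by (simp add: right_diff_distrib)
        \<comment> \<open>The minimizer of the node remains an admissible competitor at time
          t.\<close>
        have "w t \<le> V y + ?p (x t - y)" unfolding w_def
          using Y(3)[OF cl[OF at(3,2)]] Y(1)[OF cla] by (simp add: y_def)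
        then have "w t - c \<le> wa * (1 + \<theta> * g (x a)) + \<theta> * (3 * e)"
          using step mult_left_mono[OF br \<theta>(1)] by linarith
        then have "(w t - c) * j \<le> (wa * (1 + \<theta> * g (x a)) + \<theta> * (3 * e)) * j"
          using j by (intro mult_right_mono) auto
        also have "\<dots> = wa * (j * (1 + \<theta> * g (x a))) + (\<theta> * (3 * e)) * j" by (simp add: algebra_simps)
        also have "\<dots> \<le> wa + e * \<theta> + \<theta> * (3 * e)"
          using disc j \<theta> e by (intro add_mono mult_left_le) auto
        finally have "(w t - c) * j \<le> wa + 4 * e * \<theta>" by (simp add: algebra_simps)
        then have "k a * ((w t - c) * j) \<le> k a * (wa + 4 * e * \<theta>)"
          using kb[OF a0] by (intro mult_left_mono) auto
        also have "\<dots> = (w a - c) * k a + k a * (4 * e * \<theta>)" by (simp add: wa algebra_simps)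
        also have "\<dots> \<le> (w 0 - c + 4 * e * a) + 4 * e * \<theta>"
          using cell(1) at(5) kb[OF a0] \<theta> e by (intro add_mono mult_left_le_one_le) (auto simp: a_def)
        finally show ?thesis by (simp add: kj \<theta>_def algebra_simps)
      qed
    qed
    have "w 0 \<le> V x0 + ?p 0" using Y(3)[OF x0 x0] by (simp add: w_def xx0)
    moreover have "4 * e * \<tau> \<le> \<zeta> / 2"
    proof -
      have "4 * e * \<tau> \<le> 4 * e * (T + 1)" using \<tau> e by (intro mult_left_mono) auto
      also have "\<dots> = \<zeta> / 2"
      proof -
        have "e * (8 * (T + 1)) = \<zeta>" using T by (simp add: e_def)
        then show ?thesis by (simp add: algebra_simps)
      qed
      finally show ?thesis .
    qed
    ultimately have "(w \<tau> - c) * k \<tau> \<le> V x0 - c + \<zeta>" using main[OF \<tau>(1)] p0 by simp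
    moreover have "(V (Y (x \<tau>)) - c) * k \<tau> \<le> (w \<tau> - c) * k \<tau>"
      using kb[OF \<tau>(1)] pen_nonneg[OF par] by (intro mult_right_mono) (auto simp: w_def)
    ultimately have "(V (Y (x \<tau>)) - c) * k \<tau> \<le> V x0 - c + \<zeta>" by linarith
    then show "norm (x \<tau>) \<le> (1 + norm x0) * exp (2 * R * T) \<and>
      (\<exists>y\<in>closure G. dist (x \<tau>) y \<le> \<rho>0 \<and>
        (V y - c) * exp (- integral {0..\<tau>} (\<lambda>t. g (x t))) \<le> V x0 - c + \<zeta>)"
      using growth_x[OF \<tau>] Y(1,2)[OF end_in] \<rho>
      by (intro conjI bexI[of _ "Y (x \<tau>)"]) (auto simp: X_def k_def dist_norm)
  qed
qed

end

section \<open>Exit times and proximal inequalities\<close>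

text \<open>Semicontinuity at a single z gives a radius depending on z. Continuity of V along E
  allows a comparison with nearby centres z', and the Lebesgue number of a cover of the bounded part
  of E makes the radius uniform.\<close>

lemma lsc_on_near_boundary:
  fixes V :: "'a::euclidean_space \<Rightarrow> real"
  assumes lsc: "lsc_on S V" and E: "closed E" "E \<subseteq> S" and cont: "continuous_on E V" and e: "0 < e"
  obtains r where "0 < r" "\<And>z y. z \<in> E \<Longrightarrow> norm z \<le> X \<Longrightarrow> y \<in> S \<Longrightarrow> dist y z < r \<Longrightarrow> V z - e < V y"
proof -
  define K where "K = E \<inter> cball 0 X"
  have K: "compact K" using E(1) by (simp add: K_def closed_Int_compact)
  have "\<exists>r>0. (\<forall>y\<in>S. dist y z < r \<longrightarrow> V z - e/2 < V y) \<and> (\<forall>y\<in>E. dist y z < r \<longrightarrow> V y < V z + e/2)"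
    if z: "z \<in> K" for z
  proof -
    have zE: "z \<in> E" "z \<in> S" using z E by (auto simp: K_def)
    have "\<forall>\<^sub>F y in at z within S. V z - e/2 < V y" using lsc zE e unfolding lsc_on_def by simp
    then obtain r1 where r1: "0 < r1" "\<And>y. y \<in> S \<Longrightarrow> y \<noteq> z \<Longrightarrow> dist y z < r1 \<Longrightarrow> V z - e/2 < V y"
      unfolding eventually_at by auto
    obtain r2 where r2: "0 < r2" "\<And>y. y \<in> E \<Longrightarrow> dist y z < r2 \<Longrightarrow> dist (V y) (V z) < e/2"
      using cont zE e unfolding continuous_on_iff by (meson half_gt_zero)
    show ?thesis
    proof (intro exI[of _ "min r1 r2"] conjI ballI impI)
      show "0 < min r1 r2" using r1 r2 by simp
      fix y assume "y \<in> S" "dist y z < min r1 r2"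
      then show "V z - e/2 < V y" using r1(2)[of y] e by (cases "y = z") auto
    next
      fix y assume "y \<in> E" "dist y z < min r1 r2"
      then have "\<bar>V y - V z\<bar> < e/2" using r2(2)[of y] by (simp add: dist_real_def)
      then show "V y < V z + e/2" by linarith
    qed
  qed
  then obtain r where r: "\<And>z. z \<in> K \<Longrightarrow> 0 < r z"
    "\<And>z y. z \<in> K \<Longrightarrow> y \<in> S \<Longrightarrow> dist y z < r z \<Longrightarrow> V z - e/2 < V y"
    "\<And>z y. z \<in> K \<Longrightarrow> y \<in> E \<Longrightarrow> dist y z < r z \<Longrightarrow> V y < V z + e/2"
    by metis
  have "K \<subseteq> \<Union>((\<lambda>z. ball z (r z)) ` K)" using r(1) by force
  then obtain r0 where r0: "0 < r0" "\<And>z. z \<in> K \<Longrightarrow> \<exists>N\<in>(\<lambda>z. ball z (r z)) ` K. ball z r0 \<subseteq> N"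
    using Heine_Borel_lemma[OF K, of "(\<lambda>z. ball z (r z)) ` K"] by blast
  show thesis
  proof (rule that[OF r0(1)])
    fix z y assume z: "z \<in> E" "norm z \<le> X" and y: "y \<in> S" "dist y z < r0"
    then have zK: "z \<in> K" by (simp add: K_def)
    obtain z' where z': "z' \<in> K" "ball z r0 \<subseteq> ball z' (r z')" using r0(2)[OF zK] by blast
    have "z \<in> ball z r0" "y \<in> ball z r0" using y r0 by (auto simp: dist_commute)
    then have "z \<in> ball z' (r z')" "y \<in> ball z' (r z')" using z'(2) by blast+
    then have "dist z z' < r z'" "dist y z' < r z'" by (simp_all add: dist_commute)
    then have "V z < V z' + e/2" "V z' - e/2 < V y" using r(2,3)[OF z'(1)] y z by blast+
    then show "V z - e < V y" by linarith
  qed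
qed

lemma boundary_nbhd_iff: "x \<in> boundary_nbhd M \<epsilon> \<longleftrightarrow> (\<exists>z\<in>frontier M. dist x z \<le> \<epsilon>)"
proof
  assume "x \<in> boundary_nbhd M \<epsilon>"
  then obtain z y where "x = z + y" "z \<in> frontier M" "norm y \<le> \<epsilon>" unfolding boundary_nbhd_def by blast
  then show "\<exists>z\<in>frontier M. dist x z \<le> \<epsilon>" by (intro bexI[of _ z]) (auto simp: dist_norm)
next
  assume "\<exists>z\<in>frontier M. dist x z \<le> \<epsilon>"
  then obtain z where "z \<in> frontier M" "norm (x - z) \<le> \<epsilon>" by (auto simp: dist_norm)
  moreover have "x = z + (x - z)" by simp
  ultimately show "x \<in> boundary_nbhd M \<epsilon>" unfolding boundary_nbhd_def by blast
qed

lemma closed_boundary_nbhd: "closed (boundary_nbhd M \<epsilon>)"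
proof -
  have "boundary_nbhd M \<epsilon> = (\<Union>x\<in>frontier M. \<Union>y\<in>cball 0 \<epsilon>. {x + y})"
    unfolding boundary_nbhd_def mem_cball_0[symmetric] by blast
  then show ?thesis using closed_compact_sums[of "frontier M" "cball 0 \<epsilon>"] by simp
qed

text \<open>Near a point of one set the other set is absent, so it cannot fill in the missing part
  of a neighbourhood and turn a boundary point into an interior point of the union.\<close>

lemma frontier_game_region:
  assumes M: "closed M1" "closed M2" and dist: "positive_distance M1 M2"
  shows "frontier (game_region M1 M2) = frontier M1 \<union> frontier M2"
proof -
  obtain \<delta> where \<delta>: "0 < \<delta>" "\<And>x y. x \<in> M1 \<Longrightarrow> y \<in> M2 \<Longrightarrow> \<delta> \<le> dist x y"
    using dist unfolding positive_distance_def by blast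
  have \<delta>2: "\<And>x y. x \<in> M2 \<Longrightarrow> y \<in> M1 \<Longrightarrow> \<delta> \<le> dist x y" using \<delta>(2) by (metis dist_commute)
  have "z \<notin> interior (N \<union> N')"
    if z: "z \<in> frontier N" and N: "closed N" and d: "\<And>x y. x \<in> N \<Longrightarrow> y \<in> N' \<Longrightarrow> \<delta> \<le> dist x y" for z N N'
  proof
    assume "z \<in> interior (N \<union> N')"
    then obtain e where e: "0 < e" "ball z e \<subseteq> N \<union> N'" unfolding mem_interior by blast
    have zN: "z \<in> N" using z N frontier_subset_closed by blast
    have "ball z (min e \<delta>) \<subseteq> N" using e(2) d[OF zN] by (force simp: not_le[symmetric])
    then have "z \<in> interior N" using e \<delta>(1) unfolding mem_interior by (intro exI[of _ "min e \<delta>"]) auto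
    then show False using z by (simp add: frontier_def)
  qed
  note * = this
  have "frontier M1 \<union> frontier M2 \<subseteq> frontier (M1 \<union> M2)"
  proof
    fix z assume "z \<in> frontier M1 \<union> frontier M2"
    moreover have "z \<notin> interior (M1 \<union> M2)" if "z \<in> frontier M1" by (rule *[OF that M(1) \<delta>(2)])
    moreover have "z \<notin> interior (M2 \<union> M1)" if "z \<in> frontier M2" by (rule *[OF that M(2) \<delta>2])
    ultimately have "z \<notin> interior (M1 \<union> M2)" by (auto simp: Un_commute)
    moreover have "z \<in> M1 \<union> M2"
      using \<open>z \<in> frontier M1 \<union> frontier M2\<close> M frontier_subset_closed by blast
    ultimately show "z \<in> frontier (M1 \<union> M2)" using M by (simp add: frontier_def)
  qed
  then have "frontier (M1 \<union> M2) = frontier M1 \<union> frontier M2" using frontier_Un_subset by blast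
  then show ?thesis unfolding game_region_def Compl_eq_Diff_UNIV[symmetric] frontier_complement .
qed

text \<open>The neighbourhoods are closed and the motion is continuous, so the infimum defining the
  exit time is a minimum.\<close>

lemma exit_time_attained:
  assumes x: "continuous_on {0..} x" and fin: "exit_time M1 M2 \<epsilon> x \<noteq> \<infinity>"
  obtains \<tau> where "0 \<le> \<tau>" "exit_time M1 M2 \<epsilon> x = ereal \<tau>" "x \<tau> \<in> boundary_nbhd M1 \<epsilon> \<union> boundary_nbhd M2 \<epsilon>"
proof -
  define S where "S = {t. 0 \<le> t \<and> x t \<in> boundary_nbhd M1 \<epsilon> \<union> boundary_nbhd M2 \<epsilon>}"
  have e: "exit_time M1 M2 \<epsilon> x = (INF t\<in>S. ereal t)" by (simp add: exit_time_def S_def)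
  have "S \<noteq> {}" using fin by (auto simp: e top_ereal_def)
  moreover have "closed S"
  proof -
    have "S = {0..} \<inter> x -` (boundary_nbhd M1 \<epsilon> \<union> boundary_nbhd M2 \<epsilon>)" by (auto simp: S_def)
    moreover have "closed \<dots>"
      by (rule continuous_closed_preimage[OF x]) (auto intro: closed_boundary_nbhd)
    ultimately show ?thesis by simp
  qed
  moreover have bb: "bdd_below S" by (rule bdd_belowI[of _ 0]) (simp add: S_def)
  ultimately have "Inf S \<in> S" using closed_contains_Inf by blast
  moreover have "(INF t\<in>S. ereal t) = ereal (Inf S)"
  proof (rule antisym)
    show "(INF t\<in>S. ereal t) \<le> ereal (Inf S)" using \<open>Inf S \<in> S\<close> by (rule INF_lower)
    show "ereal (Inf S) \<le> (INF t\<in>S. ereal t)" using cInf_lower[OF _ bb] by (auto intro!: INF_greatest)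
  qed
  ultimately show thesis using that[of "Inf S"] e by (auto simp: S_def)
qed

text \<open>A connected path out of G crosses the frontier of G, whose points belong to the
  \<epsilon>-neighbourhoods. The time s may lie before the exit, so the result also applies at a
  horizon that the motion reaches without exiting.\<close>

lemma before_exit_time:
  assumes M: "closed M1" "closed M2" and dist: "positive_distance M1 M2" and \<epsilon>: "0 < \<epsilon>"
    and x: "continuous_on {0..} x" "x 0 \<in> game_region M1 M2"
    and s: "0 \<le> s" "ereal s \<le> exit_time M1 M2 \<epsilon> x"
  shows "\<And>t. 0 \<le> t \<Longrightarrow> t < s \<Longrightarrow>
      x t \<in> game_region M1 M2 \<and> (\<forall>z\<in>frontier (game_region M1 M2). \<epsilon> < dist (x t) z)"
    and "x s \<in> closure (game_region M1 M2)"
proof -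
  let ?G = "game_region M1 M2"
  have fr: "frontier ?G = frontier M1 \<union> frontier M2" by (rule frontier_game_region[OF M dist])
  have far: "\<epsilon> < dist (x t) z" if t: "0 \<le> t" "t < s" and z: "z \<in> frontier ?G" for t z
  proof (rule ccontr)
    assume "\<not> \<epsilon> < dist (x t) z"
    then have "x t \<in> boundary_nbhd M1 \<epsilon> \<union> boundary_nbhd M2 \<epsilon>"
      using z unfolding fr Un_iff boundary_nbhd_iff not_less by blast
    then have "exit_time M1 M2 \<epsilon> x \<le> ereal t" unfolding exit_time_def using t by (intro INF_lower) auto
    then have "ereal s \<le> ereal t" using s(2) by (rule order_trans[rotated])
    then show False using t by simp
  qed
  have inG: "x t \<in> ?G" if t: "0 \<le> t" "t < s" for t
  proof (rule ccontr)
    assume n: "x t \<notin> ?G"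
    have "connected (x ` {0..t})"
      by (intro connected_continuous_image continuous_on_subset[OF x(1)]) auto
    moreover have "x ` {0..t} \<inter> ?G \<noteq> {}" using x(2) t by force
    moreover have "x t \<in> x ` {0..t}" using t by auto
    then have "x ` {0..t} - ?G \<noteq> {}" using n by blast
    ultimately have "x ` {0..t} \<inter> frontier ?G \<noteq> {}" by (rule connected_Int_frontier)
    then obtain r where "0 \<le> r" "r \<le> t" "x r \<in> frontier ?G" by auto
    then show False using far[of r "x r"] t \<epsilon> by simp
  qed
  show "x t \<in> ?G \<and> (\<forall>z\<in>frontier ?G. \<epsilon> < dist (x t) z)" if "0 \<le> t" "t < s" for t
    using far inG that by blast
  show "x s \<in> closure ?G"
  proof (cases "s = 0")
    case True then show ?thesis using x(2) closure_subset by auto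
  next
    case False
    then have "s \<in> closure {0..<s}" using s(1) by simp
    moreover have "x ` closure {0..<s} \<subseteq> closure ?G"
    proof (rule image_closure_subset)
      show "continuous_on (closure {0..<s}) x" using s(1) False by (intro continuous_on_subset[OF x(1)]) auto
      show "x ` {0..<s} \<subseteq> closure ?G" using inG closure_subset by fastforce
    qed simp
    ultimately show ?thesis by blast
  qed
qed

section \<open>From directional derivatives to proximal inequalities\<close>

lemma ereal_le_of_all_less:
  assumes "\<And>e. 0 < e \<Longrightarrow> ereal (m - e) \<le> L"
  shows "ereal m \<le> L"
proof (rule ccontr)
  assume "\<not> ereal m \<le> L"
  then obtain r where r: "L < ereal r" "ereal r < ereal m" using ereal_dense2[of L "ereal m"] by (auto simp: not_le)
  then show False using assms[of "m - r"] by simp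
qed

text \<open>In a difference quotient with step \<delta> the quadratic term is only of order
  \<delta>, and replacing w by w' costs \<open>norm s * \<rho>\<close>. The constant k collects both
  effects, so \<rho> of order \<open>e / k\<close> suffices.\<close>

lemma lower_dd_ge_proximal:
  fixes V :: "real ^ 'd \<Rightarrow> real"
  assumes sub: "\<And>z. z \<in> G \<Longrightarrow> V y + s \<bullet> (z - y) - C * (norm (z - y))\<^sup>2 \<le> V z"
  shows "ereal (s \<bullet> w) \<le> lower_dd G V y w"
proof (rule ereal_le_of_all_less)
  fix e :: real assume e: "0 < e"
  define k where "k = norm s + \<bar>C\<bar> * (norm w + 1)\<^sup>2"
  have k: "0 \<le> k" by (simp add: k_def)
  define \<rho> where "\<rho> = min 1 (e / (k + 1))"
  have \<rho>: "0 < \<rho>" "\<rho> \<le> 1" using e k by (auto simp: \<rho>_def)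
  have "k * \<rho> \<le> (k + 1) * (e / (k + 1))" using k e \<rho> by (intro mult_mono) (auto simp: \<rho>_def)
  then have k\<rho>: "k * \<rho> \<le> e" using k by simp
  show "ereal (s \<bullet> w - e) \<le> lower_dd G V y w"
    unfolding lower_dd_eq_SUP
  proof (rule SUP_upper2[of \<rho>])
    show "ereal (s \<bullet> w - e) \<le> (INF (\<delta>, w') \<in> {(\<delta>, w'). 0 < \<delta> \<and> \<delta> < \<rho> \<and>
         norm (w - w') \<le> \<rho> \<and> y + \<delta> *\<^sub>R w' \<in> G}. ereal ((V (y + \<delta> *\<^sub>R w') - V y) / \<delta>))"
    proof (rule INF_greatest)
      fix v assume "v \<in> {(\<delta>, w'). 0 < \<delta> \<and> \<delta> < \<rho> \<and> norm (w - w') \<le> \<rho> \<and> y + \<delta> *\<^sub>R w' \<in> G}"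
      then obtain \<delta> w' where v: "v = (\<delta>, w')" and \<delta>: "0 < \<delta>" "\<delta> < \<rho>"
        and w': "norm (w - w') \<le> \<rho>" and inG: "y + \<delta> *\<^sub>R w' \<in> G" by blast
      have "\<delta> * (s \<bullet> w' - C * \<delta> * (norm w')\<^sup>2) \<le> V (y + \<delta> *\<^sub>R w') - V y"
        using sub[OF inG] by (simp add: power2_eq_square algebra_simps)
      then have 1: "s \<bullet> w' - C * \<delta> * (norm w')\<^sup>2 \<le> (V (y + \<delta> *\<^sub>R w') - V y) / \<delta>"
        using \<delta> by (simp add: pos_le_divide_eq mult.commute)
      have "s \<bullet> (w - w') \<le> norm s * norm (w - w')" by (rule norm_cauchy_schwarz)
      also have "\<dots> \<le> norm s * \<rho>" using w' by (rule mult_left_mono) simp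
      finally have 2: "s \<bullet> w - s \<bullet> w' \<le> norm s * \<rho>" by (simp add: inner_diff_right)
      have "norm w' \<le> norm w + norm (w' - w)" by (rule norm_triangle_sub)
      also have "\<dots> \<le> norm w + 1" using w' \<rho> by (simp add: norm_minus_commute)
      finally have nw: "norm w' \<le> norm w + 1" .
      have "C * (\<delta> * (norm w')\<^sup>2) \<le> \<bar>C\<bar> * (\<rho> * (norm w + 1)\<^sup>2)"
        using \<delta> nw by (intro mult_mono power_mono) auto
      then have "C * \<delta> * (norm w')\<^sup>2 \<le> \<bar>C\<bar> * (norm w + 1)\<^sup>2 * \<rho>" by (simp add: mult_ac)
      then have "s \<bullet> w - e \<le> (V (y + \<delta> *\<^sub>R w') - V y) / \<delta>"
        using 1 2 k\<rho> by (simp add: k_def algebra_simps)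
      then show "ereal (s \<bullet> w - e) \<le> (case v of (\<delta>, w') \<Rightarrow> ereal ((V (y + \<delta> *\<^sub>R w') - V y) / \<delta>))"
        by (simp add: v)
    qed
  qed (use \<rho> in simp)
qed

text \<open>Lets a subsolution w be handled through the lower derivative of
  \<open>- w\<close>.\<close>

lemma upper_dd_eq_lower_dd: "upper_dd G u x w = - lower_dd G (\<lambda>x. - u x) x w"
proof -
  have 1: "(INF (\<delta>, w')\<in>S. ereal ((- u (x + \<delta> *\<^sub>R w') - - u x) / \<delta>))
      = - (SUP (\<delta>, w')\<in>S. ereal ((u (x + \<delta> *\<^sub>R w') - u x) / \<delta>))" for S
  proof -
    have "(case z of (\<delta>, w') \<Rightarrow> ereal ((- u (x + \<delta> *\<^sub>R w') - - u x) / \<delta>))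
       = - (case z of (\<delta>, w') \<Rightarrow> ereal ((u (x + \<delta> *\<^sub>R w') - u x) / \<delta>))" for z
      by (cases z) (simp add: diff_divide_distrib)
    then show ?thesis by (simp add: ereal_INF_uminus_eq)
  qed
  show ?thesis unfolding upper_dd_eq_INF lower_dd_eq_SUP 1 by (simp add: ereal_SUP_uminus_eq)
qed

text \<open>A half-space and a hyperplane containing the generators also contain their convex
  hull.\<close>

lemma E_plus_bounds:
  assumes m: "\<And>p. p \<in> P \<Longrightarrow> m \<le> s \<bullet> f x p q" and e: "(fb, gb) \<in> E_plus P f g x z q"
  shows "gb = g x * (z - 1)" "m \<le> s \<bullet> fb"
proof -
  let ?H = "{w. (s, 0) \<bullet> w \<ge> m} \<inter> {w. (0, 1) \<bullet> w = g x * (z - 1)}"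
  have "E_plus P f g x z q \<subseteq> ?H"
    unfolding E_plus_def
    by (rule hull_minimal) (use m in \<open>auto intro!: convex_Int convex_halfspace_ge convex_hyperplane\<close>)
  then show "gb = g x * (z - 1)" "m \<le> s \<bullet> fb" using e by auto
qed

section \<open>Comparison with the boundary values at the exit\<close>

context aiming
begin

text \<open>The first estimate needs no contact with the boundary and is meant for the horizon,
  where only \<open>- B \<le> V\<close> is known; the second one serves at the exit. A common
  arbitrary \<tau> covers both uses.\<close>

definition exit_bound where
  "exit_bound \<epsilon> T x0 \<beta> U \<mu> \<longleftrightarrow> U \<in> UNIV \<rightarrow> A \<and> 0 < \<mu> \<and>
      (\<forall>\<Delta> x \<tau>. is_partition \<Delta> \<longrightarrow> (\<forall>i. \<Delta> (Suc i) - \<Delta> i < \<mu>) \<longrightarrow> x \<in> motions1 D F x0 U \<Delta> \<longrightarrow>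
        0 \<le> \<tau> \<longrightarrow> \<tau> \<le> T \<longrightarrow>
        (\<forall>t. 0 \<le> t \<longrightarrow> t < \<tau> \<longrightarrow> x t \<in> G \<and> (\<forall>z\<in>frontier G. \<epsilon> < dist (x t) z)) \<longrightarrow>
        x \<tau> \<in> closure G \<longrightarrow>
        (- B - c) * exp (- integral {0..\<tau>} (\<lambda>t. g (x t))) \<le> \<beta> \<and>
        (\<forall>z\<in>frontier G. dist (x \<tau>) z \<le> \<epsilon> \<longrightarrow>
          (V z - c) * exp (- integral {0..\<tau>} (\<lambda>t. g (x t))) \<le> \<beta>))"

lemma exit_boundD:
  assumes "exit_bound \<epsilon> T x0 \<beta> U \<mu>"
    and "is_partition \<Delta>" "\<forall>i. \<Delta> (Suc i) - \<Delta> i < \<mu>" "x \<in> motions1 D F x0 U \<Delta>" "0 \<le> \<tau>" "\<tau> \<le> T"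
    and "\<And>t. 0 \<le> t \<Longrightarrow> t < \<tau> \<Longrightarrow> x t \<in> G \<and> (\<forall>z\<in>frontier G. \<epsilon> < dist (x t) z)" "x \<tau> \<in> closure G"
  shows "(- B - c) * exp (- integral {0..\<tau>} (\<lambda>t. g (x t))) \<le> \<beta>"
    and "z \<in> frontier G \<Longrightarrow> dist (x \<tau>) z \<le> \<epsilon> \<Longrightarrow> (V z - c) * exp (- integral {0..\<tau>} (\<lambda>t. g (x t))) \<le> \<beta>"
  using assms unfolding exit_bound_def by blast+

text \<open>The minimizer and a boundary point z, both within \<epsilon> of \<open>x \<tau>\<close>,
  are less than r apart once \<open>2 * \<epsilon> < r\<close>. Lower semicontinuity then bounds
  \<open>V z\<close> by \<open>V y + \<zeta> / 2\<close>, the one-sided comparison that is wanted.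
  The 1 added in X leaves room for the distance from \<open>x \<tau>\<close> to z.\<close>

theorem exit_strategy:
  assumes cont: "continuous_on (frontier G) V" and \<zeta>: "0 < \<zeta>" and T: "0 \<le> T" and x0: "x0 \<in> closure G"
  obtains \<epsilon>1 where "0 < \<epsilon>1"
    "\<And>\<epsilon>. 0 < \<epsilon> \<Longrightarrow> \<epsilon> < \<epsilon>1 \<Longrightarrow> \<exists>U \<mu>. exit_bound \<epsilon> T x0 (V x0 - c + \<zeta>) U \<mu>"
proof -
  define X where "X = (1 + norm x0) * exp (2 * R * T) + 1"
  have fr: "frontier G \<subseteq> closure G" by (simp add: frontier_def)
  obtain r where r: "0 < r" "\<And>z y. z \<in> frontier G \<Longrightarrow> norm z \<le> X \<Longrightarrow> y \<in> closure G \<Longrightarrow> dist y z < r \<Longrightarrow>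
      V z - \<zeta> / 2 < V y"
    using lsc_on_near_boundary[OF lsc _ fr cont half_gt_zero[OF \<zeta>], where X = X] by (auto simp: frontier_closed)
  show thesis
  proof (rule that[of "min 1 (r / 2)"])
    show "0 < min 1 (r / 2)" using r by simp
    fix \<epsilon> :: real assume \<epsilon>: "0 < \<epsilon>" "\<epsilon> < min 1 (r / 2)"
    obtain U \<mu> where U: "U \<in> UNIV \<rightarrow> A" and \<mu>: "0 < \<mu>" and
      aim: "\<And>\<Delta> x \<tau>. is_partition \<Delta> \<Longrightarrow> (\<And>i. \<Delta> (Suc i) - \<Delta> i < \<mu>) \<Longrightarrow> x \<in> motions1 D F x0 U \<Delta> \<Longrightarrow>
        0 \<le> \<tau> \<Longrightarrow> \<tau> \<le> T \<Longrightarrow>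
        (\<And>t. 0 \<le> t \<Longrightarrow> t < \<tau> \<Longrightarrow> x t \<in> G \<and> (\<forall>z\<in>frontier G. \<epsilon> < dist (x t) z)) \<Longrightarrow>
        x \<tau> \<in> closure G \<Longrightarrow>
        norm (x \<tau>) \<le> (1 + norm x0) * exp (2 * R * T) \<and>
        (\<exists>y\<in>closure G. dist (x \<tau>) y \<le> \<epsilon> \<and>
          (V y - c) * exp (- integral {0..\<tau>} (\<lambda>t. g (x t))) \<le> V x0 - c + \<zeta> / 2)"
      using aiming_strategy[OF \<epsilon>(1) half_gt_zero[OF \<zeta>] T x0] by blast
    show "\<exists>U \<mu>. exit_bound \<epsilon> T x0 (V x0 - c + \<zeta>) U \<mu>"
      unfolding exit_bound_def
    proof (rule exI[of _ U], rule exI[of _ \<mu>], rule conjI[OF U], rule conjI[OF \<mu>], intro allI impI)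
      fix \<Delta> x \<tau>
      assume part: "is_partition \<Delta>" and fine: "\<forall>i. \<Delta> (Suc i) - \<Delta> i < \<mu>" and x: "x \<in> motions1 D F x0 U \<Delta>"
        and \<tau>: "0 \<le> \<tau>" "\<tau> \<le> T"
        and inside: "\<forall>t. 0 \<le> t \<longrightarrow> t < \<tau> \<longrightarrow> x t \<in> G \<and> (\<forall>z\<in>frontier G. \<epsilon> < dist (x t) z)"
        and end_in: "x \<tau> \<in> closure G"
      define k where "k = exp (- integral {0..\<tau>} (\<lambda>t. g (x t)))"
      have xc: "continuous_on {0..\<tau>} x" using x by (auto simp: motions1_def elim: continuous_on_subset)
      have "continuous_on UNIV g"
        using lipg lam by (intro lipschitz_on_continuous_on[of lam] lipschitz_onI) (auto simp: dist_norm)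
      then have "continuous_on {0..\<tau>} (\<lambda>t. g (x t))" using xc by (rule continuous_on_compose2) auto
      then have "0 \<le> integral {0..\<tau>} (\<lambda>t. g (x t))"
        using b by (intro integral_nonneg integrable_continuous_real) (auto intro: order_trans[OF less_imp_le])
      then have k: "0 < k" "k \<le> 1" by (auto simp: k_def)
      have "norm (x \<tau>) \<le> (1 + norm x0) * exp (2 * R * T) \<and>
        (\<exists>y\<in>closure G. dist (x \<tau>) y \<le> \<epsilon> \<and> (V y - c) * k \<le> V x0 - c + \<zeta> / 2)"
        unfolding k_def using aim[OF part _ x \<tau> _ end_in] fine inside by blast
      then obtain y where nx: "norm (x \<tau>) \<le> X - 1" and y: "y \<in> closure G" "dist (x \<tau>) y \<le> \<epsilon>"
        and le: "(V y - c) * k \<le> V x0 - c + \<zeta> / 2" by (auto simp: X_def)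
      have "(- B - c) * k \<le> (V y - c) * k" using bnd[OF y(1)] k by (intro mult_right_mono) (auto simp: abs_le_iff)
      then have "(- B - c) * k \<le> V x0 - c + \<zeta>" using le \<zeta> by linarith
      moreover have "(V z - c) * k \<le> V x0 - c + \<zeta>" if z: "z \<in> frontier G" "dist (x \<tau>) z \<le> \<epsilon>" for z
      proof -
        have "norm z \<le> norm (x \<tau>) + dist (x \<tau>) z" unfolding dist_norm by norm
        then have "norm z \<le> X" using nx z(2) \<epsilon> by simp
        moreover have "dist y z < r" using dist_triangle[of y z "x \<tau>"] y(2) z(2) \<epsilon> by (simp add: dist_commute)
        ultimately have "V z - \<zeta> / 2 < V y" using r(2)[OF z(1) _ y(1)] by blast
        then have "(V z - c) * k \<le> (V y - c + \<zeta> / 2) * k" using k by (intro mult_right_mono) auto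
        also have "\<dots> \<le> (V y - c) * k + \<zeta> / 2" using k \<zeta> by (simp add: distrib_right mult_left_le)
        finally show ?thesis using le by linarith
      qed
      ultimately show "(- B - c) * exp (- integral {0..\<tau>} (\<lambda>t. g (x t))) \<le> V x0 - c + \<zeta> \<and>
        (\<forall>z\<in>frontier G. dist (x \<tau>) z \<le> \<epsilon> \<longrightarrow>
          (V z - c) * exp (- integral {0..\<tau>} (\<lambda>t. g (x t))) \<le> V x0 - c + \<zeta>)"
        unfolding k_def by blast
    qed
  qed
qed

end

section \<open>The filter of fine partitions\<close>

lemma eventually_fine_partitions:
  assumes "0 < \<mu>"
  shows "\<forall>\<^sub>F \<Delta> in fine_partitions. is_partition \<Delta> \<and> (\<forall>i. \<Delta> (Suc i) - \<Delta> i < \<mu>)"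
proof -
  have "\<forall>\<^sub>F m in at_right (0::ereal). m < ereal \<mu>"
    using assms by (subst eventually_at_right[of 0 "ereal \<mu>"]) (auto intro: exI[of _ "ereal \<mu>"])
  then have "\<forall>\<^sub>F \<Delta> in filtercomap mesh (at_right 0). mesh \<Delta> < ereal \<mu>"
    by (rule eventually_filtercomapI)
  then show ?thesis
    unfolding fine_partitions_def eventually_inf_principal
  proof eventually_elim
    case (elim \<Delta>)
    have "ereal (\<Delta> (Suc i) - \<Delta> i) \<le> mesh \<Delta>" for i unfolding mesh_def by (rule SUP_upper) simp
    then have "ereal (\<Delta> (Suc i) - \<Delta> i) < ereal \<mu>" for i using elim by (rule le_less_trans)
    then show ?case by auto
  qed
qed

text \<open>Uniform partitions realize every small positive mesh. Nontriviality is what makes a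
  lower limit stay below an upper limit.\<close>

lemma fine_partitions_neq_bot: "fine_partitions \<noteq> bot"
proof
  assume "fine_partitions = bot"
  then have "eventually (\<lambda>\<Delta>. \<not> is_partition \<Delta>) (filtercomap mesh (at_right 0))"
    by (simp add: fine_partitions_def eventually_inf_principal trivial_limit_def)
  then obtain S where S: "eventually S (at_right (0::ereal))" "\<And>\<Delta>. S (mesh \<Delta>) \<Longrightarrow> \<not> is_partition \<Delta>"
    unfolding eventually_filtercomap by blast
  then obtain y where y: "0 < y" "\<And>m. 0 < m \<Longrightarrow> m < y \<Longrightarrow> S m"
    by (subst (asm) eventually_at_right[of 0 \<infinity>]) auto
  obtain m where m: "0 < ereal m" "ereal m < y" using ereal_dense2[OF y(1)] by blast
  define \<Delta> where "\<Delta> i = real i * m" for i :: nat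
  have gap: "\<Delta> (Suc i) - \<Delta> i = m" for i by (simp add: \<Delta>_def algebra_simps)
  have "is_partition \<Delta>" using m gap by (simp add: is_partition_def) (simp add: \<Delta>_def)
  moreover have "mesh \<Delta> = ereal m" by (simp add: mesh_def gap)
  ultimately show False using S(2)[of \<Delta>] y(2)[of "ereal m"] m by simp
qed

section \<open>The game with exit time\<close>

lemma abs_exp_minus_diff_le:
  fixes a h :: real
  assumes "0 \<le> a" "0 \<le> h"
  shows "\<bar>exp (- h) - exp (- a)\<bar> \<le> \<bar>h - a\<bar>"
proof -
  have *: "exp (- s) - exp (- t) \<le> t - s" if "0 \<le> s" "s \<le> t" for s t :: real
  proof -
    have "exp (- t) = exp (- s) * exp (- (t - s))" by (simp flip: exp_add)
    then have "exp (- s) - exp (- t) = exp (- s) * (1 - exp (- (t - s)))" by (simp add: algebra_simps)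
    also have "\<dots> \<le> 1 * (t - s)" using that exp_ge_add_one_self[of "s - t"] by (intro mult_mono) (auto simp: algebra_simps)
    finally show ?thesis by simp
  qed
  show ?thesis
  proof (cases "a \<le> h")
    case True
    then have "exp (- h) \<le> exp (- a)" by simp
    then show ?thesis using *[of a h] assms True by simp
  next
    case False
    then have "exp (- a) \<le> exp (- h)" by simp
    then show ?thesis using *[of h a] assms False by simp
  qed
qed

lemma motions2_eq_motions1: "motions2 P f x0 V \<Delta> = motions1 P (\<lambda>x q p. f x p q) x0 V \<Delta>"
  by (simp add: motions1_def motions2_def)

text \<open>The consequences of (A1)-(A5) with all constants fixed. One \<epsilon>0 bounds both the
  admissible \<epsilon> and the distance between the terminal sets, so that M1 never meets the
  \<epsilon>-neighbourhood of the boundary of M2.\<close>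

locale exit_game =
  fixes P :: "'p::metric_space set" and Q :: "'q::metric_space set"
    and f :: "real ^ 'd \<Rightarrow> 'p \<Rightarrow> 'q \<Rightarrow> real ^ 'd" and g :: "real ^ 'd \<Rightarrow> real"
    and M1 M2 :: "(real ^ 'd) set" and \<sigma> :: "real ^ 'd \<Rightarrow> ereal" and sh :: "real \<Rightarrow> real ^ 'd \<Rightarrow> ereal"
    and R lam b L K \<epsilon>0 :: real
  assumes ne: "P \<noteq> {}" "Q \<noteq> {}" and closed: "closed M1" "closed M2"
    and growth: "\<And>x p q. p \<in> P \<Longrightarrow> q \<in> Q \<Longrightarrow> norm (f x p q) \<le> R * (1 + norm x)" and R: "0 \<le> R"
    and lipf: "\<And>x y p q. p \<in> P \<Longrightarrow> q \<in> Q \<Longrightarrow> norm (f x p q - f y p q) \<le> lam * norm (x - y)"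
    and lipg: "\<And>x y. \<bar>g x - g y\<bar> \<le> lam * norm (x - y)" and lam: "0 \<le> lam"
    and b: "0 < b" "\<And>x. b \<le> g x"
    and saddle: "\<And>s x. (INF p\<in>P. SUP q\<in>Q. s \<bullet> f x p q) = (SUP q\<in>Q. INF p\<in>P. s \<bullet> f x p q)"
    and \<sigma>1: "\<And>x. x \<in> frontier M1 \<Longrightarrow> 0 \<le> \<sigma> x \<and> \<sigma> x \<noteq> \<infinity>"
    and \<sigma>2: "\<And>x. x \<in> frontier M2 \<Longrightarrow> \<sigma> x = \<infinity>"
    and \<sigma>lip: "L-lipschitz_on (frontier M1) (\<lambda>x. real_of_ereal (\<sigma> x))"
    and \<epsilon>0: "0 < \<epsilon>0" and sep: "\<And>x y. x \<in> M1 \<Longrightarrow> y \<in> M2 \<Longrightarrow> \<epsilon>0 \<le> dist x y"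
    and sh1: "\<And>\<epsilon> x. 0 < \<epsilon> \<Longrightarrow> \<epsilon> < \<epsilon>0 \<Longrightarrow> x \<in> frontier M1 \<Longrightarrow> sh \<epsilon> x = \<sigma> x"
    and shb: "\<And>\<epsilon> x. 0 < \<epsilon> \<Longrightarrow> \<epsilon> < \<epsilon>0 \<Longrightarrow> x \<in> closure (game_region M1 M2) \<Longrightarrow> x \<notin> boundary_nbhd M2 \<epsilon> \<Longrightarrow>
        0 \<le> sh \<epsilon> x \<and> sh \<epsilon> x \<noteq> \<infinity>"
    and shlip: "\<And>\<epsilon>. 0 < \<epsilon> \<Longrightarrow> \<epsilon> < \<epsilon>0 \<Longrightarrow>
        K-lipschitz_on (closure (game_region M1 M2) - boundary_nbhd M2 \<epsilon>) (\<lambda>x. real_of_ereal (sh \<epsilon> x))"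
    and sh2: "\<And>\<epsilon> x. 0 < \<epsilon> \<Longrightarrow> \<epsilon> < \<epsilon>0 \<Longrightarrow> x \<in> closure (game_region M1 M2) \<Longrightarrow> x \<in> boundary_nbhd M2 \<epsilon> \<Longrightarrow>
        sh \<epsilon> x = \<infinity>"
begin

abbreviation "G \<equiv> game_region M1 M2"
abbreviation "th \<equiv> \<lambda>x. kruzhkov (\<sigma> x)"

lemma open_G: "open G"
  using closed by (simp add: game_region_def open_Diff closed_Un)

lemma positive_distance: "positive_distance M1 M2"
  unfolding positive_distance_def using \<epsilon>0 sep by blast

lemma frontier_G: "frontier G = frontier M1 \<union> frontier M2"
  by (rule frontier_game_region[OF closed positive_distance])

lemma K: "0 \<le> K"
  using shlip[of "\<epsilon>0 / 2"] \<epsilon>0 by (simp add: lipschitz_on_def)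

lemma \<sigma>1_real:
  assumes "z \<in> frontier M1"
  obtains a where "\<sigma> z = ereal a" "0 \<le> a" "th z = 1 - exp (- a)"
  using \<sigma>1[OF assms] by (cases "\<sigma> z") (auto simp: kruzhkov_def)

lemma th2: "z \<in> frontier M2 \<Longrightarrow> th z = 1"
  by (simp add: \<sigma>2 kruzhkov_def)

lemma th_le_1: "z \<in> frontier G \<Longrightarrow> th z \<le> 1"
  unfolding frontier_G using th2 by (auto elim: \<sigma>1_real)

text \<open>The transform turns the infinite payoff on the boundary of M2 into the constant 1, so
  the boundary data satisfy the continuity demanded by \<open>exit_strategy\<close>.\<close>

lemma continuous_on_th: "continuous_on (frontier G) th"
  unfolding frontier_G
proof (rule continuous_on_closed_Un)
  have "continuous_on (frontier M1) (\<lambda>x. 1 - exp (- real_of_ereal (\<sigma> x)))"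
    using lipschitz_on_continuous_on[OF \<sigma>lip] by (intro continuous_intros)
  then show "continuous_on (frontier M1) th"
    by (rule continuous_on_eq) (auto elim!: \<sigma>1_real)
  have "continuous_on (frontier M2) (\<lambda>x. 1 :: real)" by simp
  then show "continuous_on (frontier M2) th" by (rule continuous_on_eq) (simp add: th2)
qed (auto simp: frontier_closed)

text \<open>With a quadratic minorant of slope s, every direction of \<open>E_plus\<close>
  contributes at least \<open>?m - g y * (v y - 1)\<close> to the infimum. Its nonpositivity thus
  becomes a statement about s alone, for each q.\<close>

lemma supersolution_aiming:
  assumes v: "supersolution P Q f g G th v"
  obtains B where "aiming P Q f g G v R lam b 1 B"
proof -
  obtain B where B: "\<And>x. x \<in> closure G \<Longrightarrow> \<bar>v x\<bar> \<le> B"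
    using v unfolding supersolution_def bounded_iff by auto
  have "aiming P Q f g G v R lam b 1 B"
  proof
    fix y s C q
    assume y: "y \<in> G" and sub: "\<And>z. z \<in> closure G \<Longrightarrow> v y + s \<bullet> (z - y) - C * (norm (z - y))\<^sup>2 \<le> v z"
      and q: "q \<in> Q"
    let ?m = "INF p\<in>P. s \<bullet> f y p q"
    have bb: "bdd_below ((\<lambda>p. s \<bullet> f y p q) ` P)"
    proof (rule bdd_belowI2)
      fix p assume "p \<in> P"
      then have "norm s * norm (f y p q) \<le> norm s * (R * (1 + norm y))" using growth q by (intro mult_left_mono) auto
      then show "- (norm s * (R * (1 + norm y))) \<le> s \<bullet> f y p q"
        using Cauchy_Schwarz_ineq2[of s "f y p q"] by linarith
    qed
    have m: "?m \<le> s \<bullet> f y p q" if "p \<in> P" for p using that by (rule cINF_lower[OF bb])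
    have "ereal (?m - g y * (v y - 1)) \<le> (INF (fb, gb) \<in> E_plus P f g y (v y) q. lower_dd G v y fb - ereal gb)"
    proof (rule INF_greatest)
      fix e assume "e \<in> E_plus P f g y (v y) q"
      moreover obtain fb gb where e: "e = (fb, gb)" by fastforce
      ultimately have gb: "gb = g y * (v y - 1)" and fb: "?m \<le> s \<bullet> fb"
        using E_plus_bounds[of P ?m s f y q fb gb g "v y"] m by blast+
      have "ereal (s \<bullet> fb) \<le> lower_dd G v y fb"
        using sub closure_subset by (intro lower_dd_ge_proximal) blast
      then have "ereal ?m \<le> lower_dd G v y fb" using fb by (meson ereal_less_eq(3) order_trans)
      then have "ereal ?m - ereal gb \<le> lower_dd G v y fb - ereal gb" by (rule ereal_minus_mono) simp
      then show "ereal (?m - g y * (v y - 1)) \<le> (case e of (fb, gb) \<Rightarrow> lower_dd G v y fb - ereal gb)"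
        by (simp add: e gb)
    qed
    also have "\<dots> \<le> 0" using v y q unfolding supersolution_def by blast
    finally show "?m \<le> g y * (v y - 1)" by simp
  next
    show "lsc_on (closure G) v" using v by (simp add: supersolution_def)
  qed (use ne growth R lipf lipg lam b saddle open_G B in auto)
  then show thesis by (rule that)
qed

text \<open>Passing from s to \<open>- s\<close> exchanges infima and suprema.\<close>

lemma saddle_swapped: "(INF q\<in>Q. SUP p\<in>P. s \<bullet> f x p q) = (SUP p\<in>P. INF q\<in>Q. s \<bullet> f x p q)"
  using saddle[of "- s" x] by (simp add: Inf_real_def image_image)

text \<open>The value -1 of c comes from \<open>- (w y - 1) = - w y - (- 1)\<close>; the second
  player is now the one who aims.\<close>

lemma subsolution_aiming:
  assumes w: "subsolution P Q f g G th w"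
  obtains B where "aiming Q P (\<lambda>x q p. f x p q) g G (\<lambda>x. - w x) R lam b (- 1) B"
proof -
  obtain B where B: "\<And>x. x \<in> closure G \<Longrightarrow> \<bar>w x\<bar> \<le> B"
    using w unfolding subsolution_def bounded_iff by auto
  have "aiming Q P (\<lambda>x q p. f x p q) g G (\<lambda>x. - w x) R lam b (- 1) B"
  proof
    fix y s C p
    assume y: "y \<in> G" and sub: "\<And>z. z \<in> closure G \<Longrightarrow> - w y + s \<bullet> (z - y) - C * (norm (z - y))\<^sup>2 \<le> - w z"
      and p: "p \<in> P"
    let ?m = "INF q\<in>Q. s \<bullet> f y p q"
    have bb: "bdd_below ((\<lambda>q. s \<bullet> f y p q) ` Q)"
    proof (rule bdd_belowI2)
      fix q assume "q \<in> Q"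
      then have "norm s * norm (f y p q) \<le> norm s * (R * (1 + norm y))" using growth p by (intro mult_left_mono) auto
      then show "- (norm s * (R * (1 + norm y))) \<le> s \<bullet> f y p q"
        using Cauchy_Schwarz_ineq2[of s "f y p q"] by linarith
    qed
    have m: "?m \<le> s \<bullet> f y p q" if "q \<in> Q" for q using that by (rule cINF_lower[OF bb])
    have E: "E_minus Q f g y (w y) p = E_plus Q (\<lambda>x q p. f x p q) g y (w y) p"
      by (simp add: E_minus_def E_plus_def)
    have "0 \<le> (SUP (fb, gb) \<in> E_minus Q f g y (w y) p. upper_dd G w y fb - ereal gb)"
      using w y p unfolding subsolution_def by blast
    also have "\<dots> \<le> ereal (- ?m - g y * (w y - 1))"
    proof (rule SUP_least)
      fix e assume "e \<in> E_minus Q f g y (w y) p"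
      moreover obtain fb gb where e: "e = (fb, gb)" by fastforce
      ultimately have gb: "gb = g y * (w y - 1)" and fb: "?m \<le> s \<bullet> fb"
        using E_plus_bounds[of Q ?m s "\<lambda>x q p. f x p q" y p fb gb g "w y"] m unfolding E by blast+
      have "ereal (s \<bullet> fb) \<le> lower_dd G (\<lambda>x. - w x) y fb"
        using sub closure_subset by (intro lower_dd_ge_proximal) blast
      then have "ereal ?m \<le> lower_dd G (\<lambda>x. - w x) y fb" using fb by (meson ereal_less_eq(3) order_trans)
      then have "upper_dd G w y fb \<le> ereal (- ?m)"
        unfolding upper_dd_eq_lower_dd by (metis ereal_minus_le_minus uminus_ereal.simps(1))
      then have "upper_dd G w y fb - ereal gb \<le> ereal (- ?m) - ereal gb" by (rule ereal_minus_mono) simp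
      then show "(case e of (fb, gb) \<Rightarrow> upper_dd G w y fb - ereal gb) \<le> ereal (- ?m - g y * (w y - 1))"
        by (simp add: e gb)
    qed
    finally show "?m \<le> g y * (- w y - - 1)" by (simp add: algebra_simps)
  next
    show "lsc_on (closure G) (\<lambda>x. - w x)"
      unfolding lsc_on_def
    proof (intro ballI allI impI)
      fix x k assume x: "x \<in> closure G" and "k < - w x"
      then have "\<forall>\<^sub>F y in at x within closure G. w y < - k"
        using w unfolding subsolution_def usc_on_def by simp
      then show "\<forall>\<^sub>F y in at x within closure G. k < - w y" by eventually_elim simp
    qed
  qed (use ne growth R lipf lipg lam b saddle_swapped open_G B in auto)
  then show thesis by (rule that)
qed

section \<open>Running and terminal costs of a motion\<close>

lemma continuous_on_running_cost:
  assumes "continuous_on {0..} x"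
  shows "continuous_on {0..} (\<lambda>t. g (x t))"
proof -
  have "continuous_on UNIV g"
    using lipg lam by (intro lipschitz_on_continuous_on[of lam] lipschitz_onI) (auto simp: dist_norm)
  then show ?thesis using assms by (rule continuous_on_compose2) auto
qed

lemma running_cost_ge:
  assumes "continuous_on {0..} x" "0 \<le> t"
  shows "b * t \<le> integral {0..t} (\<lambda>t. g (x t))"
proof -
  have "integral {0..t} (\<lambda>_. b) \<le> integral {0..t} (\<lambda>t. g (x t))"
    using b by (intro integral_le integrable_continuous_real
        continuous_on_subset[OF continuous_on_running_cost[OF assms(1)]]) auto
  then show ?thesis using assms(2) by (simp add: mult.commute)
qed

text \<open>The extension is Lipschitz with K independent of \<epsilon>, so at the exit it differs
  from \<sigma> at a boundary point z of M1 by at most \<open>K * \<epsilon>\<close>, and the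
  transform does not increase this. The Lipschitz bound holds off the neighbourhood of M2 only; z
  avoids that neighbourhood because the two sets are at least \<epsilon>0 apart.\<close>

lemma terminal_cost:
  assumes \<epsilon>: "0 < \<epsilon>" "\<epsilon> < \<epsilon>0" and x: "x \<in> closure G" "x \<in> boundary_nbhd M1 \<epsilon> \<union> boundary_nbhd M2 \<epsilon>"
    and n2: "x \<notin> boundary_nbhd M2 \<epsilon>"
  obtains z a h where "z \<in> frontier G" "dist x z \<le> \<epsilon>" "th z = 1 - exp (- a)" "sh \<epsilon> x = ereal h"
    "0 \<le> a" "0 \<le> h" "\<bar>exp (- h) - exp (- a)\<bar> \<le> K * \<epsilon>"
proof -
  obtain z where z: "z \<in> frontier M1" "dist x z \<le> \<epsilon>" using x(2) n2 by (auto simp: boundary_nbhd_iff)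
  obtain a where a: "\<sigma> z = ereal a" "0 \<le> a" "th z = 1 - exp (- a)" using \<sigma>1_real[OF z(1)] .
  obtain h where h: "sh \<epsilon> x = ereal h" "0 \<le> h" using shb[OF \<epsilon> x(1) n2] by (cases "sh \<epsilon> x") auto
  have zG: "z \<in> frontier G" using z by (simp add: frontier_G)
  have "z \<notin> boundary_nbhd M2 \<epsilon>"
  proof
    assume "z \<in> boundary_nbhd M2 \<epsilon>"
    then obtain z' where z': "z' \<in> frontier M2" "dist z z' \<le> \<epsilon>" by (auto simp: boundary_nbhd_iff)
    then have "\<epsilon>0 \<le> dist z z'" using z(1) closed frontier_subset_closed by (intro sep) blast+
    then show False using z' \<epsilon> by simp
  qed
  then have "dist (real_of_ereal (sh \<epsilon> x)) (real_of_ereal (sh \<epsilon> z)) \<le> K * dist x z"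
    using zG x(1) n2 by (intro lipschitz_onD[OF shlip[OF \<epsilon>]]) (auto simp: frontier_def)
  then have "\<bar>h - a\<bar> \<le> K * dist x z" using sh1[OF \<epsilon> z(1)] a h by (simp add: dist_real_def)
  also have "\<dots> \<le> K * \<epsilon>" using z K by (intro mult_left_mono) auto
  finally have "\<bar>exp (- h) - exp (- a)\<bar> \<le> K * \<epsilon>" using abs_exp_minus_diff_le[OF a(2) h(2)] by linarith
  then show thesis using that zG z(2) a h by blast
qed

lemma terminal_cost_nonneg: "0 < \<epsilon> \<Longrightarrow> \<epsilon> < \<epsilon>0 \<Longrightarrow> x \<in> closure G \<Longrightarrow> 0 \<le> sh \<epsilon> x"
  using shb[of \<epsilon> x] sh2[of \<epsilon> x] by (cases "x \<in> boundary_nbhd M2 \<epsilon>") auto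

lemma payoff_nonneg:
  assumes \<epsilon>: "0 < \<epsilon>" "\<epsilon> < \<epsilon>0" and x: "continuous_on {0..} x" "x 0 \<in> G"
  shows "0 \<le> payoff M1 M2 g sh \<epsilon> x"
proof (cases "exit_time M1 M2 \<epsilon> x = \<infinity>")
  case False
  obtain \<tau> where \<tau>: "0 \<le> \<tau>" "exit_time M1 M2 \<epsilon> x = ereal \<tau>" using exit_time_attained[OF x(1) False] .
  have "x \<tau> \<in> closure G" using before_exit_time(2)[OF closed positive_distance \<epsilon>(1) x] \<tau> by simp
  then have "0 \<le> sh \<epsilon> (x \<tau>)" by (rule terminal_cost_nonneg[OF \<epsilon>])
  moreover have "0 \<le> b * \<tau>" using b \<tau> by simp
  then have "0 \<le> integral {0..\<tau>} (\<lambda>t. g (x t))" using running_cost_ge[OF x(1) \<tau>(1)] by linarith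
  ultimately show ?thesis by (simp add: payoff_def \<tau>)
qed (simp add: payoff_def)


section \<open>Bounds for the guaranteed results\<close>

lemma discount_horizon:
  fixes C k :: real
  assumes "0 < C" "0 < k"
  obtains T where "0 \<le> T" "C \<le> k * exp (b * T)"
proof
  define T where "T = max 0 (ln (C / k) / b)"
  show "0 \<le> T" by (simp add: T_def)
  have "ln (C / k) / b * b \<le> T * b" using b by (intro mult_right_mono) (auto simp: T_def)
  then have "ln (C / k) \<le> b * T" using b by (simp add: mult.commute)
  then have "C / k \<le> exp (b * T)" using assms by (metis divide_pos_pos exp_le_cancel_iff exp_ln)
  then show "C \<le> k * exp (b * T)" using assms by (simp add: pos_divide_le_eq mult.commute)
qed

lemma discount_le:
  assumes "continuous_on {0..} x" "0 \<le> t"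
  shows "exp (- integral {0..t} (\<lambda>t. g (x t))) \<le> exp (- (b * t))" "exp (- integral {0..t} (\<lambda>t. g (x t))) \<le> 1"
proof -
  have "0 \<le> b * t" using b assms by simp
  then show "exp (- integral {0..t} (\<lambda>t. g (x t))) \<le> exp (- (b * t))" "exp (- integral {0..t} (\<lambda>t. g (x t))) \<le> 1"
    using running_cost_ge[OF assms] by auto
qed

text \<open>On the scale of \<open>exp (- payoff)\<close> the claim reads
  \<open>1 - c \<le> exp (- payoff)\<close>, which is what the discounted bound on
  \<open>v - 1\<close> yields at the exit.\<close>

lemma guarantee1_le:
  assumes v: "supersolution P Q f g G th v" and x0: "x0 \<in> G" and c: "v x0 < c" "c < 1"
  obtains \<epsilon>1 where "0 < \<epsilon>1"
    "\<And>\<epsilon>. 0 < \<epsilon> \<Longrightarrow> \<epsilon> < \<epsilon>1 \<Longrightarrow> guarantee1 P Q f g M1 M2 sh \<epsilon> x0 \<le> ereal (- ln (1 - c))"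
proof -
  obtain B where "aiming P Q f g G v R lam b 1 B" using supersolution_aiming[OF v] .
  then interpret aiming P Q f g G v R lam b 1 B .
  have x0c: "x0 \<in> closure G" using x0 closure_subset by blast
  have B: "0 \<le> B" using bnd[OF x0c] by simp
  have vth: "v z = th z" if "z \<in> frontier G" for z using v that by (simp add: supersolution_def)
  have cont: "continuous_on (frontier G) v"
    using continuous_on_th by (rule continuous_on_eq) (simp add: vth)
  \<comment> \<open>Half of the gap goes to the aiming error; the other half remains as
    \<open>- \<zeta>\<close> and covers the error \<open>K * \<epsilon>\<close> of the extended
    terminal payoff.\<close>
  define \<zeta> where "\<zeta> = (c - v x0) / 2"
  have \<zeta>: "0 < \<zeta>" "v x0 - 1 + \<zeta> = c - 1 - \<zeta>" using c by (auto simp: \<zeta>_def field_simps)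
  obtain T where T: "0 \<le> T" "B + 2 \<le> (1 - c) * exp (b * T)"
    using discount_horizon[of "B + 2" "1 - c"] B c by auto
  obtain \<epsilon>s where \<epsilon>s: "0 < \<epsilon>s" and strat: "\<And>\<epsilon>. 0 < \<epsilon> \<Longrightarrow> \<epsilon> < \<epsilon>s \<Longrightarrow> \<exists>U \<mu>. exit_bound \<epsilon> T x0 (v x0 - 1 + \<zeta>) U \<mu>"
    using exit_strategy[OF cont \<zeta>(1) T(1) x0c] by blast
  show thesis
  proof (rule that[of "min \<epsilon>s (min \<epsilon>0 (\<zeta> / (K + 1)))"])
    show "0 < min \<epsilon>s (min \<epsilon>0 (\<zeta> / (K + 1)))" using \<epsilon>s \<epsilon>0 \<zeta> K by simp
    fix \<epsilon> assume \<epsilon>': "0 < \<epsilon>" "\<epsilon> < min \<epsilon>s (min \<epsilon>0 (\<zeta> / (K + 1)))"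
    then have \<epsilon>: "0 < \<epsilon>" "\<epsilon> < \<epsilon>0" "\<epsilon> < \<epsilon>s" by auto
    have "\<epsilon> * (K + 1) \<le> \<zeta>" using \<epsilon>' K by (simp flip: pos_le_divide_eq)
    then have K\<epsilon>: "K * \<epsilon> \<le> \<zeta>" using K \<epsilon> by (simp add: algebra_simps)
    obtain U \<mu> where eb: "exit_bound \<epsilon> T x0 (v x0 - 1 + \<zeta>) U \<mu>"
      using strat[OF \<epsilon>(1,3)] by blast
    then have U: "U \<in> UNIV \<rightarrow> P" "0 < \<mu>" by (auto simp: exit_bound_def)
    note res = exit_boundD[OF eb]
    have pay: "payoff M1 M2 g sh \<epsilon> x \<le> ereal (- ln (1 - c))"
      if part: "is_partition \<Delta>" "\<forall>i. \<Delta> (Suc i) - \<Delta> i < \<mu>" and x: "x \<in> motions1 Q f x0 U \<Delta>" for \<Delta> x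
    proof -
      have xc: "continuous_on {0..} x" and xx0: "x 0 \<in> G" using x x0 by (auto simp: motions1_def)
      note bef = before_exit_time[OF closed positive_distance \<epsilon>(1) xc xx0]
      define k where "k t = exp (- integral {0..t} (\<lambda>t. g (x t)))" for t
      have res': "(- B - 1) * k s \<le> c - 1 - \<zeta>"
          "\<And>z. z \<in> frontier G \<Longrightarrow> dist (x s) z \<le> \<epsilon> \<Longrightarrow> (v z - 1) * k s \<le> c - 1 - \<zeta>"
        if s: "0 \<le> s" "s \<le> T" "ereal s \<le> exit_time M1 M2 \<epsilon> x" for s
        using res[OF part x s(1,2) bef[OF s(1,3)]] unfolding \<zeta>(2) k_def by blast+
      \<comment> \<open>Survival up to T contradicts the estimate: it demands a discounted deficit
        of at least \<open>1 - c + \<zeta>\<close>, whereas T was chosen so that the discount leaves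
        at most \<open>1 - c\<close>.\<close>
      have "\<not> ereal T \<le> exit_time M1 M2 \<epsilon> x"
      proof
        assume "ereal T \<le> exit_time M1 M2 \<epsilon> x"
        then have 1: "1 - c + \<zeta> \<le> (B + 1) * k T" using res'(1)[OF T(1) order_refl] by (simp add: algebra_simps)
        have "(B + 1) * k T \<le> (B + 2) * exp (- (b * T))"
          using discount_le(1)[OF xc T(1)] B by (intro mult_mono) (auto simp: k_def)
        also have "\<dots> \<le> ((1 - c) * exp (b * T)) * exp (- (b * T))" using T(2) by (intro mult_right_mono) auto
        also have "\<dots> = 1 - c" by (simp add: exp_minus)
        finally show False using 1 \<zeta> by simp
      qed
      then have fin: "exit_time M1 M2 \<epsilon> x \<noteq> \<infinity>" by auto
      obtain \<tau> where \<tau>: "0 \<le> \<tau>" "exit_time M1 M2 \<epsilon> x = ereal \<tau>"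
        and hit: "x \<tau> \<in> boundary_nbhd M1 \<epsilon> \<union> boundary_nbhd M2 \<epsilon>" using exit_time_attained[OF xc fin] .
      have \<tau>T: "\<tau> \<le> T" using \<open>\<not> ereal T \<le> exit_time M1 M2 \<epsilon> x\<close> \<tau> by simp
      have zb: "(th z - 1) * k \<tau> \<le> c - 1 - \<zeta>" if "z \<in> frontier G" "dist (x \<tau>) z \<le> \<epsilon>" for z
        using res'(2)[OF \<tau>(1) \<tau>T _ that] vth[OF that(1)] \<tau>(2) by simp
      \<comment> \<open>Near M2 the boundary value is 1, and the bound would read
        \<open>0 \<le> c - 1 - \<zeta>\<close>.\<close>
      have n2: "x \<tau> \<notin> boundary_nbhd M2 \<epsilon>"
      proof
        assume "x \<tau> \<in> boundary_nbhd M2 \<epsilon>"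
        then obtain z where "z \<in> frontier M2" "dist (x \<tau>) z \<le> \<epsilon>" by (auto simp: boundary_nbhd_iff)
        then show False using zb[of z] th2[of z] frontier_G c \<zeta> by simp
      qed
      have xcl: "x \<tau> \<in> closure G" using bef(2)[OF \<tau>(1)] \<tau>(2) by simp
      obtain z a h where z: "z \<in> frontier G" "dist (x \<tau>) z \<le> \<epsilon>" "th z = 1 - exp (- a)"
        and h: "sh \<epsilon> (x \<tau>) = ereal h" "\<bar>exp (- h) - exp (- a)\<bar> \<le> K * \<epsilon>"
        using terminal_cost[OF \<epsilon>(1,2) xcl hit n2] by metis
      have k1: "0 < k \<tau>" "k \<tau> \<le> 1" using discount_le(2)[OF xc \<tau>(1)] by (auto simp: k_def)
      have "1 - c + \<zeta> \<le> exp (- a) * k \<tau>" using zb[OF z(1,2)] z(3) by simp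
      moreover have "(exp (- a) - exp (- h)) * k \<tau> \<le> \<zeta> * 1"
        using h(2) K\<epsilon> k1 \<zeta> by (intro mult_mono) auto
      ultimately have "1 - c \<le> exp (- h) * k \<tau>" by (simp add: algebra_simps)
      also have "\<dots> = exp (- (h + integral {0..\<tau>} (\<lambda>t. g (x t))))" by (simp add: k_def flip: exp_add)
      finally have "exp (ln (1 - c)) \<le> exp (- (h + integral {0..\<tau>} (\<lambda>t. g (x t))))" using c by simp
      then have "h + integral {0..\<tau>} (\<lambda>t. g (x t)) \<le> - ln (1 - c)" by simp
      then show ?thesis using \<tau>(2) h(1) by (simp add: payoff_def add.commute)
    qed
    have "Limsup fine_partitions (\<lambda>\<Delta>. SUP x \<in> motions1 Q f x0 U \<Delta>. payoff M1 M2 g sh \<epsilon> x) \<le> ereal (- ln (1 - c))"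
    proof (rule Limsup_bounded)
      show "\<forall>\<^sub>F \<Delta> in fine_partitions. (SUP x \<in> motions1 Q f x0 U \<Delta>. payoff M1 M2 g sh \<epsilon> x) \<le> ereal (- ln (1 - c))"
        using eventually_fine_partitions[OF U(2)] by eventually_elim (auto intro!: SUP_least pay)
    qed
    then show "guarantee1 P Q f g M1 M2 sh \<epsilon> x0 \<le> ereal (- ln (1 - c))"
      unfolding guarantee1_def by (rule INF_lower2[OF U(1)])
  qed
qed

text \<open>Motions that never exit, exit after T or exit near M2 are expensive without any aiming;
  the strategy matters only for an early exit near M1.\<close>

lemma guarantee2_ge:
  assumes w: "subsolution P Q f g G th w" and x0: "x0 \<in> G" and c: "c < w x0" "c < 1"
  obtains \<epsilon>1 where "0 < \<epsilon>1"
    "\<And>\<epsilon>. 0 < \<epsilon> \<Longrightarrow> \<epsilon> < \<epsilon>1 \<Longrightarrow> ereal (- ln (1 - c)) \<le> guarantee2 P Q f g M1 M2 sh \<epsilon> x0"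
proof -
  obtain B where "aiming Q P (\<lambda>x q p. f x p q) g G (\<lambda>x. - w x) R lam b (- 1) B" using subsolution_aiming[OF w] .
  then interpret aiming Q P "\<lambda>x q p. f x p q" g G "\<lambda>x. - w x" R lam b "- 1" B .
  have x0c: "x0 \<in> closure G" using x0 closure_subset by blast
  have wth: "w z = th z" if "z \<in> frontier G" for z using w that by (simp add: subsolution_def)
  have cont: "continuous_on (frontier G) (\<lambda>x. - w x)"
    using continuous_on_minus[OF continuous_on_th] by (rule continuous_on_eq) (simp add: wth)
  define \<zeta> where "\<zeta> = (w x0 - c) / 2"
  have \<zeta>: "0 < \<zeta>" "- w x0 - - 1 + \<zeta> = 1 - c - \<zeta>" using c by (auto simp: \<zeta>_def field_simps)
  \<comment> \<open>From this time on the running cost alone, at least \<open>b * T\<close>, reaches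
    the level \<open>- ln (1 - c)\<close>.\<close>
  define T where "T = max 0 (- ln (1 - c) / b)"
  have T: "0 \<le> T" by (simp add: T_def)
  have "- ln (1 - c) / b * b \<le> T * b" using b by (intro mult_right_mono) (auto simp: T_def)
  then have bT: "- ln (1 - c) \<le> b * T" using b by (simp add: mult.commute)
  obtain \<epsilon>s where \<epsilon>s: "0 < \<epsilon>s" and strat: "\<And>\<epsilon>. 0 < \<epsilon> \<Longrightarrow> \<epsilon> < \<epsilon>s \<Longrightarrow> \<exists>U \<mu>. exit_bound \<epsilon> T x0 (- w x0 - - 1 + \<zeta>) U \<mu>"
    using exit_strategy[OF cont \<zeta>(1) T x0c] by blast
  show thesis
  proof (rule that[of "min \<epsilon>s (min \<epsilon>0 (\<zeta> / (K + 1)))"])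
    show "0 < min \<epsilon>s (min \<epsilon>0 (\<zeta> / (K + 1)))" using \<epsilon>s \<epsilon>0 \<zeta> K by simp
    fix \<epsilon> assume \<epsilon>': "0 < \<epsilon>" "\<epsilon> < min \<epsilon>s (min \<epsilon>0 (\<zeta> / (K + 1)))"
    then have \<epsilon>: "0 < \<epsilon>" "\<epsilon> < \<epsilon>0" "\<epsilon> < \<epsilon>s" by auto
    have "\<epsilon> * (K + 1) \<le> \<zeta>" using \<epsilon>' K by (simp flip: pos_le_divide_eq)
    then have K\<epsilon>: "K * \<epsilon> \<le> \<zeta>" using K \<epsilon> by (simp add: algebra_simps)
    obtain U \<mu> where eb: "exit_bound \<epsilon> T x0 (- w x0 - - 1 + \<zeta>) U \<mu>"
      using strat[OF \<epsilon>(1,3)] by blast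
    then have U: "U \<in> UNIV \<rightarrow> Q" "0 < \<mu>" by (auto simp: exit_bound_def)
    note res = exit_boundD[OF eb]
    have pay: "ereal (- ln (1 - c)) \<le> payoff M1 M2 g sh \<epsilon> x"
      if part: "is_partition \<Delta>" "\<forall>i. \<Delta> (Suc i) - \<Delta> i < \<mu>"
        and x: "x \<in> motions1 P (\<lambda>x q p. f x p q) x0 U \<Delta>" for \<Delta> x
    proof (cases "exit_time M1 M2 \<epsilon> x = \<infinity>")
      case False
      have xc: "continuous_on {0..} x" and xx0: "x 0 \<in> G" using x x0 by (auto simp: motions1_def)
      note bef = before_exit_time[OF closed positive_distance \<epsilon>(1) xc xx0]
      obtain \<tau> where \<tau>: "0 \<le> \<tau>" "exit_time M1 M2 \<epsilon> x = ereal \<tau>"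
        and hit: "x \<tau> \<in> boundary_nbhd M1 \<epsilon> \<union> boundary_nbhd M2 \<epsilon>" using exit_time_attained[OF xc False] .
      define I where "I = integral {0..\<tau>} (\<lambda>t. g (x t))"
      have xcl: "x \<tau> \<in> closure G" using bef(2)[OF \<tau>(1)] \<tau>(2) by simp
      have po: "payoff M1 M2 g sh \<epsilon> x = ereal I + sh \<epsilon> (x \<tau>)" by (simp add: payoff_def \<tau>(2) I_def)
      have sh0: "0 \<le> sh \<epsilon> (x \<tau>)" by (rule terminal_cost_nonneg[OF \<epsilon>(1,2) xcl])
      show ?thesis
      proof (cases "T \<le> \<tau> \<or> x \<tau> \<in> boundary_nbhd M2 \<epsilon>")
        case True
        then show ?thesis
        proof
          assume "T \<le> \<tau>"
          then have "b * T \<le> b * \<tau>" using b by (intro mult_left_mono) auto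
          then have "- ln (1 - c) \<le> I" using bT running_cost_ge[OF xc \<tau>(1)] by (simp add: I_def)
          then have "ereal (- ln (1 - c)) + 0 \<le> ereal I + sh \<epsilon> (x \<tau>)" using sh0 by (intro add_mono) auto
          then show ?thesis by (simp add: po)
        next
          assume "x \<tau> \<in> boundary_nbhd M2 \<epsilon>"
          then show ?thesis using sh2[OF \<epsilon>(1,2) xcl] by (simp add: po)
        qed
      next
        case n: False
        obtain z a h where z: "z \<in> frontier G" "dist (x \<tau>) z \<le> \<epsilon>" "th z = 1 - exp (- a)"
          and h: "sh \<epsilon> (x \<tau>) = ereal h" "\<bar>exp (- h) - exp (- a)\<bar> \<le> K * \<epsilon>"
          using terminal_cost[OF \<epsilon>(1,2) xcl hit] n by metis
        have "(- w z - - 1) * exp (- I) \<le> - w x0 - - 1 + \<zeta>"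
          unfolding I_def using n \<tau>(2) by (intro res(2)[OF part x \<tau>(1) _ bef[OF \<tau>(1)] z(1,2)]) auto
        then have "exp (- a) * exp (- I) \<le> 1 - c - \<zeta>" using \<zeta>(2) wth[OF z(1)] z(3) by simp
        moreover have "(exp (- h) - exp (- a)) * exp (- I) \<le> \<zeta> * 1"
          using h(2) K\<epsilon> discount_le(2)[OF xc \<tau>(1)] \<zeta> by (intro mult_mono) (auto simp: I_def)
        ultimately have "exp (- h) * exp (- I) \<le> 1 - c" by (simp add: algebra_simps)
        then have "exp (- (h + I)) \<le> exp (ln (1 - c))" using c by (simp flip: exp_add)
        then have "- ln (1 - c) \<le> I + h" by simp
        then show ?thesis by (simp add: po h(1))
      qed
    qed (simp add: payoff_def)
    have "ereal (- ln (1 - c)) \<le> Liminf fine_partitions (\<lambda>\<Delta>. INF x \<in> motions2 P f x0 U \<Delta>. payoff M1 M2 g sh \<epsilon> x)"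
    proof (rule Liminf_bounded)
      show "\<forall>\<^sub>F \<Delta> in fine_partitions. ereal (- ln (1 - c)) \<le> (INF x \<in> motions2 P f x0 U \<Delta>. payoff M1 M2 g sh \<epsilon> x)"
        using eventually_fine_partitions[OF U(2)]
        by eventually_elim (auto intro!: INF_greatest pay simp: motions2_eq_motions1)
    qed
    then show "ereal (- ln (1 - c)) \<le> guarantee2 P Q f g M1 M2 sh \<epsilon> x0"
      unfolding guarantee2_def by (rule SUP_upper2[OF U(1)])
  qed
qed

text \<open>If w exceeded 1 at x0, the second player's aiming strategy would preserve a discounted
  excess of at least \<zeta>. Boundary values are at most 1, so the motion cannot exit before T, and
  w is bounded, so the excess cannot last up to T. This keeps u within the range of the
  transform.\<close>

lemma subsolution_le_1:
  assumes w: "subsolution P Q f g G th w" and x0: "x0 \<in> G"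
  shows "w x0 \<le> 1"
proof (rule ccontr)
  assume "\<not> w x0 \<le> 1"
  obtain B where "aiming Q P (\<lambda>x q p. f x p q) g G (\<lambda>x. - w x) R lam b (- 1) B" using subsolution_aiming[OF w] .
  then interpret aiming Q P "\<lambda>x q p. f x p q" g G "\<lambda>x. - w x" R lam b "- 1" B .
  have x0c: "x0 \<in> closure G" using x0 closure_subset by blast
  have B: "0 \<le> B" using bnd[OF x0c] by simp
  have wth: "w z = th z" if "z \<in> frontier G" for z using w that by (simp add: subsolution_def)
  have cont: "continuous_on (frontier G) (\<lambda>x. - w x)"
    using continuous_on_minus[OF continuous_on_th] by (rule continuous_on_eq) (simp add: wth)
  define \<zeta> where "\<zeta> = (w x0 - 1) / 2"
  have \<zeta>: "0 < \<zeta>" "- w x0 - - 1 + \<zeta> = - \<zeta>" using \<open>\<not> w x0 \<le> 1\<close> by (auto simp: \<zeta>_def field_simps)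
  obtain T where T: "0 \<le> T" "B + 1 \<le> \<zeta> * exp (b * T)"
    using discount_horizon[of "B + 1" \<zeta>] B \<zeta> by auto
  obtain \<epsilon>s where "0 < \<epsilon>s" and "\<And>\<epsilon>. 0 < \<epsilon> \<Longrightarrow> \<epsilon> < \<epsilon>s \<Longrightarrow> \<exists>U \<mu>. exit_bound \<epsilon> T x0 (- w x0 - - 1 + \<zeta>) U \<mu>"
    using exit_strategy[OF cont \<zeta>(1) T(1) x0c] by blast
  then have "\<exists>U \<mu>. exit_bound (\<epsilon>s / 2) T x0 (- w x0 - - 1 + \<zeta>) U \<mu>" by simp
  then obtain \<epsilon> U \<mu> where \<epsilon>: "0 < \<epsilon>" and eb: "exit_bound \<epsilon> T x0 (- w x0 - - 1 + \<zeta>) U \<mu>"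
    using \<open>0 < \<epsilon>s\<close> half_gt_zero by blast
  then have U: "U \<in> UNIV \<rightarrow> Q" "0 < \<mu>" by (auto simp: exit_bound_def)
  note res = exit_boundD[OF eb]
  obtain \<Delta> where part: "is_partition \<Delta>" "\<forall>i. \<Delta> (Suc i) - \<Delta> i < \<mu>"
    using eventually_happens'[OF fine_partitions_neq_bot eventually_fine_partitions[OF U(2)]] by blast
  \<comment> \<open>One motion suffices for the contradiction, so the first player may use a
    constant control.\<close>
  obtain p0 where "p0 \<in> P" using ne by blast
  then have p0: "(\<lambda>_. p0) \<in> UNIV \<rightarrow> P" by simp
  obtain x where "x \<in> motions2 P f x0 U \<Delta>"
    using exists_common_motion[where f = f and L = lam and ?x0.0 = x0, OF part(1) p0 U(1) lipf] by blast
  then have x: "x \<in> motions1 P (\<lambda>x q p. f x p q) x0 U \<Delta>" by (simp add: motions2_eq_motions1)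
  have xc: "continuous_on {0..} x" and xx0: "x 0 \<in> G" using x x0 by (auto simp: motions1_def)
  note bef = before_exit_time[OF closed positive_distance \<epsilon> xc xx0]
  define k where "k t = exp (- integral {0..t} (\<lambda>t. g (x t)))" for t
  have res': "(- B + 1) * k s \<le> - \<zeta>"
      "\<And>z. z \<in> frontier G \<Longrightarrow> dist (x s) z \<le> \<epsilon> \<Longrightarrow> (1 - w z) * k s \<le> - \<zeta>"
    if s: "0 \<le> s" "s \<le> T" "ereal s \<le> exit_time M1 M2 \<epsilon> x" for s
    using res[OF part x s(1,2) bef[OF s(1,3)]] unfolding \<zeta>(2) k_def by simp_all
  have "\<not> ereal T \<le> exit_time M1 M2 \<epsilon> x"
  proof
    assume "ereal T \<le> exit_time M1 M2 \<epsilon> x"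
    then have 1: "\<zeta> \<le> (B - 1) * k T" using res'(1)[OF T(1) order_refl] by (simp add: algebra_simps)
    have "(B - 1) * k T < (B + 1) * k T" by (simp add: k_def)
    also have "\<dots> \<le> (B + 1) * exp (- (b * T))"
      using discount_le(1)[OF xc T(1)] B by (intro mult_left_mono) (auto simp: k_def)
    also have "\<dots> \<le> (\<zeta> * exp (b * T)) * exp (- (b * T))" using T(2) by (intro mult_right_mono) auto
    also have "\<dots> = \<zeta>" by (simp add: exp_minus)
    finally show False using 1 by simp
  qed
  then have fin: "exit_time M1 M2 \<epsilon> x \<noteq> \<infinity>" by auto
  obtain \<tau> where \<tau>: "0 \<le> \<tau>" "exit_time M1 M2 \<epsilon> x = ereal \<tau>"
    and hit: "x \<tau> \<in> boundary_nbhd M1 \<epsilon> \<union> boundary_nbhd M2 \<epsilon>" using exit_time_attained[OF xc fin] .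
  have \<tau>T: "\<tau> \<le> T" using \<open>\<not> ereal T \<le> exit_time M1 M2 \<epsilon> x\<close> \<tau> by simp
  obtain z where z: "z \<in> frontier G" "dist (x \<tau>) z \<le> \<epsilon>"
    using hit unfolding frontier_G by (auto simp: boundary_nbhd_iff)
  have "(1 - w z) * k \<tau> \<le> - \<zeta>" using res'(2)[OF \<tau>(1) \<tau>T _ z] \<tau>(2) by simp
  moreover have "0 \<le> (1 - w z) * k \<tau>" using th_le_1[OF z(1)] wth[OF z(1)] by (simp add: k_def)
  ultimately show False using \<zeta> by simp
qed

lemma guarantee2_le_guarantee1: "guarantee2 P Q f g M1 M2 sh \<epsilon> x0 \<le> guarantee1 P Q f g M1 M2 sh \<epsilon> x0"
  unfolding guarantee1_def guarantee2_def
proof (intro SUP_least INF_greatest)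
  fix U :: "real ^ 'd \<Rightarrow> 'p" and V :: "real ^ 'd \<Rightarrow> 'q"
  assume V: "V \<in> UNIV \<rightarrow> Q" and U: "U \<in> UNIV \<rightarrow> P"
  let ?I = "\<lambda>\<Delta>. INF x \<in> motions2 P f x0 V \<Delta>. payoff M1 M2 g sh \<epsilon> x"
  let ?S = "\<lambda>\<Delta>. SUP x \<in> motions1 Q f x0 U \<Delta>. payoff M1 M2 g sh \<epsilon> x"
  have "\<forall>\<^sub>F \<Delta> in fine_partitions. ?I \<Delta> \<le> ?S \<Delta>"
    using eventually_fine_partitions[of 1, simplified]
  proof eventually_elim
    case (elim \<Delta>)
    obtain x where "x \<in> motions1 Q f x0 U \<Delta>" "x \<in> motions2 P f x0 V \<Delta>"
      using exists_common_motion[where f = f and L = lam and ?x0.0 = x0, OF conjunct1[OF elim] U V lipf] by blast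
    then show ?case by (meson INF_lower SUP_upper order_trans)
  qed
  then have "Liminf fine_partitions ?I \<le> Liminf fine_partitions ?S" by (rule Liminf_mono)
  also have "\<dots> \<le> Limsup fine_partitions ?S" by (rule Liminf_le_Limsup[OF fine_partitions_neq_bot])
  finally show "Liminf fine_partitions ?I \<le> Limsup fine_partitions ?S" .
qed

lemma guarantee2_nonneg:
  assumes \<epsilon>: "0 < \<epsilon>" "\<epsilon> < \<epsilon>0" and x0: "x0 \<in> G"
  shows "0 \<le> guarantee2 P Q f g M1 M2 sh \<epsilon> x0"
proof -
  obtain q0 where "q0 \<in> Q" using ne by blast
  then have V: "(\<lambda>_. q0) \<in> UNIV \<rightarrow> Q" by simp
  have "0 \<le> Liminf fine_partitions (\<lambda>\<Delta>. INF x \<in> motions2 P f x0 (\<lambda>_. q0) \<Delta>. payoff M1 M2 g sh \<epsilon> x)"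
    using payoff_nonneg[OF \<epsilon>] x0 by (intro Liminf_bounded always_eventually allI INF_greatest) (auto simp: motions2_def)
  then show ?thesis unfolding guarantee2_def by (rule SUP_upper2[OF V])
qed

text \<open>At a fixed x0 a single member of each approximating sequence, close enough to
  \<open>u x0\<close>, gives the bound for a given c; the rate of convergence and its dependence on
  x0 do not matter.\<close>

theorem minimax_solution_value:
  assumes u: "minimax_solution P Q f g G th u" and x0: "x0 \<in> G"
  shows "is_game_value P Q f g M1 M2 sh x0 (limit_guarantee1 P Q f g M1 M2 sh x0)"
    and "u x0 = kruzhkov (limit_guarantee1 P Q f g M1 M2 sh x0)"
proof -
  let ?J1 = "limit_guarantee1 P Q f g M1 M2 sh x0" and ?J2 = "limit_guarantee2 P Q f g M1 M2 sh x0"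
  obtain v w where v: "\<And>k::nat. supersolution P Q f g G th (v k)" and w: "\<And>k::nat. subsolution P Q f g G th (w k)"
    and lim: "\<And>x. x \<in> closure G \<Longrightarrow> (\<lambda>k. v k x) \<longlonglongrightarrow> u x" "\<And>x. x \<in> closure G \<Longrightarrow> (\<lambda>k. w k x) \<longlonglongrightarrow> u x"
    using u unfolding minimax_solution_def by blast
  have x0c: "x0 \<in> closure G" using x0 closure_subset by blast
  have ev: "\<forall>\<^sub>F \<epsilon> in at_right (0::real). 0 < \<epsilon> \<and> \<epsilon> < r" if "0 < r" for r
    using that by (auto simp: eventually_at_right_field)
  have up: "?J1 \<le> ereal (- ln (1 - c))" if c: "u x0 < c" "c < 1" for c
  proof -
    have "\<forall>\<^sub>F k in sequentially. v k x0 < c" using order_tendstoD(2)[OF lim(1)[OF x0c] c(1)] .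
    then obtain k where "v k x0 < c" by (meson eventually_happens' sequentially_bot)
    then obtain \<epsilon>1 where "0 < \<epsilon>1"
      "\<And>\<epsilon>. 0 < \<epsilon> \<Longrightarrow> \<epsilon> < \<epsilon>1 \<Longrightarrow> guarantee1 P Q f g M1 M2 sh \<epsilon> x0 \<le> ereal (- ln (1 - c))"
      using guarantee1_le[OF v x0 _ c(2)] by metis
    then show ?thesis unfolding limit_guarantee1_def
      by (intro Limsup_bounded eventually_mono[OF ev]) auto
  qed
  have lo: "ereal (- ln (1 - c)) \<le> ?J2" if c: "c < u x0" "c < 1" for c
  proof -
    have "\<forall>\<^sub>F k in sequentially. c < w k x0" using order_tendstoD(1)[OF lim(2)[OF x0c] c(1)] .
    then obtain k where "c < w k x0" by (meson eventually_happens' sequentially_bot)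
    then obtain \<epsilon>1 where "0 < \<epsilon>1"
      "\<And>\<epsilon>. 0 < \<epsilon> \<Longrightarrow> \<epsilon> < \<epsilon>1 \<Longrightarrow> ereal (- ln (1 - c)) \<le> guarantee2 P Q f g M1 M2 sh \<epsilon> x0"
      using guarantee2_ge[OF w x0 _ c(2)] by metis
    then show ?thesis unfolding limit_guarantee2_def
      by (intro Liminf_bounded eventually_mono[OF ev]) auto
  qed
  have J0: "0 \<le> ?J2" unfolding limit_guarantee2_def
    by (intro Liminf_bounded eventually_mono[OF ev[OF \<epsilon>0]]) (auto intro: guarantee2_nonneg[OF _ _ x0])
  have J21: "?J2 \<le> ?J1"
  proof -
    have "?J2 \<le> Liminf (at_right 0) (\<lambda>\<epsilon>. guarantee1 P Q f g M1 M2 sh \<epsilon> x0)"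
      unfolding limit_guarantee2_def by (intro Liminf_mono always_eventually allI guarantee2_le_guarantee1)
    also have "\<dots> \<le> ?J1" unfolding limit_guarantee1_def by (rule Liminf_le_Limsup) simp
    finally show ?thesis .
  qed
  have u1: "u x0 \<le> 1"
    using subsolution_le_1[OF w x0] by (intro LIMSEQ_le_const2[OF lim(2)[OF x0c]]) auto
  have "?J1 = ?J2 \<and> u x0 = kruzhkov ?J1"
  proof (cases "u x0 = 1")
    case True
    \<comment> \<open>No c fits between \<open>u x0 = 1\<close> and 1, so there is no upper bound;
      the lower bound with c tending to 1 makes both guarantees infinite, the first one because it
      dominates the second.\<close>
    have "ereal r \<le> ?J2" for r
      using lo[of "1 - exp (- r)"] True by simp
    then have "?J2 = \<infinity>" by (metis PInfty_neq_ereal(1) ereal_top)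
    then show ?thesis using J21 True by (simp add: kruzhkov_def)
  next
    case False
    then have u1: "u x0 < 1" using u1 by simp
    define N where "N = - ln (1 - u x0)"
    \<comment> \<open>Below 1 the map \<open>c \<mapsto> - ln (1 - c)\<close> is continuous, so
      approaching \<open>u x0\<close> from the right and from the left closes the gap between the
      two bounds.\<close>
    have tl: "((\<lambda>c. ereal (- ln (1 - c))) \<longlongrightarrow> ereal N) (at (u x0))"
      unfolding N_def using u1 by (auto intro!: tendsto_eq_intros)
    have "?J1 \<le> ereal N"
    proof (rule tendsto_lowerbound)
      show "((\<lambda>c. ereal (- ln (1 - c))) \<longlongrightarrow> ereal N) (at_right (u x0))"
        using tl by (simp add: filterlim_at_split)
      have "\<forall>\<^sub>F c in at_right (u x0). u x0 < c \<and> c < 1" using u1 by (auto simp: eventually_at_right)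
      then show "\<forall>\<^sub>F c in at_right (u x0). ?J1 \<le> ereal (- ln (1 - c))" by eventually_elim (rule up, auto)
    qed simp
    moreover have "ereal N \<le> ?J2"
    proof (rule tendsto_upperbound)
      show "((\<lambda>c. ereal (- ln (1 - c))) \<longlongrightarrow> ereal N) (at_left (u x0))"
        using tl by (simp add: filterlim_at_split)
      have "\<forall>\<^sub>F c in at_left (u x0). c < u x0" by (auto simp: eventually_at_filter)
      then show "\<forall>\<^sub>F c in at_left (u x0). ereal (- ln (1 - c)) \<le> ?J2" by eventually_elim (rule lo, use u1 in auto)
    qed simp
    ultimately have J: "?J1 = ereal N" "?J2 = ereal N" using J21 by auto
    then show ?thesis using u1 by (simp add: kruzhkov_def N_def)
  qed
  then show "is_game_value P Q f g M1 M2 sh x0 ?J1" "u x0 = kruzhkov ?J1"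
    using J0 by (simp_all add: is_game_value_def)
qed

end

theorem mainTheorem5:
  fixes P :: "'p::metric_space set"
    and Q :: "'q::metric_space set"
    and f :: "real ^ 'd \<Rightarrow> 'p \<Rightarrow> 'q \<Rightarrow> real ^ 'd"
    and g :: "real ^ 'd \<Rightarrow> real"
    and M1 M2 G :: "(real ^ 'd) set"
    and \<sigma> :: "real ^ 'd \<Rightarrow> ereal"
    and sh :: "real \<Rightarrow> real ^ 'd \<Rightarrow> ereal"
    and u :: "real ^ 'd \<Rightarrow> real"
    and \<Sigma> :: real
  assumes P: "compact P" "P \<noteq> {}"
    and Q: "compact Q" "Q \<noteq> {}"
    and M1: "closed M1" "continuous_boundary M1"
    and M2: "closed M2" "continuous_boundary M2"
    and dist_M: "positive_distance M1 M2"
    and G: "G = game_region M1 M2"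
    and A1_cont: "continuous_on (UNIV \<times> P \<times> Q) (\<lambda>(x, p, q). f x p q)" "continuous_on UNIV g"
    and A1_growth: "\<exists>R. \<forall>x. \<forall>p\<in>P. \<forall>q\<in>Q. norm (f x p q) \<le> R * (1 + norm x)"
    and A2: "\<exists>lam. \<forall>x y. \<forall>p\<in>P. \<forall>q\<in>Q.
               norm (f (x + y) p q - f x p q) + \<bar>g (x + y) - g x\<bar> \<le> lam * norm y"
    and A3: "\<forall>s x. (INF p\<in>P. SUP q\<in>Q. s \<bullet> f x p q) = (SUP q\<in>Q. INF p\<in>P. s \<bullet> f x p q)"
    and A4: "\<exists>b>0. \<forall>x. b \<le> g x"
    and A5_bound: "0 < \<Sigma>" "\<forall>x\<in>frontier M1. 0 \<le> \<sigma> x \<and> \<sigma> x \<le> ereal \<Sigma>"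
    and A5_infty: "\<forall>x\<in>frontier M2. \<sigma> x = \<infinity>"
    and A5_lipschitz: "\<exists>L. L-lipschitz_on (frontier M1) (\<lambda>x. real_of_ereal (\<sigma> x))"
    and extension: "sigma_extension M1 M2 \<sigma> \<Sigma> sh"
    and unique_solution: "unique_minimax_solution P Q f g G (\<lambda>x. kruzhkov (\<sigma> x)) u"
  shows "\<exists>Val :: real ^ 'd \<Rightarrow> ereal.
           \<forall>x0\<in>G. is_game_value P Q f g M1 M2 sh x0 (Val x0) \<and> u x0 = kruzhkov (Val x0)"
proof -
  obtain R where R: "\<And>x p q. p \<in> P \<Longrightarrow> q \<in> Q \<Longrightarrow> norm (f x p q) \<le> R * (1 + norm x)"
    using A1_growth by blast
  obtain lam where lam: "\<And>x y p q. p \<in> P \<Longrightarrow> q \<in> Q \<Longrightarrow>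
      norm (f (x + y) p q - f x p q) + \<bar>g (x + y) - g x\<bar> \<le> lam * norm y"
    using A2 by blast
  obtain b where b: "0 < b" "\<And>x. b \<le> g x" using A4 by blast
  obtain L where L: "L-lipschitz_on (frontier M1) (\<lambda>x. real_of_ereal (\<sigma> x))" using A5_lipschitz by blast
  obtain \<delta> where \<delta>: "0 < \<delta>" "\<And>x y. x \<in> M1 \<Longrightarrow> y \<in> M2 \<Longrightarrow> \<delta> \<le> dist x y"
    using dist_M unfolding positive_distance_def by blast
  obtain K \<epsilon>s where \<epsilon>s: "0 < \<epsilon>s" and ext: "\<forall>\<epsilon>. 0 < \<epsilon> \<and> \<epsilon> < \<epsilon>s \<longrightarrow>
      (\<forall>x\<in>frontier M1. sh \<epsilon> x = \<sigma> x) \<and>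
      (\<forall>x\<in>closure (game_region M1 M2) - boundary_nbhd M2 \<epsilon>. 0 \<le> sh \<epsilon> x \<and> sh \<epsilon> x \<le> ereal \<Sigma>) \<and>
      K-lipschitz_on (closure (game_region M1 M2) - boundary_nbhd M2 \<epsilon>) (\<lambda>x. real_of_ereal (sh \<epsilon> x)) \<and>
      (\<forall>x\<in>closure (game_region M1 M2) \<inter> boundary_nbhd M2 \<epsilon>. sh \<epsilon> x = \<infinity>)"
    using extension unfolding sigma_extension_def Let_def by (elim exE conjE)
  \<comment> \<open>Assumption (A2) bounds f and g jointly for given controls; extracting the bound
    for g alone takes one admissible pair.\<close>
  obtain p0 q0 where pq: "p0 \<in> P" "q0 \<in> Q" using P Q by blast
  define lam' where "lam' = max lam 0"
  have lip: "norm (f x p q - f y p q) + \<bar>g x - g y\<bar> \<le> lam' * norm (x - y)" if "p \<in> P" "q \<in> Q" for x y p q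
  proof -
    have "norm (f x p q - f y p q) + \<bar>g x - g y\<bar> \<le> lam * norm (x - y)" using lam[OF that, of y "x - y"] by simp
    also have "\<dots> \<le> lam' * norm (x - y)" by (intro mult_right_mono) (auto simp: lam'_def)
    finally show ?thesis .
  qed
  \<comment> \<open>Taking \<open>min \<epsilon>s \<delta>\<close> secures both roles of
    \<epsilon>0: the extension is controlled below \<open>\<epsilon>s\<close>, and the terminal sets
    are at least \<delta> apart.\<close>
  interpret exit_game P Q f g M1 M2 \<sigma> sh "max R 0" lam' b L K "min \<epsilon>s \<delta>"
  proof
    fix x p q assume "p \<in> P" "q \<in> Q"
    then have "norm (f x p q) \<le> R * (1 + norm x)" by (rule R)
    also have "\<dots> \<le> max R 0 * (1 + norm x)" by (intro mult_right_mono) auto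
    finally show "norm (f x p q) \<le> max R 0 * (1 + norm x)" .
  next
    fix x y p q assume "p \<in> P" "q \<in> Q"
    then show "norm (f x p q - f y p q) \<le> lam' * norm (x - y)" using lip[of p q x y] by simp
  next
    fix x y
    show "\<bar>g x - g y\<bar> \<le> lam' * norm (x - y)"
      using lip[OF pq, of x y] norm_ge_zero[of "f x p0 q0 - f y p0 q0"] by linarith
  next
    fix x assume "x \<in> frontier M1"
    then have "0 \<le> \<sigma> x" "\<sigma> x \<le> ereal \<Sigma>" using A5_bound(2) by blast+
    then show "0 \<le> \<sigma> x \<and> \<sigma> x \<noteq> \<infinity>" by auto
  next
    fix \<epsilon> x assume "0 < \<epsilon>" "\<epsilon> < min \<epsilon>s \<delta>" "x \<in> closure (game_region M1 M2)" "x \<notin> boundary_nbhd M2 \<epsilon>"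
    then have "0 \<le> sh \<epsilon> x" "sh \<epsilon> x \<le> ereal \<Sigma>" using ext by simp_all
    then show "0 \<le> sh \<epsilon> x \<and> sh \<epsilon> x \<noteq> \<infinity>" by auto
  qed (use P Q M1 M2 A3 A5_infty L b \<epsilon>s \<delta> ext in \<open>auto simp: lam'_def intro: min.coboundedI2\<close>)
  have u: "minimax_solution P Q f g (game_region M1 M2) (\<lambda>x. kruzhkov (\<sigma> x)) u"
    using unique_solution unfolding unique_minimax_solution_def G by blast
  show ?thesis
    using minimax_solution_value[OF u] unfolding G by blast
qed

end
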